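(* Let $Y^{(1)}_{\alpha_1}$ and $Y^{(2)}_{\alpha_2}$ be two independent inverse stable subordinators with indices $\alpha_1,\alpha_2\in(0,1)$, let $\mathcal{G}$ be the $\sigma$-algebra they generate, let $\mu_{\boldsymbol{\alpha}}$ be the associated random product measure on $\mathbb{R}_+^2$, and let $\lambda>0$. A random simple locally finite counting measure $N_{\alpha_1,\alpha_2}$ on $\mathbb{R}_+^2$ is a fractional Poisson random field (FPRF) with parameter $\lambda$ if and only if, conditioned on $\mathcal{G}$, the process $N_{\alpha_1,\alpha_2}\circ\Gamma$ is a one-parameter inhomogeneous Poisson process with (cumulative) intensity $\lambda(\mu_{\boldsymbol{\alpha}}\circ\Gamma)$, for any increasing set $\Gamma$ independent of $\mathcal{G}$.
   Context: An inverse $\alpha$-stable subordinator, $\alpha\in(0,1)$, is $Y_\alpha(t)=\inf\{u\ge 0:L_\alpha(u)>t\}$ with $L_\alpha$ a Lévy subordinator with $\mathrm{E}e^{-sL_\alpha(t)}=e^{-ts^\alpha}$. Since $Y^{(i)}_{\alpha_i}$ is continuous and nondecreasing, it defines a random measure $\mu_{\alpha_i}$ on $\mathbb{R}_+$ by $\mu_{\alpha_i}([0,t])=Y^{(i)}_{\alpha_i}(t)$. Put $\mathcal{G}_i=\sigma(Y^{(i)}_{\alpha_i}(t),t\ge 0)$, $\mathcal{G}=\sigma(\mathcal{G}_1,\mathcal{G}_2)$, $\mu_{\boldsymbol{\alpha}}=\mu_{\alpha_1}\otimes\mu_{\alpha_2}$. A Poisson random field (PRF) with intensity $\lambda>0$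 is a field $N(t_1,t_2)$ on $\mathbb{R}_+^2$ given by a homogeneous Poisson point process of intensity $\lambda$ with respect to Lebesgue measure. $N_{\alpha_1,\alpha_2}$ is an FPRF if $N_{\alpha_1,\alpha_2}(t_1,t_2)=N(Y^{(1)}_{\alpha_1}(t_1),Y^{(2)}_{\alpha_2}(t_2))$ for $(t_1,t_2)\in\mathbb{R}_+^2$, with $N$ a PRF with intensity $\lambda$ independent of $(Y^{(1)}_{\alpha_1},Y^{(2)}_{\alpha_2})$; it is identified with the corresponding random counting measure, $N_{\alpha_1,\alpha_2}(t_1,t_2)=N_{\alpha_1,\alpha_2}([0,t_1]\times[0,t_2])$. Let $A_{t_1,t_2}=[0,t_1]\times[0,t_2]$. The lower set family $\widetilde{\mathcal{A}}(u)$ is the family of closed sets $A\subseteq\mathbb{R}_+^2$ such that $A_{t_1,t_2}\subseteq A$ for all $(t_1,t_2)\in A$. A function $\Gamma:\mathbb{R}_+\to\widetilde{\mathcal{A}}(u)$ is an increasing set if $\Gamma(0)=\{(0,0)\}$, it is continuous, it is non-decreasing ($s\le t\Rightarrow\Gamma(s)\subseteq\Gamma(t)$), the area $|\Gamma(t)|$ is finite for any $t$, and $\lim_{t\to\infty}|\Gamma(t)|=\infty$. For a (random) measure $\mu$ on $\mathbb{R}_+^2$, $(\mu\circ\Gamma)(t)=\mu(\Gamma(t))$; likewise $(N\circ\Gamma)(t)=N(\Gamma(t))$. "Conditioned on $\mathcal{G}$, $N\circ\Gamma$ is an inhomogeneous Poisson process with intensity $m$" (with $m$ a $\mathcal{G}$-measurable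 nondecreasing function) means that, conditionally on $\mathcal{G}$, the increments of $N\circ\Gamma$ over disjoint intervals $(s_i,t_i]$ are independent and Poisson distributed with means $m(t_i)-m(s_i)$.
   Formalization: "Poisson process" here also requires N∘Γ to start at 0 almost surely; with conditions on increments only, an FPRF plus a unit atom at (0,0) would refute the "if" part. Increasing sets Γ are taken deterministic, as in their definition. *)

theory Defs
  imports "HOL-Probability.Probability"
begin

section \<open>Inverse stable subordinators\<close>

text \<open>
  A process on \<open>M\<close> with time set \<open>[0,\<infinity>)\<close> is a function \<open>real \<Rightarrow> 'w \<Rightarrow> real\<close>; its values at negative
  times are never used.
\<close>

definition stable_subordinator :: "'w measure \<Rightarrow> real \<Rightarrow> (real \<Rightarrow> 'w \<Rightarrow> real) \<Rightarrow> bool" where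
  "stable_subordinator M \<alpha> L \<longleftrightarrow>
     (\<forall>t\<ge>0. L t \<in> borel_measurable M) \<and>
     (AE \<omega> in M. L 0 \<omega> = 0 \<and> mono_on {0..} (\<lambda>t. L t \<omega>) \<and>
                 (\<forall>t\<ge>0. continuous (at_right t) (\<lambda>t. L t \<omega>))) \<and>
     (\<forall>(n::nat) (t::nat \<Rightarrow> real). 0 \<le> t 0 \<and> (\<forall>i<n. t i \<le> t (Suc i)) \<longrightarrow>
        prob_space.indep_vars M (\<lambda>_. borel) (\<lambda>i \<omega>. L (t (Suc i)) \<omega> - L (t i) \<omega>) {..<n}) \<and>
     (\<forall>t\<ge>0. \<forall>h\<ge>0. distr M borel (\<lambda>\<omega>. L (t + h) \<omega> - L t \<omega>) = distr M borel (L h)) \<and>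
     (\<forall>t\<ge>0. \<forall>s\<ge>0. prob_space.expectation M (\<lambda>\<omega>. exp (- s * L t \<omega>)) = exp (- t * s powr \<alpha>))"

text \<open>
  First passage times of a stable subordinator are almost surely real-valued, continuous and
  nondecreasing in \<open>t\<close>, with value \<open>0\<close> at \<open>0\<close>. As usual we work with the version for which this holds
  for all \<open>\<omega>\<close>, so that every path defines a measure; the first passage formula then holds
  almost surely, simultaneously for all \<open>t\<close>.
\<close>

definition inverse_stable_subordinator :: "'w measure \<Rightarrow> real \<Rightarrow> (real \<Rightarrow> 'w \<Rightarrow> real) \<Rightarrow> bool" where
  "inverse_stable_subordinator M \<alpha> Y \<longleftrightarrow>
     (\<forall>t\<ge>0. Y t \<in> borel_measurable M) \<and>
     (\<forall>\<omega>\<in>space M. Y 0 \<omega> = 0 \<and> continuous_on {0..} (\<lambda>t. Y t \<omega>) \<and> mono_on {0..} (\<lambda>t. Y t \<omega>)) \<and>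
     (\<exists>L. stable_subordinator M \<alpha> L \<and>
          (AE \<omega> in M. \<forall>t\<ge>0. Y t \<omega> = Inf {u. 0 \<le> u \<and> t < L u \<omega>}))"

definition process_algebra :: "'w measure \<Rightarrow> (real \<Rightarrow> 'w \<Rightarrow> real) \<Rightarrow> 'w measure" where
  "process_algebra M Y = sigma (space M) {Y t -` B \<inter> space M | t B. 0 \<le> t \<and> B \<in> sets borel}"

definition joint_algebra ::
    "'w measure \<Rightarrow> (real \<Rightarrow> 'w \<Rightarrow> real) \<Rightarrow> (real \<Rightarrow> 'w \<Rightarrow> real) \<Rightarrow> 'w measure" where
  "joint_algebra M Y1 Y2 =
     sigma (space M) (sets (process_algebra M Y1) \<union> sets (process_algebra M Y2))"

text \<open>
  The measure on the line determined by \<open>[0,t] \<mapsto> Y t \<omega>\<close>; the path is extended by \<open>Y 0 \<omega> = 0\<close> to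
  negative times, so that no mass is put on \<open>(-\<infinity>,0]\<close>.
\<close>

definition path_measure :: "(real \<Rightarrow> 'w \<Rightarrow> real) \<Rightarrow> 'w \<Rightarrow> real measure" where
  "path_measure Y \<omega> = interval_measure (\<lambda>t. Y (max 0 t) \<omega>)"

definition product_path_measure ::
    "(real \<Rightarrow> 'w \<Rightarrow> real) \<Rightarrow> (real \<Rightarrow> 'w \<Rightarrow> real) \<Rightarrow> 'w \<Rightarrow> (real \<times> real) measure" where
  "product_path_measure Y1 Y2 \<omega> = path_measure Y1 \<omega> \<Otimes>\<^sub>M path_measure Y2 \<omega>"


section \<open>Random counting measures and Poisson random fields\<close>

definition quadrant :: "(real \<times> real) set" where
  "quadrant = {0..} \<times> {0..}"

text \<open>Measures on the quadrant are Borel measures on the plane that vanish off the quadrant.\<close>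

definition counting_measure :: "(real \<times> real) measure \<Rightarrow> bool" where
  "counting_measure \<nu> \<longleftrightarrow> sets \<nu> = sets borel \<and> emeasure \<nu> (- quadrant) = 0 \<and>
     (\<forall>B\<in>sets borel. emeasure \<nu> B \<in> range of_nat \<union> {\<infinity>})"

definition locally_finite_measure :: "(real \<times> real) measure \<Rightarrow> bool" where
  "locally_finite_measure \<nu> \<longleftrightarrow> (\<forall>B\<in>sets borel. bounded B \<longrightarrow> emeasure \<nu> B < \<infinity>)"

definition simple_measure :: "(real \<times> real) measure \<Rightarrow> bool" where
  "simple_measure \<nu> \<longleftrightarrow> (\<forall>x. emeasure \<nu> {x} \<le> 1)"

definition random_counting_measure :: "'w measure \<Rightarrow> ('w \<Rightarrow> (real \<times> real) measure) \<Rightarrow> bool" where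
  "random_counting_measure M N \<longleftrightarrow>
     (\<forall>\<omega>\<in>space M. counting_measure (N \<omega>) \<and> locally_finite_measure (N \<omega>)) \<and>
     (\<forall>B\<in>sets borel. (\<lambda>\<omega>. emeasure (N \<omega>) B) \<in> borel_measurable M)"

definition random_simple_counting_measure ::
    "'w measure \<Rightarrow> ('w \<Rightarrow> (real \<times> real) measure) \<Rightarrow> bool" where
  "random_simple_counting_measure M N \<longleftrightarrow>
     random_counting_measure M N \<and> (\<forall>\<omega>\<in>space M. simple_measure (N \<omega>))"

definition field_algebra :: "'w measure \<Rightarrow> ('w \<Rightarrow> (real \<times> real) measure) \<Rightarrow> 'w measure" where
  "field_algebra M N = sigma (space M)
     {(\<lambda>\<omega>. emeasure (N \<omega>) B) -` C \<inter> space M | B C. B \<in> sets borel \<and> C \<in> sets borel}"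

text \<open>
  The Poisson law with mean \<open>r \<in> [0,\<infinity>]\<close>, carried by the extended naturals inside \<^typ>\<open>ennreal\<close>.
  The library only has positive finite means; the laws with mean \<open>0\<close> and \<open>\<infinity>\<close> are the point
  masses at \<open>0\<close> and \<open>\<infinity>\<close>.
\<close>

definition poisson_law :: "ennreal \<Rightarrow> ennreal pmf" where
  "poisson_law r =
     (if r = 0 then return_pmf 0
      else if r = \<infinity> then return_pmf \<infinity>
      else map_pmf of_nat (poisson_pmf (enn2real r)))"

definition poisson_random_field ::
    "'w measure \<Rightarrow> real \<Rightarrow> ('w \<Rightarrow> (real \<times> real) measure) \<Rightarrow> bool" where
  "poisson_random_field M r N \<longleftrightarrow>
     random_counting_measure M N \<and>
     (\<forall>B\<in>sets borel. B \<subseteq> quadrant \<longrightarrow>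
        (\<forall>C\<in>sets borel. measure M {\<omega>\<in>space M. emeasure (N \<omega>) B \<in> C} =
           measure_pmf.prob (poisson_law (ennreal r * emeasure lborel B)) C)) \<and>
     (\<forall>(n::nat) B. (\<forall>i<n. B i \<in> sets borel \<and> B i \<subseteq> quadrant) \<and> disjoint_family_on B {..<n} \<longrightarrow>
        prob_space.indep_vars M (\<lambda>_. borel) (\<lambda>i \<omega>. emeasure (N \<omega>) (B i)) {..<n})"

text \<open>
  The random measure \<open>N\<close> and its time-changed counterpart \<open>N'\<close> are compared through
  \<open>N(t\<^sub>1,t\<^sub>2) = N([0,t\<^sub>1] \<times> [0,t\<^sub>2])\<close>; as usual for random fields, equality is almost sure,
  here simultaneously in \<open>(t\<^sub>1,t\<^sub>2)\<close>.
\<close>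

definition fractional_poisson_random_field ::
    "'w measure \<Rightarrow> (real \<Rightarrow> 'w \<Rightarrow> real) \<Rightarrow> (real \<Rightarrow> 'w \<Rightarrow> real) \<Rightarrow> real \<Rightarrow>
     ('w \<Rightarrow> (real \<times> real) measure) \<Rightarrow> bool" where
  "fractional_poisson_random_field M Y1 Y2 r N' \<longleftrightarrow>
     (\<exists>N. poisson_random_field M r N \<and>
          prob_space.indep_set M (sets (field_algebra M N)) (sets (joint_algebra M Y1 Y2)) \<and>
          (AE \<omega> in M. \<forall>t1\<ge>0. \<forall>t2\<ge>0.
             emeasure (N' \<omega>) ({0..t1} \<times> {0..t2}) =
             emeasure (N \<omega>) ({0..Y1 t1 \<omega>} \<times> {0..Y2 t2 \<omega>})))"


section \<open>Increasing sets\<close>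

definition lower_set_family :: "(real \<times> real) set set" where
  "lower_set_family =
     {A. closed A \<and> A \<subseteq> quadrant \<and> (\<forall>t1 t2. (t1, t2) \<in> A \<longrightarrow> {0..t1} \<times> {0..t2} \<subseteq> A)}"

text \<open>
  Continuity of a nondecreasing family of closed sets is meant in the sense customary for flows of
  lower sets: \<open>\<Gamma>(t)\<close> is the intersection of the later sets and the closure of the union of the
  earlier ones. Only the values of \<open>\<Gamma>\<close> on \<open>[0,\<infinity>)\<close> matter.
\<close>

definition increasing_set :: "(real \<Rightarrow> (real \<times> real) set) \<Rightarrow> bool" where
  "increasing_set \<Gamma> \<longleftrightarrow>
     (\<forall>t\<ge>0. \<Gamma> t \<in> lower_set_family) \<and>
     \<Gamma> 0 = {(0, 0)} \<and>
     (\<forall>t\<ge>0. \<Gamma> t = (\<Inter>u\<in>{t<..}. \<Gamma> u)) \<and>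
     (\<forall>t>0. \<Gamma> t = closure (\<Union>u\<in>{0..<t}. \<Gamma> u)) \<and>
     (\<forall>s t. 0 \<le> s \<and> s \<le> t \<longrightarrow> \<Gamma> s \<subseteq> \<Gamma> t) \<and>
     (\<forall>t\<ge>0. emeasure lborel (\<Gamma> t) < \<infinity>) \<and>
     ((\<lambda>t. emeasure lborel (\<Gamma> t)) \<longlongrightarrow> \<infinity>) at_top"


section \<open>Conditionally Poisson processes\<close>

definition conditional_prob :: "'w measure \<Rightarrow> 'w measure \<Rightarrow> 'w set \<Rightarrow> 'w \<Rightarrow> real" where
  "conditional_prob M G A = real_cond_exp M G (indicator A)"

definition conditionally_indep_vars ::
    "'w measure \<Rightarrow> 'w measure \<Rightarrow> ('i \<Rightarrow> 'w \<Rightarrow> ennreal) \<Rightarrow> 'i set \<Rightarrow> bool" where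
  "conditionally_indep_vars M G X I \<longleftrightarrow>
     (\<forall>i\<in>I. X i \<in> borel_measurable M) \<and>
     (\<forall>J C. J \<subseteq> I \<and> finite J \<and> (\<forall>i\<in>J. C i \<in> sets borel) \<longrightarrow>
        (AE \<omega> in M. conditional_prob M G {x\<in>space M. \<forall>i\<in>J. X i x \<in> C i} \<omega> =
           (\<Prod>i\<in>J. conditional_prob M G {x\<in>space M. X i x \<in> C i} \<omega>)))"

definition conditionally_poisson ::
    "'w measure \<Rightarrow> 'w measure \<Rightarrow> ('w \<Rightarrow> ennreal) \<Rightarrow> ('w \<Rightarrow> ennreal) \<Rightarrow> bool" where
  "conditionally_poisson M G X r \<longleftrightarrow>
     (\<forall>C\<in>sets borel. AE \<omega> in M.
        conditional_prob M G {x\<in>space M. X x \<in> C} \<omega> = measure_pmf.prob (poisson_law (r \<omega>)) C)"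

text \<open>
  Poisson processes start at \<open>0\<close>. The values of \<open>X\<close> and of the cumulative intensity \<open>m\<close> may be
  infinite: an increasing set of finite area may be unbounded, and then have infinite mass for the
  random product measure. Since \<open>\<infinity> - x = \<infinity>\<close> in \<^typ>\<open>ennreal\<close> for all \<open>x\<close> (including \<open>\<infinity>\<close>), once
  \<open>m s = \<infinity>\<close> the condition on an increment over \<open>(s,t]\<close> only says that it is \<open>\<infinity>\<close> almost surely.
\<close>

definition conditionally_poisson_process ::
    "'w measure \<Rightarrow> 'w measure \<Rightarrow> (real \<Rightarrow> 'w \<Rightarrow> ennreal) \<Rightarrow> (real \<Rightarrow> 'w \<Rightarrow> ennreal) \<Rightarrow> bool" where
  "conditionally_poisson_process M G X m \<longleftrightarrow>
     (\<forall>t\<ge>0. m t \<in> borel_measurable G) \<and>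
     (\<forall>\<omega>\<in>space M. mono_on {0..} (\<lambda>t. m t \<omega>)) \<and>
     (AE \<omega> in M. X 0 \<omega> = 0) \<and>
     (\<forall>(n::nat) s t. (\<forall>i<n. 0 \<le> s i \<and> s i < t i) \<and>
          disjoint_family_on (\<lambda>i. {s i<..t i}) {..<n} \<longrightarrow>
        conditionally_indep_vars M G (\<lambda>i \<omega>. X (t i) \<omega> - X (s i) \<omega>) {..<n} \<and>
        (\<forall>i<n. conditionally_poisson M G
           (\<lambda>\<omega>. X (t i) \<omega> - X (s i) \<omega>) (\<lambda>\<omega>. m (t i) \<omega> - m (s i) \<omega>)))"

end

theory Submission
  imports Defs
begin

text \<open>
  Write \<open>S\<close> for the clock \<open>(t\<^sub>1, t\<^sub>2) \<mapsto> (Y\<^sub>1 t\<^sub>1, Y\<^sub>2 t\<^sub>2)\<close>; it maps \<open>\<mu>\<close> to Lebesgue measure on the quadrant,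
  because the paths are continuous and almost surely unbounded.

  If \<open>N\<close> is a time change of a Poisson field \<open>N\<^sub>0\<close>, then it is almost surely the image of \<open>N\<^sub>0\<close> under
  the generalised inverse of \<open>S\<close>, and since \<open>N\<^sub>0\<close> is independent of \<open>\<G>\<close> the inverse may be frozen
  when conditioning on \<open>\<G>\<close>.

  Conversely, the hull of a continuous curve issuing from the origin is an increasing set, and a
  suitable curve picks up the cells of a dyadic grid one at a time. Hence the cell counts are
  conditionally independent Poisson variables, which is the formula
  \<open>E (1\<^sub>H exp (- N f)) = E (1\<^sub>H exp (- r \<mu> (1 - exp (- f))))\<close>, \<open>H \<in> \<G>\<close>, for random dyadic step functions \<open>f\<close>.
  Both sides are stable under bounded pointwise limits of \<open>f\<close>, so the formula holds for all random
  \<open>f = \<Sum>\<^sub>i c\<^sub>i 1\<^bsub>D i\<^esub>\<close>. Taking \<open>D i = S\<^sup>-\<^sup>1 (B i)\<close> and inverting the Laplace transform, the image of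
  \<open>N\<close> under \<open>S\<close> is a Poisson field independent of \<open>\<G>\<close>. Taking for \<open>D\<close> the points to the right of or
  above which \<open>S\<close> is stationary, a \<open>\<mu>\<close>-null set, \<open>N\<close> is recovered from its image.
\<close>


section \<open>Laplace transforms of counting variables\<close>

text \<open>The definition of a fractional field asks for a Poisson field on \<open>M\<close>
  itself, independent of the clock, and no further randomness is at hand. The image of
  \<open>N\<close> under the clock is the only natural candidate. Testing its law on a set
  \<open>B\<close> means counting \<open>N\<close> on the preimage of \<open>B\<close>, a set that
  moves with \<omega>; hence the Laplace formula has to cover functions of (\<omega>, x) that are
  random through \<open>G\<close>, although the hypothesis speaks of deterministic increasing sets
  only.

  The hypothesis gives joint laws only along one increasing set at a time. All cells of a grid must
  therefore be exhausted by a single one, and this is what the excursions from the origin to the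
  successive grid corners achieve.

  Infinite values cannot be avoided: an unbounded set of finite area may have infinite mass. Counts
  and intensities stay in \<open>ennreal\<close> throughout. A Laplace transform at c > 0 does not
  see the value \<infinity>; its value at c = 0 is the total mass, and that is how the mass at
  \<infinity> is recovered.\<close>

definition exp_neg :: "ennreal \<Rightarrow> ennreal" where
  "exp_neg x = (if x = \<infinity> then 0 else ennreal (exp (- enn2real x)))"

lemma exp_neg_ennreal: "0 \<le> x \<Longrightarrow> exp_neg (ennreal x) = ennreal (exp (- x))"
  by (simp add: exp_neg_def)

lemma exp_neg_0 [simp]: "exp_neg 0 = 1"
  and exp_neg_top [simp]: "exp_neg \<top> = 0"
  by (auto simp: exp_neg_def)

lemma exp_neg_le_1: "exp_neg x \<le> 1"
  by (auto simp: exp_neg_def)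

lemma exp_neg_add: "exp_neg (x + y) = exp_neg x * exp_neg y"
  by (cases x; cases y)
     (auto simp: exp_neg_ennreal exp_add[symmetric] simp flip: ennreal_plus ennreal_mult)

lemma exp_neg_sum: "exp_neg (sum f A) = (\<Prod>i\<in>A. exp_neg (f i))"
  by (induction A rule: infinite_finite_induct) (auto simp: exp_neg_add)

lemma exp_neg_eq_1_iff: "exp_neg x = 1 \<longleftrightarrow> x = 0"
  by (cases x) (auto simp: exp_neg_ennreal simp flip: ennreal_1)

lemma exp_neg_power: "0 \<le> c \<Longrightarrow> exp_neg (ennreal c * of_nat k) = ennreal (exp (- c)) ^ k"
  by (simp add: ennreal_of_nat_eq_real_of_nat exp_neg_ennreal ennreal_power exp_of_nat_mult[symmetric]
      mult.commute flip: ennreal_mult)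

lemma borel_measurable_exp_neg [measurable]: "exp_neg \<in> borel_measurable borel"
  unfolding exp_neg_def by measurable

text \<open>Continuity at \<infinity> is the point: it allows bounded boxes to increase to the
  quadrant even where the limiting count is infinite.\<close>

lemma tendsto_exp_neg:
  assumes "(f \<longlongrightarrow> l) F"
  shows "((\<lambda>x. exp_neg (f x)) \<longlongrightarrow> exp_neg l) F"
proof (cases l)
  case (real r)
  have "eventually (\<lambda>x. f x < top) F"
    using assms real by (intro order_tendstoD(2)[of f l]) auto
  moreover have "((\<lambda>x. ennreal (exp (- enn2real (f x)))) \<longlongrightarrow> ennreal (exp (- r))) F"
    using assms real by (intro tendsto_intros tendsto_enn2real) auto
  ultimately show ?thesis
    unfolding real exp_neg_ennreal[OF real(1)]
    by (auto intro: Lim_transform_eventually elim!: eventually_mono simp: exp_neg_def simp del: ennreal_inj tendsto_ennreal_iff)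
next
  case top
  have "((\<lambda>x. exp_neg (f x)) \<longlongrightarrow> 0) F"
  proof (rule order_tendstoI)
    fix a :: ennreal assume "0 < a"
    then obtain b where b: "0 < b" "ennreal b < a"
      by (metis ennreal_less_zero_iff ennreal_0 dense not_less ennreal_cases top_greatest leD)
    \<comment> \<open>Beyond - ln b the exponential is below b; the maximum with 0 keeps the
      threshold from being truncated by \<open>ennreal\<close>.\<close>
    have "eventually (\<lambda>x. ennreal (max 0 (- ln b)) < f x) F"
      using assms top by (intro order_tendstoD(1)[of f l]) auto
    then show "eventually (\<lambda>x. exp_neg (f x) < a) F"
    proof eventually_elim
      case (elim x)
      show ?case
      proof (cases "f x")
        case (real s)
        then have "- s < ln b" using elim by (auto simp: ennreal_less_iff max_def split: if_splits)
        then have "exp (- s) < b" using b by (metis exp_ln exp_less_cancel_iff)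
        then show ?thesis using real b by (simp add: exp_neg_ennreal) (meson ennreal_leI le_less_trans less_imp_le)
      qed (use \<open>0 < a\<close> in auto)
    qed
  qed auto
  then show ?thesis using top by simp
qed

text \<open>Dividing by the power of z that belongs to the first nonzero coefficient and letting z
  decrease to 0 would make that coefficient vanish. Only the interval (0,1) is assumed, because the
  argument will be z = exp (- c) with c > 0.\<close>

lemma powser_unique_pos:
  fixes a :: "nat \<Rightarrow> real"
  assumes "\<And>z. 0 < z \<Longrightarrow> z < 1 \<Longrightarrow> (\<lambda>n. a n * z ^ n) sums 0"
  shows "a n = 0"
proof (rule ccontr)
  assume "a n \<noteq> 0"
  define m where "m = (LEAST n. a n \<noteq> 0)"
  have m: "a m \<noteq> 0" "\<And>k. k < m \<Longrightarrow> a k = 0"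
    using \<open>a n \<noteq> 0\<close> LeastI[of "\<lambda>n. a n \<noteq> 0" n] not_less_Least unfolding m_def by blast+
  define f where "f z = (\<Sum>k. a (k + m) * z ^ k)" for z :: real
  have s0: "(\<lambda>k. a (k + m) * z ^ k) sums 0" if z: "0 < z" "z < 1" for z
  proof -
    have "(\<lambda>k. a (k + m) * z ^ (k + m)) sums (0 - (\<Sum>i<m. a i * z ^ i))"
      by (rule sums_split_initial_segment[OF assms[OF z]])
    then have "(\<lambda>k. a (k + m) * z ^ (k + m)) sums 0" using m by simp
    from sums_divide[OF this, of "z ^ m"] show ?thesis using z by (simp add: power_add)
  qed
  \<comment> \<open>Convergence at the single point 1/2 gives a power series on a disc about 0,
    whose limit at 0 is its constant term.\<close>
  have "summable (\<lambda>k. a (k + m) * (1/2) ^ k)" using s0[of "1/2"] by (auto simp: sums_iff)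
  then have "\<And>x. norm x < 1/2 \<Longrightarrow> (\<lambda>k. a (k + m) * x ^ k) sums f x"
    unfolding f_def by (intro summable_sums) (rule powser_inside, auto)
  then have "(f \<longlongrightarrow> a (0 + m)) (at 0)"
    by (intro powser_limit_0[of "1/2"]) auto
  then have "(f \<longlongrightarrow> a m) (at_right 0)" by (simp add: filterlim_at_split)
  moreover have "eventually (\<lambda>z. 0 = f z) (at_right 0)"
    using eventually_at_right_less[of 0] eventually_at_right_real[OF zero_less_one]
    by eventually_elim (use s0 in \<open>auto simp: f_def sums_iff\<close>)
  then have "(f \<longlongrightarrow> 0) (at_right 0)"
    by (rule Lim_transform_eventually[OF tendsto_const])
  ultimately have "a m = 0" using tendsto_unique by (metis trivial_limit_at_right_real)
  with m show False by simp
qed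

text \<open>The value \<infinity> gets a summand of its own, since a series over the naturals does
  not reach it.\<close>

lemma nn_integral_extended_nat:
  fixes X :: "'a \<Rightarrow> ennreal"
  assumes [measurable]: "X \<in> borel_measurable M" "W \<in> borel_measurable M"
    and X: "\<And>x. x \<in> space M \<Longrightarrow> X x \<in> range of_nat \<union> {\<infinity>}"
  shows "(\<integral>\<^sup>+x. W x * h (X x) \<partial>M) =
    (\<Sum>k. (\<integral>\<^sup>+x. W x * indicator {of_nat k} (X x) \<partial>M) * h (of_nat k)) +
      (\<integral>\<^sup>+x. W x * indicator {\<infinity>} (X x) \<partial>M) * h \<infinity>"
proof -
  have eq: "W x * h (X x) = (\<Sum>k. W x * indicator {of_nat k} (X x) * h (of_nat k)) + W x * indicator {\<infinity>} (X x) * h \<infinity>"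
    if x: "x \<in> space M" for x
  proof (cases "X x = \<infinity>")
    case True
    then show ?thesis by (simp add: indicator_def)
  next
    case False
    then obtain k where k: "X x = of_nat k" using X[OF x] by auto
    have "(\<lambda>j. W x * indicator {of_nat j} (X x) * h (of_nat j)) sums (\<Sum>j\<in>{k}. W x * indicator {of_nat j} (X x) * h (of_nat j))"
      by (rule sums_finite) (auto simp: k)
    then show ?thesis using k by (simp add: sums_iff)
  qed
  have "(\<integral>\<^sup>+x. W x * h (X x) \<partial>M) = (\<integral>\<^sup>+x. (\<Sum>k. W x * indicator {of_nat k} (X x) * h (of_nat k)) + W x * indicator {\<infinity>} (X x) * h \<infinity> \<partial>M)"
    by (rule nn_integral_cong) (rule eq)
  also have "\<dots> = (\<integral>\<^sup>+x. (\<Sum>k. W x * indicator {of_nat k} (X x) * h (of_nat k)) \<partial>M) + (\<integral>\<^sup>+x. W x * indicator {\<infinity>} (X x) * h \<infinity> \<partial>M)"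
    by (rule nn_integral_add) measurable
  also have "\<dots> = (\<Sum>k. (\<integral>\<^sup>+x. W x * indicator {of_nat k} (X x) * h (of_nat k) \<partial>M)) + (\<integral>\<^sup>+x. W x * indicator {\<infinity>} (X x) * h \<infinity> \<partial>M)"
    by (subst nn_integral_suminf) auto
  finally show ?thesis by (simp add: nn_integral_multc)
qed

text \<open>In the variable z = exp (- c) both transforms are power series, so their coefficients
  agree; the coefficients are the weighted masses of the events that the variable equals k. Two
  measure spaces are allowed so that a random variable can also be compared with a law given as a
  \<open>pmf\<close>.\<close>

lemma laplace_inversion_one:
  fixes X :: "'a \<Rightarrow> ennreal" and X' :: "'b \<Rightarrow> ennreal"
  assumes [measurable]: "X \<in> borel_measurable M" "W \<in> borel_measurable M"
      "X' \<in> borel_measurable M'" "W' \<in> borel_measurable M'"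
    and X: "\<And>x. x \<in> space M \<Longrightarrow> X x \<in> range of_nat \<union> {\<infinity>}"
    and X': "\<And>x. x \<in> space M' \<Longrightarrow> X' x \<in> range of_nat \<union> {\<infinity>}"
    and fin: "(\<integral>\<^sup>+x. W x \<partial>M) < \<infinity>" "(\<integral>\<^sup>+x. W' x \<partial>M') < \<infinity>"
    and eq: "\<And>c. 0 \<le> c \<Longrightarrow> (\<integral>\<^sup>+x. W x * exp_neg (ennreal c * X x) \<partial>M) = (\<integral>\<^sup>+x. W' x * exp_neg (ennreal c * X' x) \<partial>M')"
  shows "(\<integral>\<^sup>+x. W x * h (X x) \<partial>M) = (\<integral>\<^sup>+x. W' x * h (X' x) \<partial>M')"
proof -
  define a where "a k = (\<integral>\<^sup>+x. W x * indicator {of_nat k} (X x) \<partial>M)" for k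
  define b where "b k = (\<integral>\<^sup>+x. W' x * indicator {of_nat k} (X' x) \<partial>M')" for k
  define A where "A = (\<integral>\<^sup>+x. W x * indicator {\<infinity>} (X x) \<partial>M)"
  define B where "B = (\<integral>\<^sup>+x. W' x * indicator {\<infinity>} (X' x) \<partial>M')"
  note expand = nn_integral_extended_nat[where X=X and W=W and M=M, OF _ _ X, folded a_def A_def, simplified]
    nn_integral_extended_nat[where X=X' and W=W' and M=M', OF _ _ X', folded b_def B_def, simplified]
  have le: "a k \<le> (\<integral>\<^sup>+x. W x \<partial>M)" "b k \<le> (\<integral>\<^sup>+x. W' x \<partial>M')" for k
    unfolding a_def b_def by (auto intro!: nn_integral_mono simp: indicator_def)
  then have fa: "a k < \<infinity>" "b k < \<infinity>" for k
    using fin le_less_trans[of "a k" "integral\<^sup>N M W"] le_less_trans[of "b k" "integral\<^sup>N M' W'"] by auto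
  \<comment> \<open>A common bound for all coefficients, by which both series are dominated by a
    geometric one.\<close>
  define C where "C = max (enn2real (\<integral>\<^sup>+x. W x \<partial>M)) (enn2real (\<integral>\<^sup>+x. W' x \<partial>M'))"
  have Ca: "enn2real (a k) \<le> C" "enn2real (b k) \<le> C" for k
    unfolding C_def using le[of k] fin by (auto intro: max.coboundedI1 max.coboundedI2 enn2real_mono)
  have "enn2real (a k) - enn2real (b k) = 0" for k
  proof (rule powser_unique_pos[where a="\<lambda>k. enn2real (a k) - enn2real (b k)"])
    fix z :: real assume z: "0 < z" "z < 1"
    have su: "summable (\<lambda>k. enn2real (a k) * z ^ k)" "summable (\<lambda>k. enn2real (b k) * z ^ k)"
      by (rule summable_comparison_test'[where g="\<lambda>k. C * z ^ k" and N=0];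
          use z Ca in \<open>auto intro!: summable_mult summable_geometric mult_right_mono simp: abs_mult\<close>)+
    have pw: "exp_neg (ennreal (- ln z) * of_nat k) = ennreal (z ^ k)" for k
      using z by (subst exp_neg_power) (auto simp: ennreal_power)
    \<comment> \<open>Since - ln z > 0, the value \<infinity> is weighted with
      \<open>exp_neg\<close> \<infinity> = 0 and drops out of both sides.\<close>
    have top: "ennreal (- ln z) * \<top> = \<top>" using z by (simp add: ennreal_mult_top)
    have "(\<Sum>k. a k * ennreal (z ^ k)) = (\<Sum>k. b k * ennreal (z ^ k))"
      using eq[of "- ln z"] z expand(1)[where h="\<lambda>y. exp_neg (ennreal (- ln z) * y)"]
        expand(2)[where h="\<lambda>y. exp_neg (ennreal (- ln z) * y)"]
      by (simp add: pw top)
    also have "(\<Sum>k. a k * ennreal (z ^ k)) = (\<Sum>k. ennreal (enn2real (a k) * z ^ k))"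
      using fa z by (intro suminf_cong) (simp add: ennreal_mult)
    also have "\<dots> = ennreal (\<Sum>k. enn2real (a k) * z ^ k)"
      using su z by (intro suminf_ennreal2) auto
    also have "(\<Sum>k. b k * ennreal (z ^ k)) = (\<Sum>k. ennreal (enn2real (b k) * z ^ k))"
      using fa z by (intro suminf_cong) (simp add: ennreal_mult)
    also have "\<dots> = ennreal (\<Sum>k. enn2real (b k) * z ^ k)"
      using su z by (intro suminf_ennreal2) auto
    finally have "(\<Sum>k. enn2real (a k) * z ^ k) = (\<Sum>k. enn2real (b k) * z ^ k)"
      using su z by (subst (asm) ennreal_inj) (auto intro!: suminf_nonneg)
    with sums_diff[OF summable_sums[OF su(1)] summable_sums[OF su(2)]]
    show "(\<lambda>k. (enn2real (a k) - enn2real (b k)) * z ^ k) sums 0" by (simp add: left_diff_distrib)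
  qed
  then have ab: "a k = b k" for k
    using fa[of k] by (metis eq_iff_diff_eq_0 ennreal_enn2real infinity_ennreal_def)
  \<comment> \<open>At c = 0 the transform is the total mass, so the masses at \<infinity> agree
    once the finite sums of the equal coefficients are cancelled.\<close>
  have "(\<Sum>k. a k) + A = (\<Sum>k. b k) + B"
    using eq[of 0] expand(1)[where h="\<lambda>y. 1"] expand(2)[where h="\<lambda>y. 1"] by simp
  moreover have "(\<Sum>k. b k) < \<infinity>"
  proof -
    have "(\<Sum>k. b k) \<le> (\<integral>\<^sup>+x. W' x \<partial>M')"
      using expand(2)[where h="\<lambda>y. 1"] by simp
    then show ?thesis using fin by auto
  qed
  ultimately have "A = B" using ab by auto
  then show ?thesis using expand(1)[of h] expand(2)[of h] ab by simp
qed

text \<open>The variables are inverted one at a time, the others being absorbed in the weights.\<close>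

lemma laplace_inversion:
  fixes X :: "'i \<Rightarrow> 'a \<Rightarrow> ennreal" and X' :: "'i \<Rightarrow> 'b \<Rightarrow> ennreal"
  assumes "finite I"
    and "\<And>i. i \<in> I \<Longrightarrow> X i \<in> borel_measurable M" "W \<in> borel_measurable M"
    and "\<And>i. i \<in> I \<Longrightarrow> X' i \<in> borel_measurable M'" "W' \<in> borel_measurable M'"
    and "\<And>i x. i \<in> I \<Longrightarrow> x \<in> space M \<Longrightarrow> X i x \<in> range of_nat \<union> {\<infinity>}"
    and "\<And>i x. i \<in> I \<Longrightarrow> x \<in> space M' \<Longrightarrow> X' i x \<in> range of_nat \<union> {\<infinity>}"
    and "(\<integral>\<^sup>+x. W x \<partial>M) < \<infinity>" "(\<integral>\<^sup>+x. W' x \<partial>M') < \<infinity>"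
    and "\<And>c. (\<And>i. 0 \<le> c i) \<Longrightarrow> (\<integral>\<^sup>+x. W x * exp_neg (\<Sum>i\<in>I. ennreal (c i) * X i x) \<partial>M) =
           (\<integral>\<^sup>+x. W' x * exp_neg (\<Sum>i\<in>I. ennreal (c i) * X' i x) \<partial>M')"
    and "\<And>i. i \<in> I \<Longrightarrow> C i \<in> sets borel"
  shows "(\<integral>\<^sup>+x. W x * (\<Prod>i\<in>I. indicator (C i) (X i x)) \<partial>M) =
         (\<integral>\<^sup>+x. W' x * (\<Prod>i\<in>I. indicator (C i) (X' i x)) \<partial>M')"
  using assms
proof (induction I arbitrary: W W' rule: finite_induct)
  case empty
  from empty(9)[of "\<lambda>_. 0"] show ?case by simp
next
  case (insert i I)
  note [measurable] = insert.prems(2,4) and fin = insert.prems(7,8)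
  have [measurable]: "X i \<in> borel_measurable M" "X' i \<in> borel_measurable M'"
    "\<And>j. j \<in> I \<Longrightarrow> X j \<in> borel_measurable M" "\<And>j. j \<in> I \<Longrightarrow> X' j \<in> borel_measurable M'"
    "C i \<in> sets borel" "\<And>j. j \<in> I \<Longrightarrow> C j \<in> sets borel"
    using insert.prems by auto
  have le: "W x * exp_neg y \<le> W x" "W' x' * exp_neg y \<le> W' x'" for x x' y
    using mult_left_mono[OF exp_neg_le_1[of y], of "W x"] mult_left_mono[OF exp_neg_le_1[of y], of "W' x'"] by auto
  have prod_le: "(\<Prod>i\<in>I. indicator (C i) (f i)) \<le> (1::ennreal)" for f :: "'i \<Rightarrow> ennreal"
    by (rule prod_le_1) (auto simp: indicator_def)
  have "(\<integral>\<^sup>+x. W x * (\<Prod>i\<in>I. indicator (C i) (X i x)) * indicator (C i) (X i x) \<partial>M) =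
      (\<integral>\<^sup>+x. W' x * (\<Prod>i\<in>I. indicator (C i) (X' i x)) * indicator (C i) (X' i x) \<partial>M')"
  proof (rule laplace_inversion_one[where X="X i" and X'="X' i" and h="indicator (C i)"
        and W="\<lambda>x. W x * (\<Prod>i\<in>I. indicator (C i) (X i x))" and W'="\<lambda>x. W' x * (\<Prod>i\<in>I. indicator (C i) (X' i x))"])
    show "(\<integral>\<^sup>+x. W x * (\<Prod>i\<in>I. indicator (C i) (X i x)) \<partial>M) < \<infinity>"
      using mult_left_mono[OF prod_le, of "W _"]
      by (intro le_less_trans[OF nn_integral_mono fin(1)]) (metis mult.right_neutral zero_le)
    show "(\<integral>\<^sup>+x. W' x * (\<Prod>i\<in>I. indicator (C i) (X' i x)) \<partial>M') < \<infinity>"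
      using mult_left_mono[OF prod_le, of "W' _"]
      by (intro le_less_trans[OF nn_integral_mono fin(2)]) (metis mult.right_neutral zero_le)
    fix c :: real assume c: "0 \<le> c"
    have "(\<integral>\<^sup>+x. (W x * exp_neg (ennreal c * X i x)) * (\<Prod>i\<in>I. indicator (C i) (X i x)) \<partial>M) =
      (\<integral>\<^sup>+x. (W' x * exp_neg (ennreal c * X' i x)) * (\<Prod>i\<in>I. indicator (C i) (X' i x)) \<partial>M')"
    proof (rule insert.IH[of "\<lambda>x. W x * exp_neg (ennreal c * X i x)" "\<lambda>x. W' x * exp_neg (ennreal c * X' i x)"])
      show "(\<integral>\<^sup>+x. W x * exp_neg (ennreal c * X i x) \<partial>M) < \<infinity>"
        by (intro le_less_trans[OF nn_integral_mono fin(1)] le)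
      show "(\<integral>\<^sup>+x. W' x * exp_neg (ennreal c * X' i x) \<partial>M') < \<infinity>"
        by (intro le_less_trans[OF nn_integral_mono fin(2)] le)
      fix d :: "'i \<Rightarrow> real" assume d: "\<And>j. 0 \<le> d j"
      \<comment> \<open>The parameters of the remaining variables and the parameter c of
        \<open>i\<close>, which has gone into the weight, form one parameter vector for the enlarged
        index set.\<close>
      have eq: "(\<Sum>j\<in>insert i I. ennreal ((d(i := c)) j) * Z j) = ennreal c * Z i + (\<Sum>j\<in>I. ennreal (d j) * Z j)" for Z
        using insert.hyps by (simp add: sum.insert) (intro disjI2 sum.cong, auto)
      show "(\<integral>\<^sup>+x. W x * exp_neg (ennreal c * X i x) * exp_neg (\<Sum>i\<in>I. ennreal (d i) * X i x) \<partial>M) =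
        (\<integral>\<^sup>+x. W' x * exp_neg (ennreal c * X' i x) * exp_neg (\<Sum>i\<in>I. ennreal (d i) * X' i x) \<partial>M')"
        using insert.prems(9)[of "d(i := c)"] c d unfolding eq by (simp add: exp_neg_add mult.assoc)
    qed (use insert.prems in auto)
    then show "(\<integral>\<^sup>+x. W x * (\<Prod>i\<in>I. indicator (C i) (X i x)) * exp_neg (ennreal c * X i x) \<partial>M) =
      (\<integral>\<^sup>+x. W' x * (\<Prod>i\<in>I. indicator (C i) (X' i x)) * exp_neg (ennreal c * X' i x) \<partial>M')"
      by (simp add: mult_ac)
  qed (use insert.prems in auto)
  then show ?case using insert.hyps by (simp add: mult_ac)
qed

section \<open>The Poisson law on the extended naturals\<close>

lemma poisson_law_range: "x \<in> set_pmf (poisson_law \<rho>) \<Longrightarrow> x \<in> range of_nat \<union> {\<infinity>}"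
  by (auto simp: poisson_law_def split: if_splits simp: set_map_pmf)

lemma nn_integral_poisson_law_ennreal:
  assumes "0 \<le> m"
  shows "(\<integral>\<^sup>+x. f x \<partial>measure_pmf (poisson_law (ennreal m))) = (\<Sum>k. ennreal (m ^ k / fact k * exp (- m)) * f (of_nat k))"
proof (cases "m = 0")
  case True
  \<comment> \<open>As 0 ^ 0 = 1, just the term k = 0 survives, in accordance with the point mass
    that \<open>poisson_law\<close> has for mean 0.\<close>
  have "(\<lambda>k. ennreal (0 ^ k / fact k * exp (- 0)) * f (of_nat k)) sums (\<Sum>k\<in>{0}. ennreal (0 ^ k / fact k * exp (- 0)) * f (of_nat k))"
    by (rule sums_finite) auto
  then show ?thesis using True by (simp add: poisson_law_def sums_iff)
next
  case False
  then show ?thesis using assms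
    by (simp add: poisson_law_def nn_integral_map_pmf) (simp add: nn_integral_measure_pmf nn_integral_count_space_nat)
qed

text \<open>For a finite mean m this is the exponential series at m exp (- c). For infinite mean
  both sides vanish if c > 0, and the convention 0 * \<infinity> = 0 makes both equal to 1 if c =
  0.\<close>

lemma laplace_poisson_law:
  assumes "0 \<le> c"
  shows "(\<integral>\<^sup>+x. exp_neg (ennreal c * x) \<partial>measure_pmf (poisson_law \<rho>)) = exp_neg (\<rho> * ennreal (1 - exp (- c)))"
proof (cases \<rho>)
  case (real m)
  have s: "(\<lambda>k. (m * exp (- c)) ^ k / fact k * exp (- m)) sums (exp (m * exp (- c)) * exp (- m))"
    using sums_mult2[OF exp_converges[of "m * exp (- c)"], of "exp (- m)"] by (simp add: field_simps)
  have "(\<integral>\<^sup>+x. exp_neg (ennreal c * x) \<partial>measure_pmf (poisson_law \<rho>)) = (\<Sum>k. ennreal ((m * exp (- c)) ^ k / fact k * exp (- m)))"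
    unfolding real nn_integral_poisson_law_ennreal[OF real(1)] exp_neg_power[OF assms]
    using real by (intro suminf_cong) (simp add: power_mult_distrib ennreal_power flip: ennreal_mult)
  also have "\<dots> = ennreal (exp (m * exp (- c)) * exp (- m))"
    using s real by (intro suminf_ennreal_eq) auto
  also have "\<dots> = exp_neg (\<rho> * ennreal (1 - exp (- c)))"
    using real assms
    by (simp add: exp_neg_ennreal flip: ennreal_mult exp_add) (simp add: algebra_simps)
  finally show ?thesis .
next
  case top
  then show ?thesis using assms
    by (cases "c = 0") (auto simp: poisson_law_def ennreal_mult_top ennreal_top_mult)
qed

text \<open>The law is discrete, so its value on any \<open>C\<close> is an explicit series in a
  finite mean, and infinite mean is a single point treated apart.\<close>

lemma borel_measurable_poisson_law [measurable]:
  "(\<lambda>\<rho>. measure_pmf.prob (poisson_law \<rho>) C) \<in> borel_measurable borel"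
proof -
  have "emeasure (measure_pmf (poisson_law \<rho>)) C =
      (if \<rho> = \<infinity> then indicator C \<infinity> else \<Sum>k. ennreal (enn2real \<rho> ^ k / fact k * exp (- enn2real \<rho>)) * indicator C (of_nat k))" for \<rho>
  proof (cases \<rho>)
    case (real m)
    then show ?thesis using nn_integral_poisson_law_ennreal[of m "indicator C"] by simp
  qed (simp add: poisson_law_def)
  then have "(\<lambda>\<rho>. emeasure (measure_pmf (poisson_law \<rho>)) C) \<in> borel_measurable borel" by simp
  then show ?thesis unfolding measure_def by measurable
qed

section \<open>Conditional probabilities\<close>

lemma (in prob_space) sigma_finite_subalgebraI: "subalgebra M G \<Longrightarrow> sigma_finite_subalgebra M G"
  by (intro finite_measure_subalgebra_is_sigma_finite finite_measure_subalgebra.intro finite_measure_axioms)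
     (auto simp: finite_measure_subalgebra_axioms_def)

text \<open>Passes from real conditional probabilities to nonnegative integrals, where the test
  function may be unbounded and extended-valued.\<close>

lemma (in prob_space) nn_integral_conditional_prob:
  assumes G: "subalgebra M G" and [measurable]: "A \<in> sets M" "u \<in> borel_measurable G"
  shows "(\<integral>\<^sup>+\<omega>. u \<omega> * ennreal (conditional_prob M G A \<omega>) \<partial>M) = (\<integral>\<^sup>+\<omega>. u \<omega> * indicator A \<omega> \<partial>M)"
proof -
  interpret sigma_finite_subalgebra M G by (rule sigma_finite_subalgebraI[OF G])
  \<comment> \<open>\<open>real_cond_exp\<close> is a difference of two nonnegative conditional
    expectations taken back to the reals. For an indicator the subtracted one is 0 and the other is
    at most 1, so nothing is lost in the conversion.\<close>
  have 0: "AE \<omega> in M. 0 = nn_cond_exp M G (\<lambda>x. ennreal (- indicator A x)) \<omega>"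
    by (rule nn_cond_exp_charact) (simp_all add: ennreal_neg)
  have "AE \<omega> in M. nn_cond_exp M G (\<lambda>x. ennreal (indicator A x)) \<omega> \<le> nn_cond_exp M G (\<lambda>x. 1) \<omega>"
    by (rule nn_cond_exp_mono) (auto simp: indicator_def)
  moreover have "AE \<omega> in M. 1 = nn_cond_exp M G (\<lambda>x. 1) \<omega>"
    by (rule nn_cond_exp_charact) simp_all
  ultimately have "AE \<omega> in M. ennreal (conditional_prob M G A \<omega>) = nn_cond_exp M G (\<lambda>x. ennreal (indicator A x)) \<omega>"
    using 0 by eventually_elim (auto simp: conditional_prob_def real_cond_exp_def ennreal_enn2real_if top_unique)
  then have "(\<integral>\<^sup>+\<omega>. u \<omega> * ennreal (conditional_prob M G A \<omega>) \<partial>M) = (\<integral>\<^sup>+\<omega>. u \<omega> * nn_cond_exp M G (\<lambda>x. ennreal (indicator A x)) \<omega> \<partial>M)"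
    by (intro nn_integral_cong_AE) auto
  also have "\<dots> = (\<integral>\<^sup>+\<omega>. u \<omega> * ennreal (indicator A \<omega>) \<partial>M)"
    by (rule nn_cond_exp_intg) auto
  finally show ?thesis by (simp add: ennreal_indicator)
qed

lemma (in prob_space) conditional_prob_eqI:
  assumes G: "subalgebra M G" and [measurable]: "A \<in> sets M" "g \<in> borel_measurable G"
    and g: "\<And>\<omega>. 0 \<le> g \<omega>" "\<And>\<omega>. g \<omega> \<le> 1"
    and eq: "\<And>H. H \<in> sets G \<Longrightarrow> (\<integral>\<^sup>+\<omega>. indicator H \<omega> * indicator A \<omega> \<partial>M) = (\<integral>\<^sup>+\<omega>. indicator H \<omega> * ennreal (g \<omega>) \<partial>M)"
  shows "AE \<omega> in M. conditional_prob M G A \<omega> = g \<omega>"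
proof -
  interpret sigma_finite_subalgebra M G by (rule sigma_finite_subalgebraI[OF G])
  have [measurable]: "g \<in> borel_measurable M" using G by (auto intro: measurable_from_subalg)
  show ?thesis unfolding conditional_prob_def
  proof (rule real_cond_exp_charact)
    fix H assume H: "H \<in> sets G"
    have [measurable]: "H \<in> sets M" using G H by (auto simp: subalgebra_def)
    have "(LINT x:H|M. indicator A x) = enn2real (\<integral>\<^sup>+\<omega>. indicator H \<omega> * indicator A \<omega> \<partial>M)"
      unfolding set_lebesgue_integral_def
      by (subst integral_eq_nn_integral) (auto simp: ennreal_mult' ennreal_indicator intro!: arg_cong[where f=enn2real] nn_integral_cong split: split_indicator)
    moreover have "(LINT x:H|M. g x) = enn2real (\<integral>\<^sup>+\<omega>. indicator H \<omega> * ennreal (g \<omega>) \<partial>M)"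
      unfolding set_lebesgue_integral_def using g
      by (subst integral_eq_nn_integral) (auto intro!: arg_cong[where f=enn2real] nn_integral_cong split: split_indicator)
    ultimately show "(LINT x:H|M. indicator A x) = (LINT x:H|M. g x)" using eq[OF H] by simp
  next
    show "integrable M g" using g by (intro integrable_const_bound[where B=1]) simp_all
    show "integrable M (indicat_real A)" by (intro integrable_const_bound[where B=1]) simp_all
    show "g \<in> borel_measurable G" by fact
  qed
qed

text \<open>The assumption \<open>law\<close> says that, given \<open>G\<close>, the counts are
  independent Poisson variables. The parameters \<open>h i\<close> may be random because they are
  measurable over \<open>G\<close>: the powers of exp (- h i) can be absorbed in the test function
  \<open>u\<close>.\<close>

lemma conditional_laplace:
  fixes X :: "'i \<Rightarrow> 'w \<Rightarrow> nat" and m h :: "'i \<Rightarrow> 'w \<Rightarrow> real"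
  assumes I: "finite I" and G: "subalgebra M G"
    and X: "\<And>i. i \<in> I \<Longrightarrow> X i \<in> M \<rightarrow>\<^sub>M count_space UNIV"
    and m: "\<And>i. i \<in> I \<Longrightarrow> m i \<in> borel_measurable G" "\<And>i \<omega>. 0 \<le> m i \<omega>"
    and h: "\<And>i. i \<in> I \<Longrightarrow> h i \<in> borel_measurable G" "\<And>i \<omega>. 0 \<le> h i \<omega>"
    and u: "u \<in> borel_measurable G"
    and law: "\<And>u k. u \<in> borel_measurable G \<Longrightarrow>
       (\<integral>\<^sup>+\<omega>. u \<omega> * (\<Prod>i\<in>I. indicator {k i} (X i \<omega>)) \<partial>M) =
       (\<integral>\<^sup>+\<omega>. u \<omega> * (\<Prod>i\<in>I. ennreal (m i \<omega> ^ k i / fact (k i) * exp (- m i \<omega>))) \<partial>M)"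
  shows "(\<integral>\<^sup>+\<omega>. u \<omega> * exp_neg (\<Sum>i\<in>I. ennreal (h i \<omega>) * of_nat (X i \<omega>)) \<partial>M) =
       (\<integral>\<^sup>+\<omega>. u \<omega> * exp_neg (\<Sum>i\<in>I. ennreal (m i \<omega>) * ennreal (1 - exp (- h i \<omega>))) \<partial>M)"
proof -
  define E where "E i \<omega> = exp_neg (ennreal (h i \<omega>) * of_nat (X i \<omega>))" for i \<omega>
  define F where "F i \<omega> = exp_neg (ennreal (m i \<omega>) * ennreal (1 - exp (- h i \<omega>)))" for i \<omega>
  define p where "p i k \<omega> = ennreal (m i \<omega> ^ k / fact k * exp (- m i \<omega>))" for i k \<omega>
  have GM: "f \<in> borel_measurable G \<Longrightarrow> f \<in> borel_measurable M" for f :: "'w \<Rightarrow> ennreal"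
    using G by (auto intro: measurable_from_subalg)
  have GM': "f \<in> borel_measurable G \<Longrightarrow> f \<in> borel_measurable M" for f :: "'w \<Rightarrow> real"
    using G by (auto intro: measurable_from_subalg)
  have mE: "E i \<in> borel_measurable M" if "i \<in> I" for i
  proof -
    have [measurable]: "X i \<in> M \<rightarrow>\<^sub>M count_space UNIV" "h i \<in> borel_measurable M"
      by (rule X[OF that], rule GM'[OF h(1)[OF that]])
    show ?thesis unfolding E_def by measurable
  qed
  have mF: "F i \<in> borel_measurable M" if "i \<in> I" for i
  proof -
    have [measurable]: "m i \<in> borel_measurable M" "h i \<in> borel_measurable M"
      by (rule GM'[OF m(1)[OF that]], rule GM'[OF h(1)[OF that]])
    show ?thesis unfolding F_def by measurable
  qed
  have mp: "p i k \<in> borel_measurable M" if "i \<in> I" for i k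
  proof -
    have [measurable]: "m i \<in> borel_measurable M" by (rule GM'[OF m(1)[OF that]])
    show ?thesis unfolding p_def by measurable
  qed
  have mI: "(\<lambda>\<omega>. indicator {k} (X i \<omega>) :: ennreal) \<in> borel_measurable M" if "i \<in> I" for i k
    by (rule measurable_compose[OF X[OF that]]) simp
  have Esum: "E i \<omega> = (\<Sum>n. ennreal (exp (- h i \<omega>)) ^ n * indicator {n} (X i \<omega>))" if "i \<in> I" for i \<omega>
  proof -
    have "(\<lambda>n. ennreal (exp (- h i \<omega>)) ^ n * indicator {n} (X i \<omega>)) sums (\<Sum>n\<in>{X i \<omega>}. ennreal (exp (- h i \<omega>)) ^ n * indicator {n} (X i \<omega>))"
      by (rule sums_finite) auto
    then show ?thesis using h(2) by (simp add: E_def exp_neg_power sums_iff)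
  qed
  have Fsum: "F i \<omega> = (\<Sum>n. ennreal (exp (- h i \<omega>)) ^ n * p i n \<omega>)" if "i \<in> I" for i \<omega>
    using laplace_poisson_law[of "h i \<omega>" "ennreal (m i \<omega>)"] h(2)[of i \<omega>] m(2)[of i \<omega>]
    by (simp add: F_def p_def nn_integral_poisson_law_ennreal exp_neg_power) (simp add: mult.commute)
  \<comment> \<open>Intermediate form of the identity: the variables in \<open>J\<close> have
    already been replaced by their transforms, the others are still pinned to the values
    \<open>k i\<close>. The test function stays universally quantified, as it changes in the
    induction step.\<close>
  have "\<forall>u k. u \<in> borel_measurable G \<longrightarrow>
       (\<integral>\<^sup>+\<omega>. u \<omega> * ((\<Prod>i\<in>J. E i \<omega>) * (\<Prod>i\<in>I-J. indicator {k i} (X i \<omega>))) \<partial>M) =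
       (\<integral>\<^sup>+\<omega>. u \<omega> * ((\<Prod>i\<in>J. F i \<omega>) * (\<Prod>i\<in>I-J. p i (k i) \<omega>)) \<partial>M)" if "J \<subseteq> I" for J
    using finite_subset[OF that I] that
  proof (induction J rule: finite_induct)
    case empty
    then show ?case using law by (simp add: p_def)
  next
    case (insert j J)
    have j: "j \<in> I" and JI: "J \<subseteq> I" "\<And>i. i \<in> J \<Longrightarrow> i \<in> I" using insert.prems by auto
    have [measurable]: "X j \<in> M \<rightarrow>\<^sub>M count_space UNIV" "h j \<in> borel_measurable M"
      by (rule X[OF j], rule GM'[OF h(1)[OF j]])
    have [measurable]: "\<And>i. i \<in> J \<Longrightarrow> E i \<in> borel_measurable M" "\<And>i. i \<in> J \<Longrightarrow> F i \<in> borel_measurable M"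
      "\<And>i k. i \<in> I - J \<Longrightarrow> p i k \<in> borel_measurable M" "\<And>k. p j k \<in> borel_measurable M"
      "\<And>i k. i \<in> I - J \<Longrightarrow> (\<lambda>\<omega>. indicator {k} (X i \<omega>) :: ennreal) \<in> borel_measurable M"
      "\<And>i k. i \<in> I - insert j J \<Longrightarrow> p i k \<in> borel_measurable M"
      by (blast intro: mE mF mp mI j JI X)+
    have IJ: "I - J = insert j (I - insert j J)" "j \<notin> I - insert j J" "finite (I - insert j J)"
      using insert.hyps j I by auto
    have upd: "(\<Prod>i\<in>I - insert j J. f i ((k(j := n)) i)) = (\<Prod>i\<in>I - insert j J. f i (k i))" for f :: "'i \<Rightarrow> nat \<Rightarrow> ennreal" and k n
      by (rule prod.cong) auto
    show ?case
    proof (intro allI impI)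
      fix u :: "'w \<Rightarrow> ennreal" and k :: "'i \<Rightarrow> nat" assume u: "u \<in> borel_measurable G"
      \<comment> \<open>The induction hypothesis with the variable \<open>j\<close> pinned to n and
        the factor exp (- h j) ^ n moved into the test function; summation over n produces
        \<open>E j\<close> on the left and \<open>F j\<close> on the right.\<close>
      have eq: "(\<integral>\<^sup>+\<omega>. u \<omega> * (ennreal (exp (- h j \<omega>)) ^ n) * ((\<Prod>i\<in>J. E i \<omega>) * (\<Prod>i\<in>I-J. indicator {(k(j:=n)) i} (X i \<omega>))) \<partial>M) =
       (\<integral>\<^sup>+\<omega>. u \<omega> * (ennreal (exp (- h j \<omega>)) ^ n) * ((\<Prod>i\<in>J. F i \<omega>) * (\<Prod>i\<in>I-J. p i ((k(j:=n)) i) \<omega>)) \<partial>M)" for n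
      proof (rule insert.IH[OF JI(1), rule_format])
        note [measurable] = u h(1)[OF j]
        show "(\<lambda>\<omega>. u \<omega> * (ennreal (exp (- h j \<omega>)) ^ n)) \<in> borel_measurable G" by measurable
      qed
      have [measurable]: "u \<in> borel_measurable M" by (rule GM[OF u])
      have "(\<integral>\<^sup>+\<omega>. u \<omega> * ((\<Prod>i\<in>insert j J. E i \<omega>) * (\<Prod>i\<in>I-insert j J. indicator {k i} (X i \<omega>))) \<partial>M)
        = (\<integral>\<^sup>+\<omega>. (\<Sum>n. u \<omega> * (ennreal (exp (- h j \<omega>)) ^ n) * ((\<Prod>i\<in>J. E i \<omega>) * (\<Prod>i\<in>I-J. indicator {(k(j:=n)) i} (X i \<omega>)))) \<partial>M)"
      proof (rule nn_integral_cong)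
        fix \<omega>
        have "(\<Sum>n. u \<omega> * (ennreal (exp (- h j \<omega>)) ^ n) * ((\<Prod>i\<in>J. E i \<omega>) * (\<Prod>i\<in>I-J. indicator {(k(j:=n)) i} (X i \<omega>)))) =
          (\<Sum>n. u \<omega> * ((\<Prod>i\<in>J. E i \<omega>) * (\<Prod>i\<in>I - insert j J. indicator {k i} (X i \<omega>))) * (ennreal (exp (- h j \<omega>)) ^ n * indicator {n} (X j \<omega>)))"
          unfolding IJ(1) prod.insert[OF IJ(3,2)] upd[of "\<lambda>i n. indicator {n} (X i \<omega>)"] by (simp add: mult_ac)
        also have "\<dots> = u \<omega> * ((\<Prod>i\<in>J. E i \<omega>) * (\<Prod>i\<in>I - insert j J. indicator {k i} (X i \<omega>))) * E j \<omega>"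
          by (simp only: Esum[OF j] ennreal_suminf_cmult)
        finally have "u \<omega> * ((\<Prod>i\<in>J. E i \<omega>) * (\<Prod>i\<in>I - insert j J. indicator {k i} (X i \<omega>))) * E j \<omega> =
          (\<Sum>n. u \<omega> * (ennreal (exp (- h j \<omega>)) ^ n) * ((\<Prod>i\<in>J. E i \<omega>) * (\<Prod>i\<in>I-J. indicator {(k(j:=n)) i} (X i \<omega>))))"
          by (rule sym)
        then show "u \<omega> * ((\<Prod>i\<in>insert j J. E i \<omega>) * (\<Prod>i\<in>I-insert j J. indicator {k i} (X i \<omega>))) =
          (\<Sum>n. u \<omega> * (ennreal (exp (- h j \<omega>)) ^ n) * ((\<Prod>i\<in>J. E i \<omega>) * (\<Prod>i\<in>I-J. indicator {(k(j:=n)) i} (X i \<omega>))))"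
          by (simp only: prod.insert[OF insert.hyps(1,2)] mult_ac)
      qed
      also have "\<dots> = (\<Sum>n. \<integral>\<^sup>+\<omega>. u \<omega> * (ennreal (exp (- h j \<omega>)) ^ n) * ((\<Prod>i\<in>J. E i \<omega>) * (\<Prod>i\<in>I-J. indicator {(k(j:=n)) i} (X i \<omega>))) \<partial>M)"
        by (rule nn_integral_suminf) measurable
      also have "\<dots> = (\<Sum>n. \<integral>\<^sup>+\<omega>. u \<omega> * (ennreal (exp (- h j \<omega>)) ^ n) * ((\<Prod>i\<in>J. F i \<omega>) * (\<Prod>i\<in>I-J. p i ((k(j:=n)) i) \<omega>)) \<partial>M)"
        unfolding eq ..
      also have "\<dots> = (\<integral>\<^sup>+\<omega>. (\<Sum>n. u \<omega> * (ennreal (exp (- h j \<omega>)) ^ n) * ((\<Prod>i\<in>J. F i \<omega>) * (\<Prod>i\<in>I-J. p i ((k(j:=n)) i) \<omega>))) \<partial>M)"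
        by (rule nn_integral_suminf[symmetric]) measurable
      also have "\<dots> = (\<integral>\<^sup>+\<omega>. u \<omega> * ((\<Prod>i\<in>insert j J. F i \<omega>) * (\<Prod>i\<in>I-insert j J. p i (k i) \<omega>)) \<partial>M)"
      proof (rule nn_integral_cong)
        fix \<omega>
        have "(\<Sum>n. u \<omega> * (ennreal (exp (- h j \<omega>)) ^ n) * ((\<Prod>i\<in>J. F i \<omega>) * (\<Prod>i\<in>I-J. p i ((k(j:=n)) i) \<omega>))) =
          (\<Sum>n. u \<omega> * ((\<Prod>i\<in>J. F i \<omega>) * (\<Prod>i\<in>I - insert j J. p i (k i) \<omega>)) * (ennreal (exp (- h j \<omega>)) ^ n * p j n \<omega>))"
          unfolding IJ(1) prod.insert[OF IJ(3,2)] upd[of "\<lambda>i n. p i n \<omega>"] by (simp add: mult_ac)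
        also have "\<dots> = u \<omega> * ((\<Prod>i\<in>J. F i \<omega>) * (\<Prod>i\<in>I - insert j J. p i (k i) \<omega>)) * F j \<omega>"
          by (simp only: Fsum[OF j] ennreal_suminf_cmult)
        finally have "(\<Sum>n. u \<omega> * (ennreal (exp (- h j \<omega>)) ^ n) * ((\<Prod>i\<in>J. F i \<omega>) * (\<Prod>i\<in>I-J. p i ((k(j:=n)) i) \<omega>))) =
          u \<omega> * ((\<Prod>i\<in>J. F i \<omega>) * (\<Prod>i\<in>I - insert j J. p i (k i) \<omega>)) * F j \<omega>" .
        then show "(\<Sum>n. u \<omega> * (ennreal (exp (- h j \<omega>)) ^ n) * ((\<Prod>i\<in>J. F i \<omega>) * (\<Prod>i\<in>I-J. p i ((k(j:=n)) i) \<omega>))) =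
          u \<omega> * ((\<Prod>i\<in>insert j J. F i \<omega>) * (\<Prod>i\<in>I-insert j J. p i (k i) \<omega>))"
          by (simp only: prod.insert[OF insert.hyps(1,2)] mult_ac)
      qed
      finally show "(\<integral>\<^sup>+\<omega>. u \<omega> * ((\<Prod>i\<in>insert j J. E i \<omega>) * (\<Prod>i\<in>I-insert j J. indicator {k i} (X i \<omega>))) \<partial>M)
        = (\<integral>\<^sup>+\<omega>. u \<omega> * ((\<Prod>i\<in>insert j J. F i \<omega>) * (\<Prod>i\<in>I-insert j J. p i (k i) \<omega>)) \<partial>M)" .
    qed
  qed
  from this[of I] u show ?thesis by (simp add: exp_neg_sum E_def F_def)
qed

section \<open>Paths and their inverses\<close>

text \<open>Paths are total on the line and vanish on the negative axis, so
  \<open>interval_measure\<close> applies to them directly; unboundedness makes the generalised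
  inverse finite at every level.\<close>

definition good_path :: "(real \<Rightarrow> real) \<Rightarrow> bool" where
  "good_path y \<longleftrightarrow> mono y \<and> continuous_on UNIV y \<and> (\<forall>t\<le>0. y t = 0) \<and> (\<forall>c. \<exists>t. c \<le> y t)"

text \<open>The left-continuous inverse. With the weak inequality the infimum is attained, which
  gives the equivalence \<open>path_inv_le_iff\<close> on which all transport formulas rest.\<close>

definition path_inv :: "(real \<Rightarrow> real) \<Rightarrow> real \<Rightarrow> real" where
  "path_inv y u = Inf {t. 0 \<le> t \<and> u \<le> y t}"

lemma good_path_nonneg: "good_path y \<Longrightarrow> 0 \<le> y t"
  using linear[of t 0] unfolding good_path_def mono_def by (metis order_refl)

lemma path_inv:
  assumes "good_path y"
  shows path_inv_nonneg: "0 \<le> path_inv y u" and le_path_inv: "u \<le> y (path_inv y u)"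
proof -
  let ?S = "{t. 0 \<le> t \<and> u \<le> y t}"
  obtain t where "u \<le> y t" using assms by (auto simp: good_path_def)
  moreover have "y t \<le> y (max 0 t)" using assms by (simp add: good_path_def mono_def)
  ultimately have "max 0 t \<in> ?S" by simp
  then have "?S \<noteq> {}" by blast
  moreover have "bdd_below ?S" by (rule bdd_belowI[of _ 0]) auto
  moreover have "closed ?S"
    using assms by (auto simp: good_path_def intro!: closed_Collect_conj closed_Collect_le continuous_intros)
  ultimately have "Inf ?S \<in> ?S" by (rule closed_contains_Inf)
  then show "0 \<le> path_inv y u" "u \<le> y (path_inv y u)" by (auto simp: path_inv_def)
qed

lemma path_inv_le_iff:
  assumes "good_path y" "0 \<le> t"
  shows "path_inv y u \<le> t \<longleftrightarrow> u \<le> y t"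
proof
  assume "path_inv y u \<le> t"
  then have "y (path_inv y u) \<le> y t" using assms(1) by (simp add: good_path_def mono_def)
  then show "u \<le> y t" using le_path_inv[OF assms(1), of u] by simp
next
  assume "u \<le> y t"
  then show "path_inv y u \<le> t" unfolding path_inv_def using assms by (intro cInf_lower bdd_belowI[of _ 0]) auto
qed

text \<open>A continuous path skips no level: the intermediate value theorem yields a time with
  value exactly u, and the first passage is not later than that.\<close>

lemma path_path_inv:
  assumes y: "good_path y" and u: "0 \<le> u"
  shows "y (path_inv y u) = u"
proof (rule antisym[OF _ le_path_inv[OF y]])
  have "\<exists>t\<ge>0. t \<le> path_inv y u \<and> y t = u"
    using y u le_path_inv[OF y, of u] path_inv_nonneg[OF y, of u]
    by (intro IVT') (auto simp: good_path_def intro: continuous_on_subset)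
  then obtain t where "0 \<le> t" "t \<le> path_inv y u" "y t = u" by blast
  moreover have "path_inv y u \<le> t" using calculation path_inv_le_iff[OF y, of t u] by simp
  ultimately show "y (path_inv y u) \<le> u" by simp
qed

lemma borel_measurable_path_inv:
  assumes y: "good_path y" shows "path_inv y \<in> borel_measurable borel"
proof (rule borel_measurable_mono)
  show "mono (path_inv y)"
  proof (rule monoI)
    fix u v :: real assume "u \<le> v"
    then have "u \<le> y (path_inv y v)" using le_path_inv[OF y, of v] by simp
    then show "path_inv y u \<le> path_inv y v" by (simp add: path_inv_le_iff[OF y path_inv_nonneg[OF y]])
  qed
qed

text \<open>The path measure is the image of Lebesgue measure on the half-line under the inverse
  path: for a \<ge> 0 the preimage of (a, b] is (y a, y b], and half-open intervals determine the
  measure.\<close>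

lemma emeasure_interval_measure_path:
  assumes y: "good_path y" and A: "A \<in> sets borel"
  shows "emeasure (interval_measure y) A = emeasure lborel {u. 0 \<le> u \<and> path_inv y u \<in> A}"
proof -
  note [measurable] = borel_measurable_path_inv[OF y]
  let ?D = "distr (density lborel (indicator {0..})) borel (path_inv y)"
  have D: "emeasure ?D A = emeasure lborel {u. 0 \<le> u \<and> path_inv y u \<in> A}" if "A \<in> sets borel" for A
  proof -
    note [measurable] = that
    have "path_inv y -` A \<in> sets borel" using measurable_sets[OF borel_measurable_path_inv[OF y] that] by simp
    then have "emeasure ?D A = (\<integral>\<^sup>+u. indicator {0..} u * indicator (path_inv y -` A) u \<partial>lborel)"
      by (subst emeasure_distr) (auto simp: emeasure_density)
    also have "\<dots> = (\<integral>\<^sup>+u. indicator {u. 0 \<le> u \<and> path_inv y u \<in> A} u \<partial>lborel)"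
      by (intro nn_integral_cong) (auto split: split_indicator)
    also have "\<dots> = emeasure lborel {u. 0 \<le> u \<and> path_inv y u \<in> A}"
      by (rule nn_integral_indicator) measurable
    finally show ?thesis .
  qed
  have mono: "\<And>a b. a \<le> b \<Longrightarrow> y a \<le> y b" using y by (auto simp: good_path_def mono_def)
  have cont: "\<And>a. continuous (at_right a) y"
    using y continuous_at_imp_continuous_at_within unfolding good_path_def by (metis UNIV_I continuous_on_eq_continuous_at open_UNIV)
  have eq: "emeasure (interval_measure y) {a<..b} = emeasure ?D {a<..b}" for a b
  proof (cases "a \<le> b")
    case True
    \<comment> \<open>For a < 0 the constraint from the left is void because the inverse is
      nonnegative; the additional level u = 0 carries no mass.\<close>
    have "{u. 0 \<le> u \<and> path_inv y u \<in> {a<..b}} = (if b < 0 then {} else if a < 0 then {0..y b} else {y a<..y b})"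
    proof -
      have "a < path_inv y u \<and> path_inv y u \<le> b \<longleftrightarrow> 0 \<le> b \<and> u \<le> y b \<and> (a < 0 \<or> y a < u)" for u
        using path_inv_nonneg[OF y, of u] path_inv_le_iff[OF y, of b u] path_inv_le_iff[OF y, of a u]
        by (smt (verit))
      moreover have "b < 0 \<longrightarrow> \<not> 0 \<le> b" by simp
      ultimately show ?thesis using good_path_nonneg[OF y, of a]
        by (intro set_eqI) (simp, smt (verit))
    qed
    moreover have "a < 0 \<Longrightarrow> y a = 0" "b < 0 \<Longrightarrow> y b = 0" using y by (auto simp: good_path_def)
    ultimately show ?thesis
      using True good_path_nonneg[OF y, of b] mono[OF True]
      by (subst D) (auto simp: emeasure_interval_measure_Ioc[OF True mono cont])
  qed auto
  have "interval_measure y = ?D"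
  proof (rule measure_eqI_generator_eq[where E="range (\<lambda>(a, b). {a<..b::real})" and \<Omega>=UNIV and A="\<lambda>n::nat. {- real n<..real n}"])
    show "Int_stable (range (\<lambda>(a, b). {a<..b::real}))"
      by (auto simp: Int_stable_def)
    show "sets (interval_measure y) = sigma_sets UNIV (range (\<lambda>(a, b). {a<..b::real}))"
      "sets ?D = sigma_sets UNIV (range (\<lambda>(a, b). {a<..b::real}))"
      by (simp_all add: borel_sigma_sets_Ioc)
    show "(\<Union>n::nat. {- real n<..real n}) = UNIV"
    proof -
      have "\<exists>n::nat. - real n < x \<and> x \<le> real n" for x
      proof -
        obtain n :: nat where "\<bar>x\<bar> < real n" using reals_Archimedean2 by blast
        then show ?thesis by (intro exI[of _ n]) auto
      qed
      then show ?thesis by auto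
    qed
    show "emeasure (interval_measure y) {- real n<..real n} \<noteq> \<infinity>" for n
      by (subst emeasure_interval_measure_Ioc[OF _ mono cont]) auto
    show "emeasure (interval_measure y) X = emeasure ?D X" if "X \<in> range (\<lambda>(a, b). {a<..b::real})" for X
      using that eq by (auto simp del: emeasure_distr)
    show "range (\<lambda>n::nat. {- real n<..real n}) \<subseteq> range (\<lambda>(a, b). {a<..b::real})"
      by (auto intro!: image_eqI[where x="(- real n, real n)" for n])
  qed simp
  then show ?thesis using D[OF A] by simp
qed

lemma emeasure_product_interval_measure:
  assumes y: "good_path y1" "good_path y2" and B: "B \<in> sets borel"
  shows "emeasure (interval_measure y1 \<Otimes>\<^sub>M interval_measure y2) B =
     emeasure lborel {u \<in> quadrant. (path_inv y1 (fst u), path_inv y2 (snd u)) \<in> B}"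
proof -
  note [measurable] = borel_measurable_path_inv[OF y(1)] borel_measurable_path_inv[OF y(2)]
  let ?T = "\<lambda>u. (path_inv y1 (fst u), path_inv y2 (snd u))"
  have q [measurable]: "quadrant \<in> sets borel" by (auto simp: quadrant_def intro!: borel_closed closed_Times)
  let ?D = "distr (density lborel (indicator quadrant)) borel ?T"
  have T [measurable]: "?T \<in> borel_measurable borel"
    unfolding borel_prod[symmetric] by measurable
  have D: "emeasure ?D B = emeasure lborel {u \<in> quadrant. ?T u \<in> B}" if "B \<in> sets borel" for B
  proof -
    note [measurable] = that
    have m: "?T -` B \<in> sets borel" using measurable_sets[OF T that] by simp
    then have "emeasure ?D B = (\<integral>\<^sup>+u. indicator quadrant u * indicator (?T -` B) u \<partial>lborel)"
      by (subst emeasure_distr) (auto simp: emeasure_density)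
    also have "\<dots> = (\<integral>\<^sup>+u. indicator {u \<in> quadrant. ?T u \<in> B} u \<partial>lborel)"
      by (intro nn_integral_cong) (auto split: split_indicator)
    also have "\<dots> = emeasure lborel {u \<in> quadrant. ?T u \<in> B}"
    proof (rule nn_integral_indicator)
      have "{u \<in> quadrant. ?T u \<in> B} = quadrant \<inter> ?T -` B" by auto
      then show "{u \<in> quadrant. ?T u \<in> B} \<in> sets lborel" using m q by (simp add: sets.Int)
    qed
    finally show ?thesis .
  qed
  have sf: "sigma_finite_measure (interval_measure y)" if "good_path y" for y
  proof (rule sigma_finite_interval_measure)
    show "y a \<le> y b" if "a \<le> b" for a b
      using that \<open>good_path y\<close> by (simp add: good_path_def mono_def)
    show "continuous (at_right a) y" for a
      using \<open>good_path y\<close> continuous_at_imp_continuous_at_within unfolding good_path_def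
      by (metis UNIV_I continuous_on_eq_continuous_at open_UNIV)
  qed
  have "interval_measure y1 \<Otimes>\<^sub>M interval_measure y2 = ?D"
  proof (rule pair_measure_eqI)
    show "sets (interval_measure y1 \<Otimes>\<^sub>M interval_measure y2) = sets ?D"
      unfolding sets_distr borel_prod[symmetric] by (intro sets_pair_measure_cong sets_interval_measure)
    fix A1 A2 assume A: "A1 \<in> sets (interval_measure y1)" "A2 \<in> sets (interval_measure y2)"
    then have [measurable]: "A1 \<in> sets borel" "A2 \<in> sets borel" by auto
    have "{u \<in> quadrant. ?T u \<in> A1 \<times> A2} = {u. 0 \<le> u \<and> path_inv y1 u \<in> A1} \<times> {u. 0 \<le> u \<and> path_inv y2 u \<in> A2}"
      by (auto simp: quadrant_def)
    moreover have "emeasure lborel ({u. 0 \<le> u \<and> path_inv y1 u \<in> A1} \<times> {u. 0 \<le> u \<and> path_inv y2 u \<in> A2}) =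
      emeasure lborel {u. 0 \<le> u \<and> path_inv y1 u \<in> A1} * emeasure lborel {u. 0 \<le> u \<and> path_inv y2 u \<in> A2}"
      unfolding lborel_prod[symmetric] by (rule lborel.emeasure_pair_measure_Times) measurable
    ultimately show "emeasure (interval_measure y1) A1 * emeasure (interval_measure y2) A2 = emeasure ?D (A1 \<times> A2)"
      by (subst D) (auto simp: emeasure_interval_measure_path y borel_Times)
  qed (use sf y in auto)
  then show ?thesis using D[OF B] by simp
qed

section \<open>Increasing sets from curves\<close>

text \<open>The curve may move back and forth; its hull is monotone in time all the same, since only
  the farthest points reached so far matter.\<close>

definition curve_hull :: "(real \<Rightarrow> real \<times> real) \<Rightarrow> real \<Rightarrow> (real \<times> real) set" where
  "curve_hull p t = {x \<in> quadrant. \<exists>s\<in>{0..t}. fst x \<le> fst (p s) \<and> snd x \<le> snd (p s)}"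

lemma curve_hull_mono: "s \<le> t \<Longrightarrow> curve_hull p s \<subseteq> curve_hull p t"
  by (fastforce simp: curve_hull_def)

lemma closed_quadrant: "closed quadrant"
  by (auto simp: quadrant_def intro: closed_Times)

text \<open>The hull is the projection of a closed set in time and space along the compact time
  interval [0, t].\<close>

lemma closed_curve_hull:
  assumes p: "continuous_on UNIV p"
  shows "closed (curve_hull p t)"
proof -
  have "closed {x. \<exists>s. s \<in> {0..t} \<and> (s, x) \<in> {sx. fst (snd sx) \<le> fst (p (fst sx)) \<and> snd (snd sx) \<le> snd (p (fst sx))}}"
    by (intro closed_compact_projection closed_Collect_conj closed_Collect_le continuous_intros continuous_on_compose2[OF p]) auto
  then have "closed (quadrant \<inter> {x. \<exists>s. s \<in> {0..t} \<and> (s, x) \<in> {sx. fst (snd sx) \<le> fst (p (fst sx)) \<and> snd (snd sx) \<le> snd (p (fst sx))}})"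
    by (intro closed_Int closed_quadrant)
  moreover have "quadrant \<inter> {x. \<exists>s. s \<in> {0..t} \<and> (s, x) \<in> {sx. fst (snd sx) \<le> fst (p (fst sx)) \<and> snd (snd sx) \<le> snd (p (fst sx))}} = curve_hull p t"
    by (auto simp: curve_hull_def)
  ultimately show ?thesis by simp
qed

lemma bounded_curve_hull:
  assumes p: "continuous_on UNIV p"
  shows "bounded (curve_hull p t)"
proof -
  have "compact (p ` {0..t})"
    using p by (intro compact_continuous_image) (auto intro: continuous_on_subset)
  then obtain B where B: "\<And>s. s \<in> {0..t} \<Longrightarrow> norm (p s) \<le> B"
    using compact_imp_bounded bounded_iff by (metis imageI)
  have "curve_hull p t \<subseteq> {0..B} \<times> {0..B}"
  proof
    fix x assume "x \<in> curve_hull p t"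
    then obtain s where "s \<in> {0..t}" "fst x \<le> fst (p s)" "snd x \<le> snd (p s)" "x \<in> quadrant"
      by (auto simp: curve_hull_def)
    moreover have "norm (fst (p s)) \<le> norm (p s)" "norm (snd (p s)) \<le> norm (p s)"
      by (metis norm_fst_le prod.collapse, metis norm_snd_le prod.collapse)
    ultimately show "x \<in> {0..B} \<times> {0..B}"
      using B[of s] by (cases x) (auto simp: quadrant_def)
  qed
  then show ?thesis using bounded_subset bounded_Times bounded_closed_interval by metis
qed

text \<open>Continuity of the curve gives continuity of the hull from both sides. The last
  assumption drives the curve to infinity along the diagonal, so that the area is unbounded.\<close>

lemma increasing_set_curve_hull:
  assumes p: "continuous_on UNIV p" and p0: "p 0 = (0, 0)" and q: "\<And>s. p s \<in> quadrant"
    and c: "\<And>s. c \<le> s \<Longrightarrow> s - c \<le> fst (p s) \<and> s - c \<le> snd (p s)"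
  shows "increasing_set (curve_hull p)"
  unfolding increasing_set_def
proof (intro conjI allI impI)
  fix t :: real assume t: "0 \<le> t"
  show "curve_hull p t \<in> lower_set_family"
    using closed_curve_hull[OF p, of t]
    by (auto simp: lower_set_family_def curve_hull_def quadrant_def intro: order_trans)
      (meson atLeastAtMost_iff order_trans)+
  show "emeasure lborel (curve_hull p t) < \<infinity>"
    by (rule emeasure_bounded_finite[OF bounded_curve_hull[OF p]])
  show "curve_hull p t = (\<Inter>u\<in>{t<..}. curve_hull p u)"
  proof
    show "curve_hull p t \<subseteq> (\<Inter>u\<in>{t<..}. curve_hull p u)"
      using curve_hull_mono[of t _ p] by (intro INT_greatest) auto
    show "(\<Inter>u\<in>{t<..}. curve_hull p u) \<subseteq> curve_hull p t"
    proof
      fix x assume x: "x \<in> (\<Inter>u\<in>{t<..}. curve_hull p u)"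
      \<comment> \<open>The times at which the curve dominates x form a closed set and hence have a
        first element; membership of x in all later hulls places it at or before t.\<close>
      let ?S = "{s. 0 \<le> s \<and> fst x \<le> fst (p s) \<and> snd x \<le> snd (p s)}"
      have S: "\<exists>s\<in>?S. s \<le> u" if "t < u" for u
      proof -
        have "x \<in> curve_hull p u" using x that by blast
        then show ?thesis by (fastforce simp: curve_hull_def)
      qed
      have "?S \<noteq> {}" using S[of "t + 1"] by auto
      moreover have bdd: "bdd_below ?S" by (rule bdd_belowI[of _ 0]) auto
      moreover have "closed ?S"
        by (intro closed_Collect_conj closed_Collect_le continuous_intros p)
      ultimately have "Inf ?S \<in> ?S" by (rule closed_contains_Inf)
      moreover have "Inf ?S \<le> u" if u: "t < u" for u
      proof -
        obtain s where "s \<in> ?S" "s \<le> u" using S[OF u] by blast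
        then show ?thesis using cInf_lower[OF _ bdd, of s] by simp
      qed
      then have "Inf ?S \<le> t" by (rule dense_ge)
      moreover have "x \<in> curve_hull p (t + 1)" using x by (metis INT_D greaterThan_iff less_add_one)
      then have "x \<in> quadrant" by (simp add: curve_hull_def)
      ultimately show "x \<in> curve_hull p t" by (auto simp: curve_hull_def)
    qed
  qed
next
  show "curve_hull p 0 = {(0, 0)}" using p0 by (auto simp: curve_hull_def quadrant_def)
next
  fix t :: real assume t: "0 < t"
  let ?U = "\<Union>u\<in>{0..<t}. curve_hull p u"
  show "curve_hull p t = closure ?U"
  proof
    show "closure ?U \<subseteq> curve_hull p t"
      using curve_hull_mono[of _ t p] by (intro closure_minimal closed_curve_hull p UN_least) auto
    show "curve_hull p t \<subseteq> closure ?U"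
    proof
      fix x assume "x \<in> curve_hull p t"
      then obtain s where s: "0 \<le> s" "s \<le> t" "fst x \<le> fst (p s)" "snd x \<le> snd (p s)" and xq: "x \<in> quadrant"
        by (auto simp: curve_hull_def)
      show "x \<in> closure ?U"
      proof (cases "s < t")
        case True
        then have "x \<in> curve_hull p s" using s xq by (auto simp: curve_hull_def)
        then show ?thesis using True s closure_subset by fastforce
      next
        case False
        then have st: "s = t" using s by simp
        \<comment> \<open>Cutting x off at p u puts it into an earlier hull. As u increases to t the
          cut-off points tend to x, because p t dominates x.\<close>
        have ev: "eventually (\<lambda>u. (min (fst x) (fst (p u)), min (snd x) (snd (p u))) \<in> closure ?U) (at_left t)"
          using eventually_at_left_real[OF t]
        proof eventually_elim
          case (elim u)
          have "(min (fst x) (fst (p u)), min (snd x) (snd (p u))) \<in> curve_hull p u"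
            using elim xq q[of u] by (auto simp: curve_hull_def quadrant_def min_def split: if_splits)
          then show ?case using elim closure_subset by fastforce
        qed
        have "(p \<longlongrightarrow> p t) (at_left t)"
          using p by (auto simp: continuous_on_def intro: tendsto_within_subset)
        then have "((\<lambda>u. (min (fst x) (fst (p u)), min (snd x) (snd (p u)))) \<longlongrightarrow>
            (min (fst x) (fst (p t)), min (snd x) (snd (p t)))) (at_left t)"
          by (intro tendsto_intros)
        also have "(min (fst x) (fst (p t)), min (snd x) (snd (p t))) = x"
          using s st by (cases x) (auto simp: min_def)
        finally show ?thesis
          by (intro Lim_in_closed_set[OF closed_closure ev]) (auto simp: trivial_limit_at_left_real)
      qed
    qed
  qed
next
  fix s t :: real assume "0 \<le> s \<and> s \<le> t"
  then show "curve_hull p s \<subseteq> curve_hull p t" by (intro curve_hull_mono) simp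
next
  show "((\<lambda>t. emeasure lborel (curve_hull p t)) \<longlongrightarrow> \<infinity>) at_top"
    unfolding infinity_ennreal_def tendsto_top_iff_ennreal
  proof (intro allI impI)
    fix l :: real assume l: "0 \<le> l"
    show "eventually (\<lambda>t. ennreal l < emeasure lborel (curve_hull p t)) at_top"
      \<comment> \<open>From time c + l + 1 on the curve dominates a corner (m, m) with m \<ge> l +
        1, and the square below it has area m * m \<ge> m > l.\<close>
      using eventually_ge_at_top[of "max 0 (c + l + 1)"]
    proof eventually_elim
      case (elim t)
      define m where "m = t - c"
      have m: "l + 1 \<le> m" using elim by (simp add: m_def)
      have "{0..m} \<times> {0..m} \<subseteq> curve_hull p t"
        using c[of t] elim l m by (auto simp: curve_hull_def quadrant_def m_def intro!: bexI[of _ t])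
      then have "emeasure lborel ({0..m} \<times> {0..m}) \<le> emeasure lborel (curve_hull p t)"
        by (intro emeasure_mono) (auto intro: closed_curve_hull[OF p] borel_closed)
      moreover have "emeasure lborel ({0..m} \<times> {0..m}) = ennreal (m * m)"
        unfolding lborel_prod[symmetric] using m l
        by (subst lborel.emeasure_pair_measure_Times) (auto simp: ennreal_mult)
      moreover have "l < m * m"
      proof -
        have "l < m" using m by simp
        also have "m * 1 \<le> m * m" using m l by (intro mult_left_mono) auto
        finally show ?thesis by simp
      qed
      ultimately show ?case using l by (metis ennreal_lessI less_le_trans le_less_trans)
    qed
  qed
qed

definition tent :: "real \<Rightarrow> real" where
  "tent v = max 0 (1 - \<bar>2 * v - 1\<bar>)"

text \<open>The curve runs from the origin to \<open>a k\<close> and back during the time interval \<open>[k, k + 1]\<close>, so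
  that its hull at time \<open>k\<close> is the union of the rectangles spanned by the origin and \<open>a i\<close>,
  \<open>i < k\<close>; the last summand makes the area unbounded.\<close>

definition excursion_curve :: "nat \<Rightarrow> (nat \<Rightarrow> real \<times> real) \<Rightarrow> real \<Rightarrow> real \<times> real" where
  "excursion_curve n a t = (\<Sum>k<n. tent (t - real k) *\<^sub>R a k) + max 0 (t - real n) *\<^sub>R (1, 1)"

lemma tent_bounds: "0 \<le> tent v" "tent v \<le> 1"
  by (auto simp: tent_def)

lemma tent_eq_0: "v \<le> 0 \<or> 1 \<le> v \<Longrightarrow> tent v = 0"
  by (auto simp: tent_def abs_if)

text \<open>The tents live on disjoint open unit intervals, so at most one summand differs from 0.
  Both end points are admissible because every tent vanishes there.\<close>

lemma excursion_curve_eq: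
  assumes "k < n" "real k \<le> s" "s \<le> real k + 1"
  shows "excursion_curve n a s = tent (s - real k) *\<^sub>R a k"
proof -
  have "tent (s - real i) = 0" if "i \<noteq> k" for i
  proof (cases "i < k")
    case True
    then have "real i + 1 \<le> real k" by linarith
    then show ?thesis using assms by (intro tent_eq_0) auto
  next
    case False
    then have "real k + 1 \<le> real i" using that by linarith
    then show ?thesis using assms by (intro tent_eq_0) auto
  qed
  then have "(\<Sum>i<n. tent (s - real i) *\<^sub>R a i) = (\<Sum>i\<in>{k}. tent (s - real i) *\<^sub>R a i)"
    using assms by (intro sum.mono_neutral_right) auto
  moreover have "max 0 (s - real n) = 0" using assms by auto
  ultimately show ?thesis by (simp add: excursion_curve_def zero_prod_def[symmetric])
qed

lemma increasing_set_excursion_curve: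
  assumes a: "\<And>k. a k \<in> quadrant"
  shows "increasing_set (curve_hull (excursion_curve n a))"
proof (rule increasing_set_curve_hull[where c="real n"])
  show "continuous_on UNIV (excursion_curve n a)"
    unfolding excursion_curve_def tent_def by (intro continuous_intros)
  show "excursion_curve n a 0 = (0, 0)"
    by (simp add: excursion_curve_def tent_eq_0 flip: zero_prod_def)
  have nn: "0 \<le> (\<Sum>k<n. tent (s - real k) * fst (a k))" "0 \<le> (\<Sum>k<n. tent (s - real k) * snd (a k))" for s
    using a tent_bounds by (auto simp: quadrant_def mem_Times_iff intro!: sum_nonneg mult_nonneg_nonneg)
  have fs: "fst (excursion_curve n a s) = (\<Sum>k<n. tent (s - real k) * fst (a k)) + max 0 (s - real n)"
    "snd (excursion_curve n a s) = (\<Sum>k<n. tent (s - real k) * snd (a k)) + max 0 (s - real n)" for s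
    by (auto simp: excursion_curve_def fst_sum snd_sum)
  show "excursion_curve n a s \<in> quadrant" for s
    using nn[of s] by (auto simp: quadrant_def mem_Times_iff fs)
  show "s - real n \<le> fst (excursion_curve n a s) \<and> s - real n \<le> snd (excursion_curve n a s)" for s
    using nn[of s] by (auto simp: fs)
qed

text \<open>Each excursion follows the segment from the origin to \<open>a i\<close>, so whatever it
  dominates is dominated by the turning point \<open>a i\<close>, which it reaches at time i +
  1/2.\<close>

lemma curve_hull_excursion_curve:
  assumes a: "\<And>k. a k \<in> quadrant" and k: "k \<le> n"
  shows "curve_hull (excursion_curve n a) (real k) =
    {x \<in> quadrant. x = (0, 0) \<or> (\<exists>i<k. fst x \<le> fst (a i) \<and> snd x \<le> snd (a i))}"
proof (intro set_eqI iffI)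
  fix x assume "x \<in> curve_hull (excursion_curve n a) (real k)"
  then obtain s where x: "x \<in> quadrant" and s: "0 \<le> s" "s \<le> real k"
    "fst x \<le> fst (excursion_curve n a s)" "snd x \<le> snd (excursion_curve n a s)"
    by (auto simp: curve_hull_def)
  show "x \<in> {x \<in> quadrant. x = (0, 0) \<or> (\<exists>i<k. fst x \<le> fst (a i) \<and> snd x \<le> snd (a i))}"
  proof (cases "k = 0")
    case True
    then have "excursion_curve n a s = (0, 0)" using s by (simp add: excursion_curve_def tent_eq_0 flip: zero_prod_def)
    then show ?thesis using s x by (cases x) (auto simp: quadrant_def)
  next
    case False
    \<comment> \<open>At s = k the floor would name the excursion that is about to start; the
      minimum selects the one that has just ended.\<close>
    define i where "i = min (nat \<lfloor>s\<rfloor>) (k - 1)"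
    have i: "i < k" "real i \<le> s" "s \<le> real i + 1"
      using False s unfolding i_def min_def by (auto simp: of_nat_diff) linarith+
    have "excursion_curve n a s = tent (s - real i) *\<^sub>R a i"
      using i k by (intro excursion_curve_eq) auto
    moreover have "tent (s - real i) * fst (a i) \<le> fst (a i)" "tent (s - real i) * snd (a i) \<le> snd (a i)"
      using a[of i] tent_bounds by (auto simp: quadrant_def mem_Times_iff intro!: mult_left_le_one_le)
    ultimately show ?thesis using s x i by (auto intro!: exI[of _ i])
  qed
next
  fix x assume x: "x \<in> {x \<in> quadrant. x = (0, 0) \<or> (\<exists>i<k. fst x \<le> fst (a i) \<and> snd x \<le> snd (a i))}"
  then consider "x = (0, 0)" | i where "i < k" "fst x \<le> fst (a i)" "snd x \<le> snd (a i)" by auto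
  then show "x \<in> curve_hull (excursion_curve n a) (real k)"
  proof cases
    case 1
    have "excursion_curve n a 0 = (0, 0)" by (simp add: excursion_curve_def tent_eq_0 flip: zero_prod_def)
    then show ?thesis using x 1 by (auto simp: curve_hull_def intro!: bexI[of _ 0])
  next
    case 2
    have "excursion_curve n a (real i + 1/2) = a i"
      using 2 k by (subst excursion_curve_eq[of i]) (auto simp: tent_def)
    moreover have "real i + 1/2 \<le> real k" using 2 by linarith
    ultimately show ?thesis using x 2 by (auto simp: curve_hull_def intro!: bexI[of _ "real i + 1/2"])
  qed
qed

text \<open>Traversing a grid row by row, an increasing set picks up the cells one at a time.\<close>

lemma grid_increasing_set:
  fixes d p :: nat
  defines "X \<equiv> \<lambda>v::real. nat \<lceil>2 ^ d * v\<rceil>"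
  obtains \<Gamma> where "increasing_set \<Gamma>"
    and "\<And>k. k \<le> (p + 1) * (p + 1) \<Longrightarrow>
       \<Gamma> (real k) = {x \<in> quadrant. x = (0, 0) \<or> (X (fst x) \<le> p \<and> (p + 1) * X (snd x) + X (fst x) < k)}"
proof -
  \<comment> \<open>Corner i stands in column i mod (p + 1) and row i div (p + 1). There are p + 1
    columns, since column 0 is kept for the points on the axis.\<close>
  define a where "a i = (real (i mod (p + 1)) / 2 ^ d, real (i div (p + 1)) / 2 ^ d)" for i
  have a: "a i \<in> quadrant" for i by (auto simp: a_def quadrant_def)
  have le: "v \<le> real j / 2 ^ d \<longleftrightarrow> X v \<le> j" for v j
    by (simp add: X_def field_simps ceiling_le_iff nat_le_iff)
  \<comment> \<open>Points below corner i belong to cells with number at most i, and each point lies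
    below the corner that carries the number of its own cell.\<close>
  have eq: "(\<exists>i<k. X (fst x) \<le> i mod (p + 1) \<and> X (snd x) \<le> i div (p + 1)) \<longleftrightarrow>
    X (fst x) \<le> p \<and> (p + 1) * X (snd x) + X (fst x) < k" (is "?L \<longleftrightarrow> ?R") for x k
  proof
    assume ?L
    then obtain i where i: "i < k" "X (fst x) \<le> i mod (p + 1)" "X (snd x) \<le> i div (p + 1)" by blast
    have "(p + 1) * X (snd x) + X (fst x) \<le> (p + 1) * (i div (p + 1)) + i mod (p + 1)"
      using i by (intro add_mono mult_left_mono) auto
    also have "\<dots> = i" by (rule mult_div_mod_eq)
    finally have "(p + 1) * X (snd x) + X (fst x) < k" using i by simp
    moreover have "i mod (p + 1) < p + 1" by (rule mod_less_divisor) simp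
    then have "X (fst x) \<le> p" using i by linarith
    ultimately show ?R by simp
  next
    assume R: ?R
    have "((p + 1) * X (snd x) + X (fst x)) mod (p + 1) = X (fst x)"
      using R by (subst mod_mult_self4) simp
    moreover have "((p + 1) * X (snd x) + X (fst x)) div (p + 1) = X (snd x)"
      using R by (subst div_mult_self4) simp_all
    ultimately show ?L using R by (intro exI[of _ "(p + 1) * X (snd x) + X (fst x)"]) simp
  qed
  show thesis
  proof (rule that[OF increasing_set_excursion_curve[of a "(p + 1) * (p + 1)"]])
    fix k assume "k \<le> (p + 1) * (p + 1)"
    from curve_hull_excursion_curve[of a, OF a this]
    show "curve_hull (excursion_curve ((p + 1) * (p + 1)) a) (real k) =
       {x \<in> quadrant. x = (0, 0) \<or> (X (fst x) \<le> p \<and> (p + 1) * X (snd x) + X (fst x) < k)}"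
      unfolding eq[symmetric] by (simp only: a_def le fst_conv snd_conv)
  qed (rule a)
qed

section \<open>Bounded pointwise closure of dyadic step functions\<close>

text \<open>The common upper bound of the sequence is what dominated convergence on bounded boxes
  needs. Defined inductively, the closure brings along the induction rule that extends the Laplace
  formula from step functions.\<close>

inductive_set bounded_closure :: "('z \<Rightarrow> real) set \<Rightarrow> ('z \<Rightarrow> real) set" for S where
  base: "f \<in> S \<Longrightarrow> f \<in> bounded_closure S"
| lim: "(\<And>n. f n \<in> bounded_closure S) \<Longrightarrow> (\<And>n z. f n z \<le> c) \<Longrightarrow> (\<And>z. (\<lambda>n::nat. f n z) \<longlonglongrightarrow> g z) \<Longrightarrow>
    g \<in> bounded_closure S"

lemma bounded_closure_nonneg:
  assumes "f \<in> bounded_closure S" and S: "\<And>f z. f \<in> S \<Longrightarrow> 0 \<le> f z"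
  shows "0 \<le> f z"
  using assms(1)
proof induction
  case (lim f c g)
  then show ?case by (intro LIMSEQ_le_const[OF lim.hyps(3)[of z]]) auto
qed (rule S)

lemma bounded_closure_bounded:
  assumes "f \<in> bounded_closure S" and S: "\<And>f. f \<in> S \<Longrightarrow> \<exists>c. \<forall>z. f z \<le> c"
  shows "\<exists>c. \<forall>z. f z \<le> c"
  using assms(1)
proof induction
  case (lim f c g)
  then have "g z \<le> c" for z by (intro LIMSEQ_le_const2[OF lim.hyps(3)[of z]]) auto
  then show ?case by blast
qed (rule S)

text \<open>Two inductions, one per argument: first \<open>g\<close> is kept in \<open>S\<close>
  while \<open>f\<close> runs through the closure, then \<open>f\<close> is any element of the
  closure while \<open>g\<close> runs. The assumption \<open>bdd\<close> supplies the common bound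
  at each limit.\<close>

lemma bounded_closure_op:
  assumes S: "\<And>f z. f \<in> S \<Longrightarrow> 0 \<le> f z" "\<And>f. f \<in> S \<Longrightarrow> \<exists>c. \<forall>z. f z \<le> c"
    and op: "\<And>f g. f \<in> S \<Longrightarrow> g \<in> S \<Longrightarrow> (\<lambda>z. op (f z) (g z)) \<in> S"
    and cont: "\<And>f g a b. f \<longlonglongrightarrow> a \<Longrightarrow> g \<longlonglongrightarrow> b \<Longrightarrow> (\<lambda>n::nat. op (f n) (g n)) \<longlonglongrightarrow> op a b"
    and bdd: "\<And>c::real. \<exists>c'::real. \<forall>a b. 0 \<le> a \<longrightarrow> a \<le> c \<longrightarrow> 0 \<le> b \<longrightarrow> b \<le> c \<longrightarrow> op a b \<le> c'"
    and f: "f \<in> bounded_closure S" and g: "g \<in> bounded_closure S"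
  shows "(\<lambda>z. op (f z) (g z)) \<in> bounded_closure S"
proof -
  have 1: "(\<lambda>z. op (f z) (g z)) \<in> bounded_closure S" if f: "f \<in> bounded_closure S" and gS: "g \<in> S" for f g
    using f
  proof induction
    case (base f)
    then show ?case using op gS by (auto intro: bounded_closure.base)
  next
    case (lim f c h)
    obtain d where d: "\<And>z. g z \<le> d" using S(2)[OF gS] by blast
    obtain c' where c': "\<And>a b. 0 \<le> a \<Longrightarrow> a \<le> max c d \<Longrightarrow> 0 \<le> b \<Longrightarrow> b \<le> max c d \<Longrightarrow> op a b \<le> c'"
      using bdd[of "max c d"] by blast
    have nn: "0 \<le> f n z" for n z using bounded_closure_nonneg[OF lim.hyps(1)] S(1) by blast
    show ?case
    proof (rule bounded_closure.lim[where f="\<lambda>n z. op (f n z) (g z)" and c=c'])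
      show "op (f n z) (g z) \<le> c'" for n z
        using nn[of n z] lim.hyps(2)[of n z] S(1)[OF gS, of z] d[of z] by (intro c') auto
      show "(\<lambda>n. op (f n z) (g z)) \<longlonglongrightarrow> op (h z) (g z)" for z
        by (intro cont lim.hyps(3) tendsto_const)
    qed (rule lim.IH)
  qed
  show ?thesis using g
  proof induction
    case (base g)
    then show ?case by (rule 1[OF f])
  next
    case (lim g c h)
    obtain d where d: "\<And>z. f z \<le> d" using bounded_closure_bounded[OF f S(2)] by blast
    obtain c' where c': "\<And>a b. 0 \<le> a \<Longrightarrow> a \<le> max c d \<Longrightarrow> 0 \<le> b \<Longrightarrow> b \<le> max c d \<Longrightarrow> op a b \<le> c'"
      using bdd[of "max c d"] by blast
    have nn: "0 \<le> g n z" for n z using bounded_closure_nonneg[OF lim.hyps(1)] S(1) by blast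
    have nn': "0 \<le> f z" for z using bounded_closure_nonneg[OF f] S(1) by blast
    show ?case
    proof (rule bounded_closure.lim[where f="\<lambda>n z. op (f z) (g n z)" and c=c'])
      show "op (f z) (g n z) \<le> c'" for n z
        using nn[of n z] lim.hyps(2)[of n z] nn'[of z] d[of z] by (intro c') auto
      show "(\<lambda>n. op (f z) (g n z)) \<longlonglongrightarrow> op (f z) (h z)" for z
        by (intro cont lim.hyps(3) tendsto_const)
    qed (rule lim.IH)
  qed
qed

text \<open>The coefficients are random but measurable over \<open>G\<close>, with one bound for all
  of them. Ceilings give cells that are closed on the right, matching the rectangles [0, t] seen by
  lower sets.\<close>

definition dyadic_step :: "'w measure \<Rightarrow> nat \<Rightarrow> ('w \<times> real \<times> real \<Rightarrow> real) set" where
  "dyadic_step G d = {\<lambda>(\<omega>, x). h \<lceil>2 ^ d * fst x\<rceil> \<lceil>2 ^ d * snd x\<rceil> \<omega> | h :: int \<Rightarrow> int \<Rightarrow> 'w \<Rightarrow> real.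
     (\<forall>i j. h i j \<in> borel_measurable G) \<and> (\<forall>i j \<omega>. 0 \<le> h i j \<omega>) \<and> (\<exists>c. \<forall>i j \<omega>. h i j \<omega> \<le> c)}"

lemma dyadic_stepI:
  assumes "\<And>i j. h i j \<in> borel_measurable G" "\<And>i j \<omega>. 0 \<le> h i j \<omega>" "\<And>i j \<omega>. h i j \<omega> \<le> c"
  shows "(\<lambda>z. h \<lceil>2 ^ d * fst (snd z)\<rceil> \<lceil>2 ^ d * snd (snd z)\<rceil> (fst z)) \<in> dyadic_step G d"
  using assms unfolding dyadic_step_def by (auto simp: case_prod_unfold intro!: exI[of _ h])

lemma dyadic_stepE:
  assumes "f \<in> dyadic_step G d"
  obtains h c where "\<And>i j. h i j \<in> borel_measurable G" "\<And>i j \<omega>. 0 \<le> h i j \<omega>" "\<And>i j \<omega>. h i j \<omega> \<le> c"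
    "f = (\<lambda>z. h \<lceil>2 ^ d * fst (snd z)\<rceil> \<lceil>2 ^ d * snd (snd z)\<rceil> (fst z))"
  using assms unfolding dyadic_step_def by (auto simp: case_prod_unfold)

lemma ceiling_half:
  fixes v :: real
  shows "\<lceil>real_of_int \<lceil>2 * v\<rceil> / 2\<rceil> = \<lceil>v\<rceil>"
proof (rule antisym)
  show "\<lceil>real_of_int \<lceil>2 * v\<rceil> / 2\<rceil> \<le> \<lceil>v\<rceil>"
  proof -
    have "\<lceil>2 * v\<rceil> \<le> 2 * \<lceil>v\<rceil>" using le_of_int_ceiling[of v] by (simp add: ceiling_le_iff)
    then have "real_of_int \<lceil>2 * v\<rceil> / 2 \<le> of_int \<lceil>v\<rceil>" by linarith
    then show ?thesis by (simp only: ceiling_le_iff)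
  qed
  show "\<lceil>v\<rceil> \<le> \<lceil>real_of_int \<lceil>2 * v\<rceil> / 2\<rceil>"
    using le_of_int_ceiling[of "2 * v"] by (intro ceiling_mono) linarith
qed

lemma dyadic_step_Suc: "dyadic_step G d \<subseteq> dyadic_step G (Suc d)"
proof
  fix f assume "f \<in> dyadic_step G d"
  then obtain h c where h: "\<And>i j. h i j \<in> borel_measurable G" "\<And>i j \<omega>. 0 \<le> h i j \<omega>" "\<And>i j \<omega>. h i j \<omega> \<le> c"
    "f = (\<lambda>z. h \<lceil>2 ^ d * fst (snd z)\<rceil> \<lceil>2 ^ d * snd (snd z)\<rceil> (fst z))" by (rule dyadic_stepE) blast
  have "(\<lambda>z. h \<lceil>real_of_int \<lceil>2 ^ Suc d * fst (snd z)\<rceil> / 2\<rceil> \<lceil>real_of_int \<lceil>2 ^ Suc d * snd (snd z)\<rceil> / 2\<rceil> (fst z)) \<in> dyadic_step G (Suc d)"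
    by (rule dyadic_stepI[where h="\<lambda>i j. h \<lceil>real_of_int i / 2\<rceil> \<lceil>real_of_int j / 2\<rceil>"]) (rule h)+
  moreover have "\<lceil>real_of_int \<lceil>2 ^ Suc d * v\<rceil> / 2\<rceil> = \<lceil>2 ^ d * v\<rceil>" for v :: real
    using ceiling_half[of "2 ^ d * v"] by (simp add: mult.assoc)
  ultimately show "f \<in> dyadic_step G (Suc d)" using h(4) by simp
qed

lemma dyadic_step_mono: "d \<le> e \<Longrightarrow> dyadic_step G d \<subseteq> dyadic_step G e"
  by (rule lift_Suc_mono_le[of "dyadic_step G"]) (rule dyadic_step_Suc)

lemma dyadic_step_op:
  assumes f: "f \<in> (\<Union>d. dyadic_step G d)" and g: "g \<in> (\<Union>d. dyadic_step G d)"
    and op: "(\<lambda>z. op (fst z) (snd z)) \<in> borel_measurable (borel \<Otimes>\<^sub>M borel)" "\<And>a b. 0 \<le> a \<Longrightarrow> 0 \<le> b \<Longrightarrow> 0 \<le> op a b"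
    and bdd: "\<And>c::real. \<exists>c'::real. \<forall>a b. 0 \<le> a \<longrightarrow> a \<le> c \<longrightarrow> 0 \<le> b \<longrightarrow> b \<le> c \<longrightarrow> op a b \<le> c'"
  shows "(\<lambda>z. op (f z) (g z)) \<in> (\<Union>d. dyadic_step G d)"
proof -
  obtain d e where de: "f \<in> dyadic_step G d" "g \<in> dyadic_step G e" using f g by blast
  then have "f \<in> dyadic_step G (max d e)" "g \<in> dyadic_step G (max d e)"
    using dyadic_step_mono[of d "max d e" G] dyadic_step_mono[of e "max d e" G] by auto
  then obtain h h' c c' where h: "\<And>i j. h i j \<in> borel_measurable G" "\<And>i j \<omega>. 0 \<le> h i j \<omega>" "\<And>i j \<omega>. h i j \<omega> \<le> c"
    "f = (\<lambda>z. h \<lceil>2 ^ (max d e) * fst (snd z)\<rceil> \<lceil>2 ^ (max d e) * snd (snd z)\<rceil> (fst z))"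
    and h': "\<And>i j. h' i j \<in> borel_measurable G" "\<And>i j \<omega>. 0 \<le> h' i j \<omega>" "\<And>i j \<omega>. h' i j \<omega> \<le> c'"
    "g = (\<lambda>z. h' \<lceil>2 ^ (max d e) * fst (snd z)\<rceil> \<lceil>2 ^ (max d e) * snd (snd z)\<rceil> (fst z))"
    by (elim dyadic_stepE) blast
  obtain b where b: "\<And>x y. 0 \<le> x \<Longrightarrow> x \<le> max c c' \<Longrightarrow> 0 \<le> y \<Longrightarrow> y \<le> max c c' \<Longrightarrow> op x y \<le> b"
    using bdd[of "max c c'"] by blast
  have "(\<lambda>z. op (f z) (g z)) \<in> dyadic_step G (max d e)"
    unfolding h(4) h'(4)
  proof (rule dyadic_stepI[where h="\<lambda>i j \<omega>. op (h i j \<omega>) (h' i j \<omega>)" and c=b])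
    show "(\<lambda>\<omega>. op (h i j \<omega>) (h' i j \<omega>)) \<in> borel_measurable G" for i j
      using measurable_compose[OF measurable_Pair[OF h(1) h'(1)] op(1)] by simp
    show "op (h i j \<omega>) (h' i j \<omega>) \<le> b" for i j \<omega>
      using h(2,3)[of i j \<omega>] h'(2,3)[of i j \<omega>] by (intro b) auto
  qed (use h h' op in blast)
  then show ?thesis by blast
qed

lemma
  fixes G :: "'w measure"
  defines "S \<equiv> \<Union>d. dyadic_step G d"
  shows dyadic_step_nonneg: "f \<in> S \<Longrightarrow> 0 \<le> f z"
    and dyadic_step_bounded: "f \<in> S \<Longrightarrow> \<exists>c. \<forall>z. f z \<le> c"
  unfolding S_def by (auto elim!: dyadic_stepE) blast

lemma
  fixes G :: "'w measure"
  defines "C \<equiv> bounded_closure (\<Union>d. dyadic_step G d)"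
  assumes "f \<in> C" "g \<in> C"
  shows bounded_closure_add: "(\<lambda>z. f z + g z) \<in> C"
    and bounded_closure_max: "(\<lambda>z. max (f z) (g z)) \<in> C"
    and bounded_closure_diff: "(\<lambda>z. max 0 (f z - g z)) \<in> C"
    and bounded_closure_cmult: "0 \<le> a \<Longrightarrow> (\<lambda>z. a * f z) \<in> C"
proof -
  have C: "(\<lambda>z. op (f z) (g z)) \<in> C"
    if "\<And>f g. f \<in> (\<Union>d. dyadic_step G d) \<Longrightarrow> g \<in> (\<Union>d. dyadic_step G d) \<Longrightarrow> (\<lambda>z. op (f z) (g z)) \<in> (\<Union>d. dyadic_step G d)"
      and "\<And>f g a b. f \<longlonglongrightarrow> a \<Longrightarrow> g \<longlonglongrightarrow> b \<Longrightarrow> (\<lambda>n::nat. op (f n) (g n)) \<longlonglongrightarrow> op a b"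
      and "\<And>c::real. \<exists>c'::real. \<forall>a b. 0 \<le> a \<longrightarrow> a \<le> c \<longrightarrow> 0 \<le> b \<longrightarrow> b \<le> c \<longrightarrow> op a b \<le> c'" for op
    unfolding C_def
  proof (rule bounded_closure_op[where op=op])
    show "f \<in> bounded_closure (\<Union>d. dyadic_step G d)" "g \<in> bounded_closure (\<Union>d. dyadic_step G d)"
      using assms(2,3) by (simp_all only: C_def)
  qed (fact dyadic_step_nonneg dyadic_step_bounded that)+
  show "(\<lambda>z. f z + g z) \<in> C"
  proof (rule C[where op="(+)"])
    show bdd: "\<exists>c'. \<forall>a b. 0 \<le> a \<longrightarrow> a \<le> c \<longrightarrow> 0 \<le> b \<longrightarrow> b \<le> c \<longrightarrow> a + b \<le> c'" for c :: real
      by (intro exI[of _ "c + c"]) auto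
    show "(\<lambda>z. f z + g z) \<in> (\<Union>d. dyadic_step G d)" if "f \<in> (\<Union>d. dyadic_step G d)" "g \<in> (\<Union>d. dyadic_step G d)" for f g
      by (rule dyadic_step_op[where op="(+)"]) (use that bdd in \<open>auto\<close>)
  qed (auto intro: tendsto_add)
  show "(\<lambda>z. max (f z) (g z)) \<in> C"
  proof (rule C[where op="max"])
    show bdd: "\<exists>c'. \<forall>a b. 0 \<le> a \<longrightarrow> a \<le> c \<longrightarrow> 0 \<le> b \<longrightarrow> b \<le> c \<longrightarrow> max a b \<le> c'" for c :: real
      by (intro exI[of _ c]) auto
    show "(\<lambda>z. max (f z) (g z)) \<in> (\<Union>d. dyadic_step G d)" if "f \<in> (\<Union>d. dyadic_step G d)" "g \<in> (\<Union>d. dyadic_step G d)" for f g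
      by (rule dyadic_step_op[where op=max]) (use that bdd in \<open>auto\<close>)
  qed (auto intro: tendsto_max)
  show "(\<lambda>z. max 0 (f z - g z)) \<in> C"
  proof (rule C[where op="\<lambda>a b. max 0 (a - b)"])
    show bdd: "\<exists>c'. \<forall>a b. 0 \<le> a \<longrightarrow> a \<le> c \<longrightarrow> 0 \<le> b \<longrightarrow> b \<le> c \<longrightarrow> max 0 (a - b) \<le> c'" for c :: real
      by (intro exI[of _ "max 0 c"]) auto
    show "(\<lambda>z. max 0 (f z - g z)) \<in> (\<Union>d. dyadic_step G d)" if "f \<in> (\<Union>d. dyadic_step G d)" "g \<in> (\<Union>d. dyadic_step G d)" for f g
      by (rule dyadic_step_op[where op="\<lambda>a b. max 0 (a - b)"]) (use that bdd in \<open>auto\<close>)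
  qed (auto intro: tendsto_max tendsto_diff)
  assume a: "0 \<le> a"
  show "(\<lambda>z. a * f z) \<in> C"
  proof (rule C[where op="\<lambda>x y. a * x"])
    show bdd: "\<exists>c'. \<forall>x y. 0 \<le> x \<longrightarrow> x \<le> c \<longrightarrow> 0 \<le> y \<longrightarrow> y \<le> c \<longrightarrow> a * x \<le> c'" for c :: real
      using a by (intro exI[of _ "a * c"]) (auto intro: mult_left_mono)
    show "(\<lambda>z. a * f z) \<in> (\<Union>d. dyadic_step G d)" if "f \<in> (\<Union>d. dyadic_step G d)" "g \<in> (\<Union>d. dyadic_step G d)" for f g
      by (rule dyadic_step_op[where op="\<lambda>x y. a * x"]) (use that bdd a in \<open>auto\<close>)
  qed (auto intro: tendsto_mult_left)
qed

lemma ceiling_dyadic_eventually: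
  fixes a v :: real
  assumes "a < v"
  shows "eventually (\<lambda>d. \<lceil>2 ^ d * a\<rceil> < \<lceil>2 ^ d * v\<rceil>) sequentially"
proof -
  obtain n where n: "1 / (v - a) < 2 ^ n" using real_arch_pow[of 2 "1 / (v - a)"] by auto
  have "\<lceil>2 ^ d * a\<rceil> < \<lceil>2 ^ d * v\<rceil>" if "n \<le> d" for d
  proof -
    have "1 < 2 ^ n * (v - a)" using n assms by (simp add: field_simps)
    also have "\<dots> \<le> 2 ^ d * (v - a)" using that assms by (intro mult_right_mono) auto
    finally have "2 ^ d * a + 1 < 2 ^ d * v" by (simp add: algebra_simps)
    then show ?thesis by linarith
  qed
  then show ?thesis by (auto simp: eventually_sequentially)
qed

text \<open>The sets with indicator in the closure form a sigma-algebra: complements come from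
  truncated differences, countable unions from maxima and limits. It contains all measurable
  rectangles, as these are obtained from lower quadrants {..a}, which dyadic steps
  approximate.\<close>

lemma indicator_in_bounded_closure:
  assumes D: "D \<in> sets (G \<Otimes>\<^sub>M borel)"
  shows "indicat_real D \<in> bounded_closure (\<Union>d. dyadic_step G d)" (is "_ \<in> ?C")
proof -
  let ?\<Omega> = "space G \<times> (UNIV :: (real \<times> real) set)"
  let ?D = "{D. D \<subseteq> ?\<Omega> \<and> indicat_real D \<in> ?C}"
  have \<Omega>: "indicat_real ?\<Omega> \<in> ?C"
  proof -
    have "(\<lambda>z. indicat_real (space G) (fst z)) \<in> dyadic_step G 0"
      by (rule dyadic_stepI[where h="\<lambda>i j. indicat_real (space G)" and c=1]) auto
    moreover have "(\<lambda>z. indicat_real (space G) (fst z)) = indicat_real ?\<Omega>" by (auto simp: indicator_def)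
    ultimately show ?thesis by (auto intro!: bounded_closure.base)
  qed
  have compl: "?\<Omega> - A \<in> ?D" if "A \<in> ?D" for A
  proof -
    have "(\<lambda>z. max 0 (indicat_real ?\<Omega> z - indicat_real A z)) \<in> ?C"
      using that \<Omega> by (intro bounded_closure_diff) auto
    moreover have "(\<lambda>z. max 0 (indicat_real ?\<Omega> z - indicat_real A z)) = indicat_real (?\<Omega> - A)"
      using that by (auto simp: indicator_def)
    ultimately show ?thesis by auto
  qed
  have empty: "{} \<in> ?D" using compl[of ?\<Omega>] \<Omega> by auto
  have union: "(\<Union>i::nat. A i) \<in> ?D" if A: "range A \<subseteq> ?D" for A
  proof -
    have fin: "indicat_real (\<Union>i<n. A i) \<in> ?C" for n
    proof (induction n)
      case (Suc n)
      have "(\<lambda>z. max (indicat_real (\<Union>i<n. A i) z) (indicat_real (A n) z)) \<in> ?C"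
        using Suc A by (intro bounded_closure_max) auto
      moreover have "(\<lambda>z. max (indicat_real (\<Union>i<n. A i) z) (indicat_real (A n) z)) = indicat_real (\<Union>i<Suc n. A i)"
        by (auto simp: indicator_def fun_eq_iff less_Suc_eq)
      ultimately show ?case by (simp only:)
    next
      case 0
      have "(\<Union>i<0. A i) = {}" by simp
      then show ?case using empty by (simp only: mem_Collect_eq)
    qed
    have "indicat_real (\<Union>i. A i) \<in> ?C"
    proof (rule bounded_closure.lim[where f="\<lambda>n. indicat_real (\<Union>i<n. A i)" and c=1])
      show "(\<lambda>n. indicat_real (\<Union>i<n. A i) z) \<longlonglongrightarrow> indicat_real (\<Union>i. A i) z" for z
        by (rule LIMSEQ_indicator_UN)
    qed (auto simp: fin indicator_def)
    then show ?thesis using A by auto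
  qed
  have rect: "H \<times> {..a} \<in> ?D" if H: "H \<in> sets G" for H and a :: "real \<times> real"
  proof -
    \<comment> \<open>The corner a is rounded up to the grid. Ceilings are monotone, so points below
      a are always kept; any other point is separated from a in some coordinate once the mesh is
      fine enough.\<close>
    define h where "h d i j = (if i \<le> \<lceil>2 ^ d * fst a\<rceil> \<and> j \<le> \<lceil>2 ^ d * snd a\<rceil> then indicat_real H else (\<lambda>_. 0))"
      for d :: nat and i j :: int
    have "indicat_real (H \<times> {..a}) \<in> ?C"
    proof (rule bounded_closure.lim[where c=1])
      show "(\<lambda>z. h d \<lceil>2 ^ d * fst (snd z)\<rceil> \<lceil>2 ^ d * snd (snd z)\<rceil> (fst z)) \<in> ?C" for d
      proof -
        have "(\<lambda>z. h d \<lceil>2 ^ d * fst (snd z)\<rceil> \<lceil>2 ^ d * snd (snd z)\<rceil> (fst z)) \<in> dyadic_step G d"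
          by (rule dyadic_stepI[where h="h d" and c=1]) (use H in \<open>auto simp: h_def\<close>)
        then show ?thesis by (auto intro: bounded_closure.base)
      qed
      show "h d \<lceil>2 ^ d * fst (snd z)\<rceil> \<lceil>2 ^ d * snd (snd z)\<rceil> (fst z) \<le> 1" for d z by (auto simp: h_def)
      show "(\<lambda>d. h d \<lceil>2 ^ d * fst (snd z)\<rceil> \<lceil>2 ^ d * snd (snd z)\<rceil> (fst z)) \<longlonglongrightarrow> indicat_real (H \<times> {..a}) z" for z
      proof (rule tendsto_eventually, cases "snd z \<le> a")
        case True
        then have "\<lceil>2 ^ d * fst (snd z)\<rceil> \<le> \<lceil>2 ^ d * fst a\<rceil>" "\<lceil>2 ^ d * snd (snd z)\<rceil> \<le> \<lceil>2 ^ d * snd a\<rceil>" for d :: nat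
          by (auto simp: less_eq_prod_def intro!: ceiling_mono)
        then show "eventually (\<lambda>d. h d \<lceil>2 ^ d * fst (snd z)\<rceil> \<lceil>2 ^ d * snd (snd z)\<rceil> (fst z) = indicat_real (H \<times> {..a}) z) sequentially"
          using True by (cases z) (auto simp: h_def indicator_def)
      next
        case False
        then consider "fst a < fst (snd z)" | "snd a < snd (snd z)" by (auto simp: less_eq_prod_def not_le)
        then have "eventually (\<lambda>d. \<lceil>2 ^ d * fst a\<rceil> < \<lceil>2 ^ d * fst (snd z)\<rceil> \<or> \<lceil>2 ^ d * snd a\<rceil> < \<lceil>2 ^ d * snd (snd z)\<rceil>) sequentially"
          by cases (auto dest!: ceiling_dyadic_eventually elim!: eventually_mono)
        then show "eventually (\<lambda>d. h d \<lceil>2 ^ d * fst (snd z)\<rceil> \<lceil>2 ^ d * snd (snd z)\<rceil> (fst z) = indicat_real (H \<times> {..a}) z) sequentially"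
          by eventually_elim (use False in \<open>cases z; auto simp: h_def indicator_def\<close>)
      qed
    qed
    then show ?thesis using sets.sets_into_space[OF H] by auto
  qed
  have prod: "H \<times> B \<in> ?D" if H: "H \<in> sets G" and B: "B \<in> sets borel" for H and B :: "(real \<times> real) set"
  proof -
    from B have "B \<in> sigma_sets UNIV (range atMost)" by (simp add: borel_eq_atMost)
    then show ?thesis
    proof induction
      case (Basic A)
      then show ?case using rect[OF H] by auto
    next
      case (Compl A)
      \<comment> \<open>The class is closed under complements in the whole space only, so the
        complement inside the strip over \<open>H\<close> is expressed through complements in the
        whole space and a union.\<close>
      have eq: "?\<Omega> - ((?\<Omega> - H \<times> UNIV) \<union> H \<times> A) = H \<times> (UNIV - A)" using sets.sets_into_space[OF H] by auto
      have HU: "H \<times> UNIV \<in> ?D"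
      proof -
        have "H \<times> (UNIV :: (real \<times> real) set) = (\<Union>n::nat. H \<times> {..(real n, real n)})"
        proof -
          have "\<exists>n::nat. x \<le> (real n, real n)" for x :: "real \<times> real"
            using real_arch_simple[of "max (fst x) (snd x)"] by (auto simp: less_eq_prod_def)
          then show ?thesis by auto
        qed
        moreover have "(\<Union>n::nat. H \<times> {..(real n, real n)}) \<in> ?D"
          by (rule union) (use rect[OF H] in blast)
        ultimately show ?thesis by (simp only:)
      qed
      have "(?\<Omega> - H \<times> UNIV) \<union> H \<times> A = (\<Union>i::nat. if i = 0 then ?\<Omega> - H \<times> UNIV else H \<times> A)"
        by (auto split: if_splits)
      also have "\<dots> \<in> ?D"
        using compl[OF HU] Compl.IH by (intro union) (auto split: if_splits)
      finally have "?\<Omega> - ((?\<Omega> - H \<times> UNIV) \<union> H \<times> A) \<in> ?D" by (rule compl)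
      then show ?case by (simp only: eq)
    next
      case (Union A)
      have "H \<times> (\<Union>i. A i) = (\<Union>i. H \<times> A i)" by auto
      then show ?case using union[of "\<lambda>i. H \<times> A i"] Union.IH by auto
    qed (use empty in simp)
  qed
  have "D \<in> sigma_sets ?\<Omega> {a \<times> b |a b. a \<in> sets G \<and> b \<in> sets (borel :: (real \<times> real) measure)}"
    using D by (simp add: sets_pair_measure)
  then have "D \<in> ?D"
  proof induction
    case (Basic A)
    then show ?case using prod by blast
  next
    case (Compl A)
    then show ?case by (rule_tac compl)
  next
    case (Union A)
    then show ?case by (intro union) blast
  qed (rule empty)
  then show ?thesis by blast
qed

lemma simple_in_bounded_closure:
  fixes G :: "'w measure"
  assumes "finite I" "\<And>i. i \<in> I \<Longrightarrow> D i \<in> sets (G \<Otimes>\<^sub>M borel)" "\<And>i. i \<in> I \<Longrightarrow> 0 \<le> (c i :: real)"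
  shows "(\<lambda>z. \<Sum>i\<in>I. c i * indicator (D i) z) \<in> bounded_closure (\<Union>d. dyadic_step G d)"
  using assms
proof (induction I rule: finite_induct)
  case empty
  have "indicat_real ({} :: ('w \<times> real \<times> real) set) \<in> bounded_closure (\<Union>d. dyadic_step G d)"
    by (intro indicator_in_bounded_closure) auto
  moreover have "indicat_real ({} :: ('w \<times> real \<times> real) set) = (\<lambda>z. 0)" by auto
  ultimately show ?case by simp
next
  case (insert i I)
  have D: "indicat_real (D i) \<in> bounded_closure (\<Union>d. dyadic_step G d)"
    by (intro indicator_in_bounded_closure insert.prems) simp
  show ?case unfolding sum.insert[OF insert.hyps]
    by (intro bounded_closure_add bounded_closure_cmult[OF D D] insert.IH insert.prems) auto
qed

section \<open>Time change by a pair of paths\<close>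

lemma dyadic_ceiling_tendsto: "(\<lambda>n. real_of_int \<lceil>2 ^ n * v\<rceil> / 2 ^ n) \<longlonglongrightarrow> v"
proof (rule tendsto_sandwich[of "\<lambda>_. v" _ _ "\<lambda>n. v + (1/2) ^ n"])
  show "(\<lambda>n. v + (1/2) ^ n) \<longlonglongrightarrow> v"
    using tendsto_add[OF tendsto_const LIMSEQ_power_zero[of "1/2::real"], of v] by simp
  have "2 ^ n * v \<le> of_int \<lceil>2 ^ n * v\<rceil>" "of_int \<lceil>2 ^ n * v\<rceil> \<le> 2 ^ n * v + 1" for n :: nat
    by linarith+
  then show "eventually (\<lambda>n. v \<le> real_of_int \<lceil>2 ^ n * v\<rceil> / 2 ^ n) sequentially"
    "eventually (\<lambda>n. real_of_int \<lceil>2 ^ n * v\<rceil> / 2 ^ n \<le> v + (1/2) ^ n) sequentially"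
    by (auto simp: field_simps power_divide)
qed auto

lemma quadrant_sets [measurable]: "quadrant \<in> sets borel"
  by (intro borel_closed closed_quadrant)

text \<open>Paths are good for every \<omega>, not just almost surely, so that the clock, its
  inverse and the clock measure are defined and measurable without exceptional sets.\<close>

locale time_change = prob_space M for M :: "'w measure" +
  fixes G :: "'w measure" and y1 y2 :: "real \<Rightarrow> 'w \<Rightarrow> real"
  assumes subalg: "subalgebra M G"
    and y_measurable: "y1 t \<in> borel_measurable G" "y2 t \<in> borel_measurable G"
    and y_good: "\<omega> \<in> space M \<Longrightarrow> good_path (\<lambda>t. y1 t \<omega>)" "\<omega> \<in> space M \<Longrightarrow> good_path (\<lambda>t. y2 t \<omega>)"
begin

definition clock :: "'w \<Rightarrow> real \<times> real \<Rightarrow> real \<times> real" where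
  "clock \<omega> x = (y1 (fst x) \<omega>, y2 (snd x) \<omega>)"

definition inv_clock :: "'w \<Rightarrow> real \<times> real \<Rightarrow> real \<times> real" where
  "inv_clock \<omega> u = (path_inv (\<lambda>t. y1 t \<omega>) (fst u), path_inv (\<lambda>t. y2 t \<omega>) (snd u))"

definition clock_measure :: "'w \<Rightarrow> (real \<times> real) measure" where
  "clock_measure \<omega> = interval_measure (\<lambda>t. y1 t \<omega>) \<Otimes>\<^sub>M interval_measure (\<lambda>t. y2 t \<omega>)"

lemma space_G: "space G = space M"
  using subalg by (simp add: subalgebra_def)

lemma sets_G: "A \<in> sets G \<Longrightarrow> A \<in> sets M"
  using subalg by (auto simp: subalgebra_def)

lemma measurable_G: "f \<in> G \<rightarrow>\<^sub>M L \<Longrightarrow> f \<in> M \<rightarrow>\<^sub>M L"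
  using measurable_from_subalg[OF subalg] by auto

lemma sets_clock_measure [simp]: "sets (clock_measure \<omega>) = sets borel"
  unfolding clock_measure_def borel_prod[symmetric] by (intro sets_pair_measure_cong sets_interval_measure)

lemma space_clock_measure [simp]: "space (clock_measure \<omega>) = UNIV"
  using sets_eq_imp_space_eq[OF sets_clock_measure] by simp

text \<open>Continuity in t makes the path a limit of functions with countably many time points. The
  sublevel sets of the inverse reduce by \<open>path_inv_le_iff\<close> to inequalities for the path
  at a fixed time.\<close>

lemma path_joint_measurable:
  assumes y: "\<And>t. y t \<in> borel_measurable G" "\<And>\<omega>. \<omega> \<in> space M \<Longrightarrow> good_path (\<lambda>t. y t \<omega>)"
  shows "(\<lambda>z. y (snd z) (fst z)) \<in> borel_measurable (G \<Otimes>\<^sub>M borel)"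
    and "(\<lambda>z. path_inv (\<lambda>t. y t (fst z)) (snd z)) \<in> borel_measurable (G \<Otimes>\<^sub>M borel)"
proof -
  note [measurable] = y(1)
  show "(\<lambda>z. y (snd z) (fst z)) \<in> borel_measurable (G \<Otimes>\<^sub>M borel)"
  proof (rule borel_measurable_LIMSEQ_real)
    fix z assume "z \<in> space (G \<Otimes>\<^sub>M (borel :: real measure))"
    then have "fst z \<in> space M" by (auto simp: space_pair_measure space_G)
    then have "isCont (\<lambda>t. y t (fst z)) (snd z)"
      using y(2) by (auto simp: good_path_def continuous_on_eq_continuous_at)
    from isCont_tendsto_compose[OF this dyadic_ceiling_tendsto]
    show "(\<lambda>n. y (real_of_int \<lceil>2 ^ n * snd z\<rceil> / 2 ^ n) (fst z)) \<longlonglongrightarrow> y (snd z) (fst z)" .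
  next
    fix n :: nat
    show "(\<lambda>z :: 'w \<times> real. y (real_of_int \<lceil>2 ^ n * snd z\<rceil> / 2 ^ n) (fst z)) \<in> borel_measurable (G \<Otimes>\<^sub>M borel)"
      by (rule measurable_compose_countable[where f="\<lambda>i z. y (real_of_int i / 2 ^ n) (fst z)"]) measurable
  qed
  have "{z \<in> space (G \<Otimes>\<^sub>M borel). path_inv (\<lambda>t. y t (fst z)) (snd z) \<le> a} \<in> sets (G \<Otimes>\<^sub>M borel)" for a
  proof (cases "0 \<le> a")
    case True
    then have "{z \<in> space (G \<Otimes>\<^sub>M borel). path_inv (\<lambda>t. y t (fst z)) (snd z) \<le> a} =
        {z \<in> space (G \<Otimes>\<^sub>M borel). snd z \<le> y a (fst z)}"
      using path_inv_le_iff[OF y(2) True] by (auto simp: space_pair_measure space_G)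
    also have "\<dots> \<in> sets (G \<Otimes>\<^sub>M borel)" by measurable
    finally show ?thesis .
  next
    case False
    have "\<not> path_inv (\<lambda>t. y t (fst z)) (snd z) \<le> a" if "z \<in> space (G \<Otimes>\<^sub>M borel)" for z
    proof -
      have "fst z \<in> space M" using that by (auto simp: space_pair_measure space_G)
      from path_inv_nonneg[OF y(2)[OF this], of "snd z"] show ?thesis using False by linarith
    qed
    then have "{z \<in> space (G \<Otimes>\<^sub>M borel). path_inv (\<lambda>t. y t (fst z)) (snd z) \<le> a} = {}"
      by blast
    then show ?thesis by (simp only: sets.empty_sets)
  qed
  then show "(\<lambda>z. path_inv (\<lambda>t. y t (fst z)) (snd z)) \<in> borel_measurable (G \<Otimes>\<^sub>M borel)"
    by (subst borel_measurable_iff_le) blast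
qed

lemma clock_measurable: "(\<lambda>z. clock (fst z) (snd z)) \<in> borel_measurable (G \<Otimes>\<^sub>M borel)"
proof -
  have "(\<lambda>z. (fst z, fst (snd z))) \<in> G \<Otimes>\<^sub>M (borel :: (real \<times> real) measure) \<rightarrow>\<^sub>M G \<Otimes>\<^sub>M borel"
    "(\<lambda>z. (fst z, snd (snd z))) \<in> G \<Otimes>\<^sub>M (borel :: (real \<times> real) measure) \<rightarrow>\<^sub>M G \<Otimes>\<^sub>M borel"
    unfolding borel_prod[symmetric] by measurable
  from measurable_compose[OF this(1) path_joint_measurable(1)[OF y_measurable(1) y_good(1)]]
    measurable_compose[OF this(2) path_joint_measurable(1)[OF y_measurable(2) y_good(2)]]
  show ?thesis unfolding clock_def by (simp add: borel_measurable_Pair)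
qed

lemma inv_clock_measurable: "(\<lambda>z. inv_clock (fst z) (snd z)) \<in> borel_measurable (G \<Otimes>\<^sub>M borel)"
proof -
  have "(\<lambda>z. (fst z, fst (snd z))) \<in> G \<Otimes>\<^sub>M (borel :: (real \<times> real) measure) \<rightarrow>\<^sub>M G \<Otimes>\<^sub>M borel"
    "(\<lambda>z. (fst z, snd (snd z))) \<in> G \<Otimes>\<^sub>M (borel :: (real \<times> real) measure) \<rightarrow>\<^sub>M G \<Otimes>\<^sub>M borel"
    unfolding borel_prod[symmetric] by measurable
  from measurable_compose[OF this(1) path_joint_measurable(2)[OF y_measurable(1) y_good(1)]]
    measurable_compose[OF this(2) path_joint_measurable(2)[OF y_measurable(2) y_good(2)]]
  show ?thesis unfolding inv_clock_def by (simp add: borel_measurable_Pair)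
qed

lemma section_sets: "D \<in> sets (G \<Otimes>\<^sub>M borel) \<Longrightarrow> {x. (\<omega>, x) \<in> D} \<in> sets borel"
  using sets_Pair1[of D G borel \<omega>] by (simp add: vimage_def)

lemma clock_section: "\<omega> \<in> space M \<Longrightarrow> clock \<omega> \<in> borel_measurable borel"
  using measurable_compose[OF measurable_Pair1'[of \<omega> G borel] clock_measurable] by (simp add: space_G)

lemma inv_clock_section: "\<omega> \<in> space M \<Longrightarrow> inv_clock \<omega> \<in> borel_measurable borel"
  using measurable_compose[OF measurable_Pair1'[of \<omega> G borel] inv_clock_measurable] by (simp add: space_G)

lemma emeasure_clock_measure:
  assumes "\<omega> \<in> space M" "B \<in> sets borel"
  shows "emeasure (clock_measure \<omega>) B = emeasure lborel {u \<in> quadrant. inv_clock \<omega> u \<in> B}"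
  unfolding clock_measure_def inv_clock_def
  using assms by (intro emeasure_product_interval_measure y_good)

lemma inv_clock_preimage_sets:
  assumes [measurable]: "B \<in> sets borel"
  shows "{z \<in> space (G \<Otimes>\<^sub>M borel). snd z \<in> quadrant \<and> inv_clock (fst z) (snd z) \<in> B} \<in> sets (G \<Otimes>\<^sub>M borel)"
proof -
  note [measurable] = inv_clock_measurable
  show ?thesis by measurable
qed

text \<open>The mass of \<open>B\<close> is the Lebesgue measure of a section of a jointly
  measurable set.\<close>

lemma clock_measure_measurable:
  assumes B: "B \<in> sets borel"
  shows "(\<lambda>\<omega>. emeasure (clock_measure \<omega>) B) \<in> borel_measurable G"
proof -
  let ?Q = "{z \<in> space (G \<Otimes>\<^sub>M borel). snd z \<in> quadrant \<and> inv_clock (fst z) (snd z) \<in> B}"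
  have "?Q \<in> sets (G \<Otimes>\<^sub>M lborel)"
    using inv_clock_preimage_sets[OF B] sets_pair_measure_cong[OF refl sets_lborel] by blast
  then have "(\<lambda>\<omega>. emeasure lborel (Pair \<omega> -` ?Q)) \<in> borel_measurable G"
    by (rule lborel.measurable_emeasure_Pair)
  moreover have "emeasure (clock_measure \<omega>) B = emeasure lborel (Pair \<omega> -` ?Q)" if "\<omega> \<in> space G" for \<omega>
    using that B by (subst emeasure_clock_measure)
      (auto simp: space_G space_pair_measure vimage_def intro!: arg_cong[where f="emeasure lborel"])
  ultimately show ?thesis by (subst measurable_cong) auto
qed

lemma y_mono: "\<omega> \<in> space M \<Longrightarrow> s \<le> t \<Longrightarrow> y1 s \<omega> \<le> y1 t \<omega>" "\<omega> \<in> space M \<Longrightarrow> s \<le> t \<Longrightarrow> y2 s \<omega> \<le> y2 t \<omega>"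
  using y_good by (auto simp: good_path_def mono_def)

lemma clock_measure_bounded:
  assumes \<omega>: "\<omega> \<in> space M" and B: "B \<in> sets borel" "bounded B"
  shows "emeasure (clock_measure \<omega>) B < \<infinity>"
proof -
  obtain K where K: "0 < K" "\<And>x. x \<in> B \<Longrightarrow> norm x \<le> K" using B(2) bounded_pos by metis
  have sub: "{u \<in> quadrant. inv_clock \<omega> u \<in> B} \<subseteq> {0..y1 K \<omega>} \<times> {0..y2 K \<omega>}"
  proof
    fix u assume u: "u \<in> {u \<in> quadrant. inv_clock \<omega> u \<in> B}"
    then have "norm (fst (inv_clock \<omega> u)) \<le> K" "norm (snd (inv_clock \<omega> u)) \<le> K"
      using K(2)[of "inv_clock \<omega> u"] norm_fst_le[of "fst (inv_clock \<omega> u)" "snd (inv_clock \<omega> u)"]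
        norm_snd_le[of "snd (inv_clock \<omega> u)" "fst (inv_clock \<omega> u)"] by auto
    then have "fst u \<le> y1 K \<omega>" "snd u \<le> y2 K \<omega>"
      using path_inv_le_iff[OF y_good(1)[OF \<omega>], of K "fst u"] path_inv_le_iff[OF y_good(2)[OF \<omega>], of K "snd u"] K(1)
      by (auto simp: inv_clock_def)
    then show "u \<in> {0..y1 K \<omega>} \<times> {0..y2 K \<omega>}" using u by (cases u) (auto simp: quadrant_def)
  qed
  have "bounded {u \<in> quadrant. inv_clock \<omega> u \<in> B}"
    by (rule bounded_subset[OF bounded_Times[OF bounded_closed_interval bounded_closed_interval] sub])
  then show ?thesis
    using emeasure_bounded_finite by (simp add: emeasure_clock_measure[OF \<omega> B(1)])
qed

lemma clock_inv_clock:
  assumes "\<omega> \<in> space M" "u \<in> quadrant"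
  shows "clock \<omega> (inv_clock \<omega> u) = u"
  using assms path_path_inv[OF y_good(1), of \<omega> "fst u"] path_path_inv[OF y_good(2), of \<omega> "snd u"]
  by (cases u) (auto simp: clock_def inv_clock_def quadrant_def)

lemma clock_quadrant: "\<omega> \<in> space M \<Longrightarrow> clock \<omega> x \<in> quadrant"
  using good_path_nonneg[OF y_good(1)] good_path_nonneg[OF y_good(2)] by (auto simp: clock_def quadrant_def)

lemma inv_clock_quadrant: "\<omega> \<in> space M \<Longrightarrow> inv_clock \<omega> u \<in> quadrant"
  using path_inv_nonneg[OF y_good(1)] path_inv_nonneg[OF y_good(2)] by (auto simp: inv_clock_def quadrant_def)

text \<open>The clock is not injective where a path is constant, but it undoes
  \<open>inv_clock\<close> on the quadrant, and the clock measure is the image of Lebesgue measure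
  under \<open>inv_clock\<close>.\<close>

lemma distr_clock_measure:
  assumes \<omega>: "\<omega> \<in> space M" and B: "B \<in> sets borel"
  shows "emeasure (clock_measure \<omega>) {x. clock \<omega> x \<in> B} = emeasure lborel (quadrant \<inter> B)"
proof -
  have "{x. clock \<omega> x \<in> B} \<in> sets borel"
    using measurable_sets[OF clock_section[OF \<omega>] B] by (simp add: vimage_def)
  then have "emeasure (clock_measure \<omega>) {x. clock \<omega> x \<in> B} = emeasure lborel {u \<in> quadrant. clock \<omega> (inv_clock \<omega> u) \<in> B}"
    by (subst emeasure_clock_measure[OF \<omega>]) auto
  also have "{u \<in> quadrant. clock \<omega> (inv_clock \<omega> u) \<in> B} = quadrant \<inter> B"
    using clock_inv_clock[OF \<omega>] by auto
  finally show ?thesis .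
qed

end

section \<open>The Laplace functional\<close>

text \<open>Index 0 is reserved for v \<le> 0. Within the quadrant, points on an axis thus form
  cells of their own, and an index i > 0 stands for the interval from (i - 1) / 2^d to i / 2^d,
  closed on the right.\<close>

definition dyadic_index :: "nat \<Rightarrow> real \<Rightarrow> nat" where
  "dyadic_index d v = nat \<lceil>2 ^ d * v\<rceil>"

text \<open>The number c codes row and column in base p + 1, in the order in which the excursion
  curve visits the corners; the bound on the column makes the code unique.\<close>

definition grid_cell :: "nat \<Rightarrow> nat \<Rightarrow> nat \<Rightarrow> (real \<times> real) set" where
  "grid_cell d p c = {x \<in> quadrant. dyadic_index d (fst x) \<le> p \<and>
     (p + 1) * dyadic_index d (snd x) + dyadic_index d (fst x) = c}"

lemma dyadic_index_le_iff: "dyadic_index d v \<le> j \<longleftrightarrow> v \<le> real j / 2 ^ d"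
  by (simp add: dyadic_index_def field_simps ceiling_le_iff nat_le_iff)

lemma grid_cell_index:
  assumes "x \<in> grid_cell d p c"
  shows "dyadic_index d (fst x) = c mod (p + 1)" "dyadic_index d (snd x) = c div (p + 1)"
proof -
  have c: "c = dyadic_index d (fst x) + (p + 1) * dyadic_index d (snd x)" "dyadic_index d (fst x) < p + 1"
    using assms by (auto simp: grid_cell_def)
  show "dyadic_index d (fst x) = c mod (p + 1)" using c(2) by (subst c(1)) (simp only: mod_mult_self2 mod_less)
  show "dyadic_index d (snd x) = c div (p + 1)" using c(2) by (subst c(1), subst div_mult_self2) simp_all
qed

lemma grid_cell_sets [measurable]: "grid_cell d p c \<in> sets borel"
proof -
  have [measurable]: "quadrant \<in> sets (borel \<Otimes>\<^sub>M borel)" unfolding borel_prod by (rule quadrant_sets)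
  have "grid_cell d p c = {x \<in> space (borel \<Otimes>\<^sub>M borel). x \<in> quadrant \<and> nat \<lceil>2 ^ d * fst x\<rceil> \<le> p \<and>
     (p + 1) * nat \<lceil>2 ^ d * snd x\<rceil> + nat \<lceil>2 ^ d * fst x\<rceil> = c}"
    by (auto simp: grid_cell_def dyadic_index_def space_pair_measure)
  also have "\<dots> \<in> sets (borel \<Otimes>\<^sub>M borel)" by measurable
  finally show ?thesis unfolding borel_prod .
qed

text \<open>For this p the last column and the last row end exactly at K.\<close>

lemma grid_cells_box:
  assumes "p = K * 2 ^ d"
  shows "(\<Union>c<(p + 1) * (p + 1). grid_cell d p c) = {0..real K} \<times> {0..real K}"
proof -
  have 1: "dyadic_index d v \<le> p \<longleftrightarrow> v \<le> real K" for v
    unfolding dyadic_index_le_iff assms by simp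
  have mem: "x \<in> (\<Union>c<(p + 1) * (p + 1). grid_cell d p c) \<longleftrightarrow>
     x \<in> quadrant \<and> dyadic_index d (fst x) \<le> p \<and> dyadic_index d (snd x) \<le> p" for x
  proof
    assume "x \<in> (\<Union>c<(p + 1) * (p + 1). grid_cell d p c)"
    then have x: "x \<in> quadrant" "dyadic_index d (fst x) \<le> p"
      "(p + 1) * dyadic_index d (snd x) + dyadic_index d (fst x) < (p + 1) * (p + 1)"
      by (auto simp: grid_cell_def)
    then have "(p + 1) * dyadic_index d (snd x) < (p + 1) * (p + 1)" by linarith
    then have "dyadic_index d (snd x) < p + 1" by (simp only: mult_less_cancel1)
    then show "x \<in> quadrant \<and> dyadic_index d (fst x) \<le> p \<and> dyadic_index d (snd x) \<le> p" using x by simp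
  next
    assume x: "x \<in> quadrant \<and> dyadic_index d (fst x) \<le> p \<and> dyadic_index d (snd x) \<le> p"
    have "(p + 1) * dyadic_index d (snd x) + dyadic_index d (fst x) < (p + 1) * p + (p + 1)"
      using x by (intro add_le_less_mono mult_left_mono) auto
    also have "\<dots> = (p + 1) * (p + 1)" by simp
    finally show "x \<in> (\<Union>c<(p + 1) * (p + 1). grid_cell d p c)"
      using x by (auto simp: grid_cell_def)
  qed
  show ?thesis
  proof (rule set_eqI)
    show "x \<in> (\<Union>c<(p + 1) * (p + 1). grid_cell d p c) \<longleftrightarrow> x \<in> {0..real K} \<times> {0..real K}" for x
      unfolding mem 1 by (cases x) (auto simp: quadrant_def)
  qed
qed

lemma bounded_grid_cell:
  assumes "c < (p + 1) * (p + 1)"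
  shows "bounded (grid_cell d p c)"
proof -
  have "grid_cell d p c \<subseteq> {0..real p / 2 ^ d} \<times> {0..real p / 2 ^ d}"
  proof
    fix x assume x: "x \<in> grid_cell d p c"
    then have "dyadic_index d (snd x) \<le> p"
      using grid_cell_index(2)[OF x] assms less_mult_imp_div_less[of c "p + 1" "p + 1"] by simp
    moreover have "dyadic_index d (fst x) \<le> p" using x by (simp add: grid_cell_def)
    ultimately show "x \<in> {0..real p / 2 ^ d} \<times> {0..real p / 2 ^ d}"
      using x by (cases x) (auto simp: dyadic_index_le_iff grid_cell_def quadrant_def)
  qed
  from bounded_subset[OF bounded_Times[OF bounded_closed_interval bounded_closed_interval] this]
  show ?thesis .
qed

text \<open>The assumption \<open>grid\<close> is the conditional Poisson law of all cell counts at
  once, in the form tested against functions \<open>u\<close> measurable over \<open>G\<close>.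
  Counts are written as naturals and means as reals, which is faithful because the cells involved
  are bounded.\<close>

locale grid_poisson = time_change M G y1 y2 for M :: "'w measure" and G y1 y2 +
  fixes N :: "'w \<Rightarrow> (real \<times> real) measure" and r :: real
  assumes N: "random_counting_measure M N" and r: "0 < r"
    and grid: "\<And>d p u k. u \<in> borel_measurable G \<Longrightarrow>
       (\<integral>\<^sup>+\<omega>. u \<omega> * (\<Prod>c<(p + 1) * (p + 1). indicator {k c} (nat \<lfloor>measure (N \<omega>) (grid_cell d p c)\<rfloor>)) \<partial>M) =
       (\<integral>\<^sup>+\<omega>. u \<omega> * (\<Prod>c<(p + 1) * (p + 1).
          ennreal ((r * measure (clock_measure \<omega>) (grid_cell d p c)) ^ k c / fact (k c) *
            exp (- (r * measure (clock_measure \<omega>) (grid_cell d p c))))) \<partial>M)"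
begin

lemma sets_N: "\<omega> \<in> space M \<Longrightarrow> sets (N \<omega>) = sets borel"
  using N by (auto simp: random_counting_measure_def counting_measure_def)

lemma space_N: "\<omega> \<in> space M \<Longrightarrow> space (N \<omega>) = UNIV"
  using sets_eq_imp_space_eq[OF sets_N] by simp

lemma N_measurable: "B \<in> sets borel \<Longrightarrow> (\<lambda>\<omega>. emeasure (N \<omega>) B) \<in> borel_measurable M"
  using N by (auto simp: random_counting_measure_def)

lemma N_finite: "\<omega> \<in> space M \<Longrightarrow> B \<in> sets borel \<Longrightarrow> bounded B \<Longrightarrow> emeasure (N \<omega>) B < \<infinity>"
  using N by (auto simp: random_counting_measure_def locally_finite_measure_def)

lemma N_range: "\<omega> \<in> space M \<Longrightarrow> B \<in> sets borel \<Longrightarrow> emeasure (N \<omega>) B \<in> range of_nat \<union> {\<infinity>}"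
  using N by (auto simp: random_counting_measure_def counting_measure_def)

lemma N_off_quadrant: "\<omega> \<in> space M \<Longrightarrow> emeasure (N \<omega>) (- quadrant) = 0"
  using N by (auto simp: random_counting_measure_def counting_measure_def)

lemma N_eq_of_nat:
  assumes "\<omega> \<in> space M" "B \<in> sets borel" "bounded B"
  shows "emeasure (N \<omega>) B = of_nat (nat \<lfloor>measure (N \<omega>) B\<rfloor>)"
proof -
  obtain n where n: "emeasure (N \<omega>) B = of_nat n"
    using N_range[OF assms(1,2)] N_finite[OF assms] by auto
  then have "measure (N \<omega>) B = real n" by (simp add: measure_def ennreal_of_nat_eq_real_of_nat)
  then show ?thesis using n by simp
qed

text \<open>Restriction to a box keeps the integral of a bounded function finite for each \<omega>,
  since \<open>N\<close> is locally finite.\<close>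

definition count_int :: "nat \<Rightarrow> ('w \<times> real \<times> real \<Rightarrow> real) \<Rightarrow> 'w \<Rightarrow> ennreal" where
  "count_int K f \<omega> = (\<integral>\<^sup>+x. ennreal (f (\<omega>, x)) * indicator ({0..real K} \<times> {0..real K}) x \<partial>N \<omega>)"

text \<open>With 1 - exp (- f) as integrand this is the exponent in the Laplace functional of a
  Poisson process, up to the factor \<open>r\<close>.\<close>

definition clock_int :: "nat \<Rightarrow> ('w \<times> real \<times> real \<Rightarrow> real) \<Rightarrow> 'w \<Rightarrow> ennreal" where
  "clock_int K f \<omega> = (\<integral>\<^sup>+x. ennreal (1 - exp (- f (\<omega>, x))) * indicator ({0..real K} \<times> {0..real K}) x \<partial>clock_measure \<omega>)"

text \<open>Bounds and measurability belong to the predicate so that they travel through limits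
  together with the identity. The measurability of \<open>count_int\<close> for random f is later
  used in its own right.\<close>

definition laplace_formula :: "nat \<Rightarrow> ('w \<times> real \<times> real \<Rightarrow> real) \<Rightarrow> bool" where
  "laplace_formula K f \<longleftrightarrow> (\<forall>z. 0 \<le> f z) \<and> (\<exists>c. \<forall>z. f z \<le> c) \<and>
     (\<forall>\<omega>\<in>space M. (\<lambda>x. f (\<omega>, x)) \<in> borel_measurable borel) \<and>
     count_int K f \<in> borel_measurable M \<and> clock_int K f \<in> borel_measurable M \<and>
     (\<forall>H\<in>sets G. (\<integral>\<^sup>+\<omega>. indicator H \<omega> * exp_neg (count_int K f \<omega>) \<partial>M) =
        (\<integral>\<^sup>+\<omega>. indicator H \<omega> * exp_neg (ennreal r * clock_int K f \<omega>) \<partial>M))"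

lemma box_sets [measurable]: "{0..real K} \<times> {0..real K} \<in> sets borel"
  by (intro borel_closed closed_Times) auto

lemma bounded_box: "bounded ({0..real K} \<times> {0..real K})"
  by (intro bounded_Times) auto

lemma laplace_formula_step:
  assumes f: "f \<in> dyadic_step G d"
  shows "laplace_formula K f"
proof -
  obtain h b where h: "\<And>i j. h i j \<in> borel_measurable G" "\<And>i j \<omega>. 0 \<le> h i j \<omega>" "\<And>i j \<omega>. h i j \<omega> \<le> b"
    and fh: "f = (\<lambda>z. h \<lceil>2 ^ d * fst (snd z)\<rceil> \<lceil>2 ^ d * snd (snd z)\<rceil> (fst z))"
    using f by (rule dyadic_stepE) blast
  define p where "p = K * 2 ^ d"
  define C where "C = {..<(p + 1) * (p + 1)}"
  define g where "g c = h (int (c mod (p + 1))) (int (c div (p + 1)))" for c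
  have gG: "g c \<in> borel_measurable G" and g0: "0 \<le> g c \<omega>" for c \<omega> by (auto simp: g_def h)
  \<comment> \<open>The function w is left open: the identity map to \<open>ennreal\<close> serves
    for the counts, 1 - exp (- v) for the clock measure.\<close>
  have ind: "w (f (\<omega>, x)) * indicator ({0..real K} \<times> {0..real K}) x = (\<Sum>c\<in>C. w (g c \<omega>) * indicator (grid_cell d p c) x)"
    for w :: "real \<Rightarrow> ennreal" and \<omega> x
  proof (cases "x \<in> {0..real K} \<times> {0..real K}")
    case True
    then obtain c where c: "c \<in> C" "x \<in> grid_cell d p c"
      using grid_cells_box[OF p_def] unfolding C_def by blast
    have "x \<in> quadrant" using c by (simp add: grid_cell_def)
    then have "0 \<le> 2 ^ d * fst x" "0 \<le> 2 ^ d * snd x" by (auto simp: quadrant_def)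
    \<comment> \<open>Nonnegative ceilings are needed to recover them from the natural-valued
      indices of the cell.\<close>
    then have nn: "0 \<le> \<lceil>2 ^ d * fst x\<rceil>" "0 \<le> \<lceil>2 ^ d * snd x\<rceil>" by linarith+
    have "\<lceil>2 ^ d * fst x\<rceil> = int (c mod (p + 1))" "\<lceil>2 ^ d * snd x\<rceil> = int (c div (p + 1))"
      using grid_cell_index[OF c(2)] nn unfolding dyadic_index_def by (metis int_nat_eq)+
    then have fg: "f (\<omega>, x) = g c \<omega>" by (simp only: fh g_def fst_conv snd_conv)
    have "(\<Sum>c\<in>C. w (g c \<omega>) * indicator (grid_cell d p c) x) = (\<Sum>c'\<in>{c}. w (g c' \<omega>) * indicator (grid_cell d p c') x)"
      using c by (intro sum.mono_neutral_right) (auto simp: C_def grid_cell_def)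
    then show ?thesis using True c fg by simp
  next
    case False
    then have "x \<notin> grid_cell d p c" if "c \<in> C" for c
      using grid_cells_box[OF p_def] that unfolding C_def by blast
    then show ?thesis using False by simp
  qed
  have bc: "bounded (grid_cell d p c)" if "c \<in> C" for c using that bounded_grid_cell by (simp add: C_def)
  have count: "count_int K f \<omega> = (\<Sum>c\<in>C. ennreal (g c \<omega>) * of_nat (nat \<lfloor>measure (N \<omega>) (grid_cell d p c)\<rfloor>))"
    if \<omega>: "\<omega> \<in> space M" for \<omega>
  proof -
    have "count_int K f \<omega> = (\<Sum>c\<in>C. (\<integral>\<^sup>+x. ennreal (g c \<omega>) * indicator (grid_cell d p c) x \<partial>N \<omega>))"
      unfolding count_int_def ind
      by (intro nn_integral_sum borel_measurable_times_ennreal borel_measurable_const borel_measurable_indicator) (simp add: sets_N[OF \<omega>])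
    also have "\<dots> = (\<Sum>c\<in>C. ennreal (g c \<omega>) * emeasure (N \<omega>) (grid_cell d p c))"
      using sets_N[OF \<omega>] by (intro sum.cong refl nn_integral_cmult_indicator) simp
    also have "\<dots> = (\<Sum>c\<in>C. ennreal (g c \<omega>) * of_nat (nat \<lfloor>measure (N \<omega>) (grid_cell d p c)\<rfloor>))"
      using N_eq_of_nat[OF \<omega>] bc by (intro sum.cong) auto
    finally show ?thesis .
  qed
  have clock: "clock_int K f \<omega> = (\<Sum>c\<in>C. ennreal (1 - exp (- g c \<omega>)) * emeasure (clock_measure \<omega>) (grid_cell d p c))" for \<omega>
  proof -
    have "clock_int K f \<omega> = (\<Sum>c\<in>C. (\<integral>\<^sup>+x. ennreal (1 - exp (- g c \<omega>)) * indicator (grid_cell d p c) x \<partial>clock_measure \<omega>))"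
      unfolding clock_int_def ind[of "\<lambda>v. ennreal (1 - exp (- v))"]
      by (intro nn_integral_sum borel_measurable_times_ennreal borel_measurable_const borel_measurable_indicator) simp
    also have "\<dots> = (\<Sum>c\<in>C. ennreal (1 - exp (- g c \<omega>)) * emeasure (clock_measure \<omega>) (grid_cell d p c))"
      by (intro sum.cong refl nn_integral_cmult_indicator) simp
    finally show ?thesis .
  qed
  have rclock: "ennreal r * clock_int K f \<omega> = (\<Sum>c\<in>C. ennreal (r * measure (clock_measure \<omega>) (grid_cell d p c)) * ennreal (1 - exp (- g c \<omega>)))"
    if \<omega>: "\<omega> \<in> space M" for \<omega>
  proof -
    have "emeasure (clock_measure \<omega>) (grid_cell d p c) = ennreal (measure (clock_measure \<omega>) (grid_cell d p c))" if "c \<in> C" for c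
      using clock_measure_bounded[OF \<omega> grid_cell_sets bc[OF that]] by (simp add: emeasure_eq_ennreal_measure)
    then show ?thesis unfolding clock sum_distrib_left using r
      by (intro sum.cong) (auto simp: ennreal_mult mult_ac)
  qed
  have mN: "(\<lambda>\<omega>. nat \<lfloor>measure (N \<omega>) (grid_cell d p c)\<rfloor>) \<in> M \<rightarrow>\<^sub>M count_space UNIV" for c
  proof -
    have [measurable]: "(\<lambda>\<omega>. measure (N \<omega>) (grid_cell d p c)) \<in> borel_measurable M"
      unfolding measure_def using N_measurable[OF grid_cell_sets] by measurable
    show ?thesis by measurable
  qed
  have mc: "(\<lambda>\<omega>. measure (clock_measure \<omega>) (grid_cell d p c)) \<in> borel_measurable G" for c
    unfolding measure_def using clock_measure_measurable[OF grid_cell_sets] by measurable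
  have gM: "g c \<in> borel_measurable M" for c by (rule measurable_G[OF gG])
  show ?thesis unfolding laplace_formula_def
  proof (intro conjI ballI)
    show "\<forall>z. 0 \<le> f z" unfolding fh using h(2) by blast
    show "\<exists>c. \<forall>z. f z \<le> c" unfolding fh using h(3) by blast
    show "(\<lambda>x. f (\<omega>, x)) \<in> borel_measurable borel" for \<omega>
    proof -
      have "(\<lambda>x :: real \<times> real. h \<lceil>2 ^ d * fst x\<rceil> \<lceil>2 ^ d * snd x\<rceil> \<omega>) \<in> borel_measurable (borel \<Otimes>\<^sub>M borel)"
      proof (rule measurable_compose_countable[where f="\<lambda>i (x :: real \<times> real). h i \<lceil>2 ^ d * snd x\<rceil> \<omega>"])
        show "(\<lambda>x :: real \<times> real. \<lceil>2 ^ d * fst x\<rceil>) \<in> borel \<Otimes>\<^sub>M borel \<rightarrow>\<^sub>M count_space UNIV" by measurable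
        fix i
        show "(\<lambda>x :: real \<times> real. h i \<lceil>2 ^ d * snd x\<rceil> \<omega>) \<in> borel_measurable (borel \<Otimes>\<^sub>M borel)"
          by (rule measurable_compose_countable[where f="\<lambda>j x. h i j \<omega>"]) measurable
      qed
      then show ?thesis unfolding fh borel_prod by simp
    qed
    show "count_int K f \<in> borel_measurable M"
    proof (subst measurable_cong[OF count])
      have "(\<lambda>\<omega>. of_nat (nat \<lfloor>measure (N \<omega>) (grid_cell d p c)\<rfloor>) :: ennreal) \<in> borel_measurable M" for c
        by (rule measurable_compose[OF mN]) simp
      then show "(\<lambda>\<omega>. \<Sum>c\<in>C. ennreal (g c \<omega>) * of_nat (nat \<lfloor>measure (N \<omega>) (grid_cell d p c)\<rfloor>)) \<in> borel_measurable M"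
        using gM by (intro borel_measurable_sum borel_measurable_times_ennreal measurable_compose[OF _ measurable_ennreal])
    qed
    show "clock_int K f \<in> borel_measurable M"
    proof (subst measurable_cong[OF clock])
      note [measurable] = gM measurable_G[OF clock_measure_measurable[OF grid_cell_sets]]
      show "(\<lambda>\<omega>. \<Sum>c\<in>C. ennreal (1 - exp (- g c \<omega>)) * emeasure (clock_measure \<omega>) (grid_cell d p c)) \<in> borel_measurable M"
        by measurable
    qed
    fix H assume H: "H \<in> sets G"
    have "(\<integral>\<^sup>+\<omega>. indicator H \<omega> * exp_neg (count_int K f \<omega>) \<partial>M) =
      (\<integral>\<^sup>+\<omega>. indicator H \<omega> * exp_neg (\<Sum>c\<in>C. ennreal (g c \<omega>) * of_nat (nat \<lfloor>measure (N \<omega>) (grid_cell d p c)\<rfloor>)) \<partial>M)"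
      by (intro nn_integral_cong) (simp add: count)
    also have "\<dots> = (\<integral>\<^sup>+\<omega>. indicator H \<omega> * exp_neg (\<Sum>c\<in>C. ennreal (r * measure (clock_measure \<omega>) (grid_cell d p c)) * ennreal (1 - exp (- g c \<omega>))) \<partial>M)"
    proof (rule conditional_laplace[OF _ subalg])
      show "(\<lambda>\<omega>. r * measure (clock_measure \<omega>) (grid_cell d p c)) \<in> borel_measurable G" for c
        using mc by measurable
      show "indicator H \<in> borel_measurable G" using H by simp
      show "0 \<le> r * measure (clock_measure \<omega>) (grid_cell d p c)" for c \<omega> using r by simp
    qed (use C_def mN gG g0 grid in auto)
    also have "\<dots> = (\<integral>\<^sup>+\<omega>. indicator H \<omega> * exp_neg (ennreal r * clock_int K f \<omega>) \<partial>M)"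
      by (intro nn_integral_cong) (simp add: rclock)
    finally show "(\<integral>\<^sup>+\<omega>. indicator H \<omega> * exp_neg (count_int K f \<omega>) \<partial>M) =
      (\<integral>\<^sup>+\<omega>. indicator H \<omega> * exp_neg (ennreal r * clock_int K f \<omega>) \<partial>M)" .
  qed
qed

lemma exp_neg_integral_lim:
  fixes u :: "nat \<Rightarrow> 'w \<Rightarrow> ennreal"
  assumes H: "H \<in> sets G" and [measurable]: "\<And>n. u n \<in> borel_measurable M" "v \<in> borel_measurable M"
    and uv: "\<And>\<omega>. \<omega> \<in> space M \<Longrightarrow> (\<lambda>n. u n \<omega>) \<longlonglongrightarrow> v \<omega>"
  shows "(\<lambda>n. \<integral>\<^sup>+\<omega>. indicator H \<omega> * exp_neg (u n \<omega>) \<partial>M) \<longlonglongrightarrow> (\<integral>\<^sup>+\<omega>. indicator H \<omega> * exp_neg (v \<omega>) \<partial>M)"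
proof (rule nn_integral_dominated_convergence[where w="\<lambda>_. 1"])
  have [measurable]: "H \<in> sets M" by (rule sets_G[OF H])
  show "(\<lambda>\<omega>. indicator H \<omega> * exp_neg (u n \<omega>)) \<in> borel_measurable M" for n by measurable
  show "(\<lambda>\<omega>. indicator H \<omega> * exp_neg (v \<omega>)) \<in> borel_measurable M" by measurable
  show "AE \<omega> in M. indicator H \<omega> * exp_neg (u n \<omega>) \<le> 1" for n
    using exp_neg_le_1 by (intro AE_I2) (auto simp: indicator_def)
  show "AE \<omega> in M. (\<lambda>n. indicator H \<omega> * exp_neg (u n \<omega>)) \<longlonglongrightarrow> indicator H \<omega> * exp_neg (v \<omega>)"
    using uv tendsto_exp_neg by (intro AE_I2) (auto simp: indicator_def)
qed (auto simp: emeasure_space_1)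

text \<open>Dominated convergence on two levels: inside, the box has finite mass under both measures
  and the functions have a common bound; outside, \<open>exp_neg\<close> is at most 1 on a
  probability space.\<close>

lemma laplace_formula_lim:
  assumes f: "\<And>n. laplace_formula K (f n)" and c: "\<And>n z. f n z \<le> c"
    and lim: "\<And>z. (\<lambda>n. f n z) \<longlonglongrightarrow> g z"
  shows "laplace_formula K g"
proof -
  have f0: "0 \<le> f n z" for n z using f[of n] unfolding laplace_formula_def by blast
  have g: "0 \<le> g z" "g z \<le> c" for z
    using LIMSEQ_le_const[OF lim[of z], of 0] LIMSEQ_le_const2[OF lim[of z], of c] f0 c by auto
  have fm: "(\<lambda>x. f n (\<omega>, x)) \<in> borel_measurable borel" if "\<omega> \<in> space M" for n \<omega>
    using f[of n] that unfolding laplace_formula_def by blast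
  have gm: "(\<lambda>x. g (\<omega>, x)) \<in> borel_measurable borel" if "\<omega> \<in> space M" for \<omega>
    by (rule borel_measurable_LIMSEQ_real[OF lim fm[OF that]])
  have cnt: "(\<lambda>n. count_int K (f n) \<omega>) \<longlonglongrightarrow> count_int K g \<omega>" if \<omega>: "\<omega> \<in> space M" for \<omega>
    unfolding count_int_def
  proof (rule nn_integral_dominated_convergence[where w="\<lambda>x. ennreal c * indicator ({0..real K} \<times> {0..real K}) x"])
    have N_cong: "u \<in> borel_measurable borel \<Longrightarrow> u \<in> borel_measurable (N \<omega>)" for u :: "real \<times> real \<Rightarrow> ennreal"
      using measurable_cong_sets[OF sets_N[OF \<omega>] refl] by blast
    note [measurable] = fm[OF \<omega>] gm[OF \<omega>]
    show "(\<lambda>x. ennreal (f n (\<omega>, x)) * indicator ({0..real K} \<times> {0..real K}) x) \<in> borel_measurable (N \<omega>)" for n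
      by (rule N_cong) measurable
    show "(\<lambda>x. ennreal (g (\<omega>, x)) * indicator ({0..real K} \<times> {0..real K}) x) \<in> borel_measurable (N \<omega>)"
      by (rule N_cong) measurable
    show "(\<lambda>x. ennreal c * indicator ({0..real K} \<times> {0..real K}) x) \<in> borel_measurable (N \<omega>)"
      by (rule N_cong) measurable
    show "AE x in N \<omega>. ennreal (f n (\<omega>, x)) * indicator ({0..real K} \<times> {0..real K}) x \<le> ennreal c * indicator ({0..real K} \<times> {0..real K}) x" for n
      using c by (intro AE_I2 mult_right_mono ennreal_leI) auto
    have "(\<integral>\<^sup>+x. ennreal c * indicator ({0..real K} \<times> {0..real K}) x \<partial>N \<omega>) = ennreal c * emeasure (N \<omega>) ({0..real K} \<times> {0..real K})"
      using sets_N[OF \<omega>] by (intro nn_integral_cmult_indicator) simp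
    also have "\<dots> < \<infinity>" using N_finite[OF \<omega> box_sets bounded_box] by (simp add: ennreal_mult_less_top)
    finally show "(\<integral>\<^sup>+x. ennreal c * indicator ({0..real K} \<times> {0..real K}) x \<partial>N \<omega>) < \<infinity>" .
    show "AE x in N \<omega>. (\<lambda>n. ennreal (f n (\<omega>, x)) * indicator ({0..real K} \<times> {0..real K}) x) \<longlonglongrightarrow> ennreal (g (\<omega>, x)) * indicator ({0..real K} \<times> {0..real K}) x"
      using lim by (intro AE_I2) (auto simp: indicator_def intro!: tendsto_ennrealI)
  qed
  have clk: "(\<lambda>n. clock_int K (f n) \<omega>) \<longlonglongrightarrow> clock_int K g \<omega>" if \<omega>: "\<omega> \<in> space M" for \<omega>
    unfolding clock_int_def
  proof (rule nn_integral_dominated_convergence[where w="\<lambda>x. indicator ({0..real K} \<times> {0..real K}) x"])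
    have N_cong: "u \<in> borel_measurable borel \<Longrightarrow> u \<in> borel_measurable (clock_measure \<omega>)" for u :: "real \<times> real \<Rightarrow> ennreal"
      using measurable_cong_sets[OF sets_clock_measure refl] by blast
    note [measurable] = fm[OF \<omega>] gm[OF \<omega>]
    show "(\<lambda>x. ennreal (1 - exp (- f n (\<omega>, x))) * indicator ({0..real K} \<times> {0..real K}) x) \<in> borel_measurable (clock_measure \<omega>)" for n
      by (rule N_cong) measurable
    show "(\<lambda>x. ennreal (1 - exp (- g (\<omega>, x))) * indicator ({0..real K} \<times> {0..real K}) x) \<in> borel_measurable (clock_measure \<omega>)"
      by (rule N_cong) measurable
    show "indicator ({0..real K} \<times> {0..real K}) \<in> borel_measurable (clock_measure \<omega>)"
      using box_sets by (intro borel_measurable_indicator) simp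
    show "AE x in clock_measure \<omega>. ennreal (1 - exp (- f n (\<omega>, x))) * indicator ({0..real K} \<times> {0..real K}) x \<le> indicator ({0..real K} \<times> {0..real K}) x" for n
      by (intro AE_I2) (auto simp: indicator_def)
    show "integral\<^sup>N (clock_measure \<omega>) (indicator ({0..real K} \<times> {0..real K})) < \<infinity>"
      using clock_measure_bounded[OF \<omega> box_sets bounded_box] by simp
    show "AE x in clock_measure \<omega>. (\<lambda>n. ennreal (1 - exp (- f n (\<omega>, x))) * indicator ({0..real K} \<times> {0..real K}) x) \<longlonglongrightarrow>
        ennreal (1 - exp (- g (\<omega>, x))) * indicator ({0..real K} \<times> {0..real K}) x"
      using lim by (intro AE_I2) (auto simp: indicator_def intro!: tendsto_ennrealI tendsto_intros)
  qed
  have mf: "count_int K (f n) \<in> borel_measurable M" "clock_int K (f n) \<in> borel_measurable M" for n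
    using f[of n] by (auto simp: laplace_formula_def)
  have mg: "count_int K g \<in> borel_measurable M" "clock_int K g \<in> borel_measurable M"
    by (rule borel_measurable_LIMSEQ_order[OF cnt mf(1)], assumption)
       (rule borel_measurable_LIMSEQ_order[OF clk mf(2)], assumption)
  show ?thesis unfolding laplace_formula_def
  proof (intro conjI ballI)
    fix H assume H: "H \<in> sets G"
    have "(\<lambda>n. \<integral>\<^sup>+\<omega>. indicator H \<omega> * exp_neg (count_int K (f n) \<omega>) \<partial>M) \<longlonglongrightarrow> (\<integral>\<^sup>+\<omega>. indicator H \<omega> * exp_neg (count_int K g \<omega>) \<partial>M)"
      by (rule exp_neg_integral_lim[OF H mf(1) mg(1) cnt])
    moreover have "(\<lambda>n. \<integral>\<^sup>+\<omega>. indicator H \<omega> * exp_neg (ennreal r * clock_int K (f n) \<omega>) \<partial>M) \<longlonglongrightarrow>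
        (\<integral>\<^sup>+\<omega>. indicator H \<omega> * exp_neg (ennreal r * clock_int K g \<omega>) \<partial>M)"
      using mf(2) mg(2) clk by (intro exp_neg_integral_lim[OF H] borel_measurable_times_ennreal ennreal_tendsto_cmult) auto
    moreover have "(\<integral>\<^sup>+\<omega>. indicator H \<omega> * exp_neg (count_int K (f n) \<omega>) \<partial>M) =
        (\<integral>\<^sup>+\<omega>. indicator H \<omega> * exp_neg (ennreal r * clock_int K (f n) \<omega>) \<partial>M)" for n
      using f[of n] H by (auto simp: laplace_formula_def)
    ultimately show "(\<integral>\<^sup>+\<omega>. indicator H \<omega> * exp_neg (count_int K g \<omega>) \<partial>M) =
        (\<integral>\<^sup>+\<omega>. indicator H \<omega> * exp_neg (ennreal r * clock_int K g \<omega>) \<partial>M)"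
      by (simp add: LIMSEQ_unique)
  qed (use g gm mg in auto)
qed

lemma laplace_formula_bounded_closure:
  assumes "f \<in> bounded_closure (\<Union>d. dyadic_step G d)"
  shows "laplace_formula K f"
  using assms
proof induction
  case (base f)
  then show ?case using laplace_formula_step by blast
next
  case (lim f c g)
  show ?case by (rule laplace_formula_lim[OF lim.IH lim.hyps(2,3)])
qed

end

section \<open>From Laplace transforms to independent Poisson laws\<close>

lemma laplace_imp_poisson:
  fixes X :: "'i \<Rightarrow> 'a \<Rightarrow> ennreal"
  assumes "finite I"
    and "\<And>i. i \<in> I \<Longrightarrow> X i \<in> borel_measurable M" "W \<in> borel_measurable M"
    and "\<And>i x. i \<in> I \<Longrightarrow> x \<in> space M \<Longrightarrow> X i x \<in> range of_nat \<union> {\<infinity>}"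
    and "(\<integral>\<^sup>+x. W x \<partial>M) < \<infinity>"
    and "\<And>c. (\<And>i. 0 \<le> c i) \<Longrightarrow> (\<integral>\<^sup>+x. W x * exp_neg (\<Sum>i\<in>I. ennreal (c i) * X i x) \<partial>M) =
           a * (\<Prod>i\<in>I. exp_neg (\<rho> i * ennreal (1 - exp (- c i))))"
    and "\<And>i. i \<in> I \<Longrightarrow> C i \<in> sets borel"
  shows "(\<integral>\<^sup>+x. W x * (\<Prod>i\<in>I. indicator (C i) (X i x)) \<partial>M) =
         a * (\<Prod>i\<in>I. emeasure (measure_pmf (poisson_law (\<rho> i))) (C i))"
  using assms
proof (induction I arbitrary: W a rule: finite_induct)
  case empty
  from empty(5)[of "\<lambda>_. 0"] show ?case by simp
next
  case (insert i I)
  note [measurable] = insert.prems(2)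
  have [measurable]: "X i \<in> borel_measurable M" "\<And>j. j \<in> I \<Longrightarrow> X j \<in> borel_measurable M"
    "C i \<in> sets borel" "\<And>j. j \<in> I \<Longrightarrow> C j \<in> sets borel"
    using insert.prems by auto
  have le: "W x * exp_neg y \<le> W x" for x y
    using mult_left_mono[OF exp_neg_le_1[of y], of "W x"] by auto
  have prod_le: "(\<Prod>i\<in>I. indicator (C i) (f i)) \<le> (1::ennreal)" for f :: "'i \<Rightarrow> ennreal"
    by (rule prod_le_1) (auto simp: indicator_def)
  have a: "a < \<infinity>" using insert.prems(4) insert.prems(5)[of "\<lambda>_. 0"] by simp
  define P where "P = a * (\<Prod>i\<in>I. emeasure (measure_pmf (poisson_law (\<rho> i))) (C i))"
  have "(\<Prod>i\<in>I. emeasure (measure_pmf (poisson_law (\<rho> i))) (C i)) \<le> 1"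
    by (rule prod_le_1) (auto simp: measure_pmf.emeasure_le_1)
  then have P: "P < \<infinity>" unfolding P_def using a by (auto simp: ennreal_mult_less_top intro: le_less_trans)
  \<comment> \<open>The inversion lemma asks for values in the extended naturals at every point,
    whereas the Poisson law guarantees them only almost surely; \<open>X'\<close> is the identity
    corrected off that range.\<close>
  define X' :: "ennreal \<Rightarrow> ennreal" where "X' x = (if x \<in> range of_nat \<union> {\<infinity>} then x else 0)" for x
  have X': "AE x in measure_pmf (poisson_law (\<rho> i)). X' x = x"
    using poisson_law_range by (auto simp: AE_measure_pmf_iff X'_def)
  have "(\<integral>\<^sup>+x. W x * (\<Prod>i\<in>I. indicator (C i) (X i x)) * indicator (C i) (X i x) \<partial>M) =
      (\<integral>\<^sup>+x. P * indicator (C i) (X' x) \<partial>measure_pmf (poisson_law (\<rho> i)))"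
  proof (rule laplace_inversion_one[where X="X i" and X'=X' and h="indicator (C i)"
        and W="\<lambda>x. W x * (\<Prod>i\<in>I. indicator (C i) (X i x))" and W'="\<lambda>x. P"])
    show "(\<integral>\<^sup>+x. W x * (\<Prod>i\<in>I. indicator (C i) (X i x)) \<partial>M) < \<infinity>"
      using mult_left_mono[OF prod_le, of "W _"]
      by (intro le_less_trans[OF nn_integral_mono insert.prems(4)]) (metis mult.right_neutral zero_le)
    show "X' x \<in> range of_nat \<union> {\<infinity>}" for x
      by (auto simp: X'_def intro: range_eqI[of _ _ 0])
    show "(\<integral>\<^sup>+x. P \<partial>measure_pmf (poisson_law (\<rho> i))) < \<infinity>" using P by simp
    fix c :: real assume c: "0 \<le> c"
    \<comment> \<open>The transform of the variable \<open>i\<close> goes into the weight and its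
      Poisson transform into the constant, so that the induction hypothesis applies to the
      others.\<close>
    have "(\<integral>\<^sup>+x. (W x * exp_neg (ennreal c * X i x)) * (\<Prod>i\<in>I. indicator (C i) (X i x)) \<partial>M) =
      a * exp_neg (\<rho> i * ennreal (1 - exp (- c))) * (\<Prod>i\<in>I. emeasure (measure_pmf (poisson_law (\<rho> i))) (C i))"
    proof (rule insert.IH[of "\<lambda>x. W x * exp_neg (ennreal c * X i x)" "a * exp_neg (\<rho> i * ennreal (1 - exp (- c)))"])
      show "(\<integral>\<^sup>+x. W x * exp_neg (ennreal c * X i x) \<partial>M) < \<infinity>"
        by (intro le_less_trans[OF nn_integral_mono insert.prems(4)] le)
      fix d :: "'i \<Rightarrow> real" assume d: "\<And>j. 0 \<le> d j"
      have eq: "(\<Sum>j\<in>insert i I. ennreal ((d(i := c)) j) * Z j) = ennreal c * Z i + (\<Sum>j\<in>I. ennreal (d j) * Z j)" for Z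
        using insert.hyps by (simp add: sum.insert) (intro disjI2 sum.cong, auto)
      have eq': "(\<Prod>j\<in>insert i I. exp_neg (\<rho> j * ennreal (1 - exp (- (d(i := c)) j)))) =
          exp_neg (\<rho> i * ennreal (1 - exp (- c))) * (\<Prod>j\<in>I. exp_neg (\<rho> j * ennreal (1 - exp (- d j))))"
        using insert.hyps by (simp add: prod.insert) (intro arg_cong2[where f=times] refl prod.cong, auto)
      have "(\<integral>\<^sup>+x. W x * exp_neg (ennreal c * X i x + (\<Sum>i\<in>I. ennreal (d i) * X i x)) \<partial>M) =
        a * (exp_neg (\<rho> i * ennreal (1 - exp (- c))) * (\<Prod>j\<in>I. exp_neg (\<rho> j * ennreal (1 - exp (- d j)))))"
        using insert.prems(5)[of "d(i := c)"] c d unfolding eq eq' by simp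
      then show "(\<integral>\<^sup>+x. W x * exp_neg (ennreal c * X i x) * exp_neg (\<Sum>i\<in>I. ennreal (d i) * X i x) \<partial>M) =
        a * exp_neg (\<rho> i * ennreal (1 - exp (- c))) * (\<Prod>j\<in>I. exp_neg (\<rho> j * ennreal (1 - exp (- d j))))"
        by (simp only: exp_neg_add mult.assoc)
    qed (use insert.prems in auto)
    then have "(\<integral>\<^sup>+x. W x * (\<Prod>i\<in>I. indicator (C i) (X i x)) * exp_neg (ennreal c * X i x) \<partial>M) =
      P * exp_neg (\<rho> i * ennreal (1 - exp (- c)))"
      by (simp add: mult_ac P_def)
    also have "\<dots> = (\<integral>\<^sup>+x. P * exp_neg (ennreal c * x) \<partial>measure_pmf (poisson_law (\<rho> i)))"
      by (subst nn_integral_cmult) (simp_all add: laplace_poisson_law[OF c])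
    also have "\<dots> = (\<integral>\<^sup>+x. P * exp_neg (ennreal c * X' x) \<partial>measure_pmf (poisson_law (\<rho> i)))"
      using X' by (intro nn_integral_cong_AE) auto
    finally show "(\<integral>\<^sup>+x. W x * (\<Prod>i\<in>I. indicator (C i) (X i x)) * exp_neg (ennreal c * X i x) \<partial>M) =
      (\<integral>\<^sup>+x. P * exp_neg (ennreal c * X' x) \<partial>measure_pmf (poisson_law (\<rho> i)))" .
  qed (use insert.prems in auto)
  also have "\<dots> = (\<integral>\<^sup>+x. P * indicator (C i) x \<partial>measure_pmf (poisson_law (\<rho> i)))"
    using X' by (intro nn_integral_cong_AE) auto
  also have "\<dots> = P * emeasure (measure_pmf (poisson_law (\<rho> i))) (C i)"
    by (rule nn_integral_cmult_indicator) simp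
  finally show ?case using insert.hyps by (simp add: mult_ac P_def)
qed

lemma emeasure_lborel_line:
  "emeasure lborel ({v} \<times> (UNIV :: real set)) = 0" "emeasure lborel ((UNIV :: real set) \<times> {v :: real}) = 0"
  unfolding lborel_prod[symmetric] by (subst lborel.emeasure_pair_measure_Times; simp)+

section \<open>Counts on random sets\<close>

context grid_poisson
begin

lemma N_Int_quadrant:
  assumes \<omega>: "\<omega> \<in> space M" and A: "A \<in> sets borel"
  shows "emeasure (N \<omega>) (A \<inter> quadrant) = emeasure (N \<omega>) A"
proof -
  have "AE x in N \<omega>. x \<in> quadrant"
    using N_off_quadrant[OF \<omega>] sets_N[OF \<omega>] by (intro AE_I[of _ _ "- quadrant"]) auto
  then show ?thesis
    using A sets_N[OF \<omega>] by (intro emeasure_eq_AE) auto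
qed

lemma UN_box: "(\<Union>K. {0..real K} \<times> {0..real K}) = quadrant"
proof -
  have "\<exists>K. fst x \<le> real K \<and> snd x \<le> real K" for x :: "real \<times> real"
    using real_arch_simple[of "max (fst x) (snd x)"] by auto
  then show ?thesis by (fastforce simp: quadrant_def)
qed

lemma incseq_box: "incseq (\<lambda>K. {0..real K} \<times> {0..real K})"
  by (intro incseq_SucI) auto

lemma N_box_lim:
  assumes \<omega>: "\<omega> \<in> space M" and A: "A \<in> sets borel"
  shows "(\<lambda>K. emeasure (N \<omega>) (A \<inter> ({0..real K} \<times> {0..real K}))) \<longlonglongrightarrow> emeasure (N \<omega>) A"
proof -
  have "(\<lambda>K. emeasure (N \<omega>) (A \<inter> ({0..real K} \<times> {0..real K}))) \<longlonglongrightarrow> emeasure (N \<omega>) (\<Union>K. A \<inter> ({0..real K} \<times> {0..real K}))"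
  proof (rule Lim_emeasure_incseq)
    show "range (\<lambda>K. A \<inter> ({0..real K} \<times> {0..real K})) \<subseteq> sets (N \<omega>)"
      by (intro image_subsetI) (simp only: sets_N[OF \<omega>] A box_sets sets.Int)
    show "incseq (\<lambda>K. A \<inter> ({0..real K} \<times> {0..real K}))"
      by (intro incseq_SucI Int_mono Sigma_mono) auto
  qed
  also have "(\<Union>K. A \<inter> ({0..real K} \<times> {0..real K})) = A \<inter> quadrant"
    by (simp only: Int_UN_distrib[symmetric] UN_box)
  finally show ?thesis by (simp only: N_Int_quadrant[OF \<omega> A])
qed

lemma count_int_simple:
  assumes "finite I" "\<And>i. i \<in> I \<Longrightarrow> D i \<in> sets (G \<Otimes>\<^sub>M borel)" "\<And>i. i \<in> I \<Longrightarrow> 0 \<le> (c i :: real)" and \<omega>: "\<omega> \<in> space M"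
  shows "count_int K (\<lambda>z. \<Sum>i\<in>I. c i * indicator (D i) z) \<omega> =
     (\<Sum>i\<in>I. ennreal (c i) * emeasure (N \<omega>) ({x. (\<omega>, x) \<in> D i} \<inter> ({0..real K} \<times> {0..real K})))"
proof -
  have "count_int K (\<lambda>z. \<Sum>i\<in>I. c i * indicator (D i) z) \<omega> =
    (\<integral>\<^sup>+x. (\<Sum>i\<in>I. ennreal (c i) * indicator ({x. (\<omega>, x) \<in> D i} \<inter> ({0..real K} \<times> {0..real K})) x) \<partial>N \<omega>)"
    unfolding count_int_def
  proof (rule nn_integral_cong)
    fix x
    have "ennreal (\<Sum>i\<in>I. c i * indicator (D i) (\<omega>, x)) = (\<Sum>i\<in>I. ennreal (c i * indicator (D i) (\<omega>, x)))"
      using assms(3) by (intro sum_ennreal[symmetric]) auto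
    then show "ennreal (\<Sum>i\<in>I. c i * indicator (D i) (\<omega>, x)) * indicator ({0..real K} \<times> {0..real K}) x =
        (\<Sum>i\<in>I. ennreal (c i) * indicator ({x. (\<omega>, x) \<in> D i} \<inter> ({0..real K} \<times> {0..real K})) x)"
      by (simp add: sum_distrib_right) (intro sum.cong refl, auto simp: indicator_def)
  qed
  also have "\<dots> = (\<Sum>i\<in>I. (\<integral>\<^sup>+x. ennreal (c i) * indicator ({x. (\<omega>, x) \<in> D i} \<inter> ({0..real K} \<times> {0..real K})) x \<partial>N \<omega>))"
    using section_sets[OF assms(2)] box_sets sets_N[OF \<omega>]
    by (intro nn_integral_sum borel_measurable_times_ennreal borel_measurable_const borel_measurable_indicator) auto
  also have "\<dots> = (\<Sum>i\<in>I. ennreal (c i) * emeasure (N \<omega>) ({x. (\<omega>, x) \<in> D i} \<inter> ({0..real K} \<times> {0..real K})))"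
    using section_sets[OF assms(2)] box_sets sets_N[OF \<omega>]
    by (intro sum.cong refl nn_integral_cmult_indicator) auto
  finally show ?thesis .
qed

text \<open>A count on a random set is a limit of the integrals \<open>count_int\<close> of an
  indicator over growing boxes, and their measurability is part of
  \<open>laplace_formula\<close>.\<close>

lemma count_section_measurable:
  assumes D: "D \<in> sets (G \<Otimes>\<^sub>M borel)"
  shows "(\<lambda>\<omega>. emeasure (N \<omega>) {x. (\<omega>, x) \<in> D}) \<in> borel_measurable M"
proof (rule borel_measurable_LIMSEQ_order)
  fix \<omega> assume "\<omega> \<in> space M"
  then show "(\<lambda>K. emeasure (N \<omega>) ({x. (\<omega>, x) \<in> D} \<inter> ({0..real K} \<times> {0..real K}))) \<longlonglongrightarrow> emeasure (N \<omega>) {x. (\<omega>, x) \<in> D}"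
    by (intro N_box_lim section_sets D)
next
  fix K :: nat
  have "laplace_formula K (\<lambda>z. \<Sum>i\<in>{()}. 1 * indicator D z)"
    by (intro laplace_formula_bounded_closure simple_in_bounded_closure) (simp_all add: D)
  then have "count_int K (\<lambda>z. \<Sum>i\<in>{()}. 1 * indicator D z) \<in> borel_measurable M"
    unfolding laplace_formula_def by (elim conjE)
  moreover have "count_int K (\<lambda>z. \<Sum>i\<in>{()}. 1 * indicator D z) \<omega> = emeasure (N \<omega>) ({x. (\<omega>, x) \<in> D} \<inter> ({0..real K} \<times> {0..real K}))"
    if "\<omega> \<in> space M" for \<omega>
    using count_int_simple[of "{()}" "\<lambda>_. D" "\<lambda>_. 1" \<omega> K] D that by simp
  ultimately show "(\<lambda>\<omega>. emeasure (N \<omega>) ({x. (\<omega>, x) \<in> D} \<inter> ({0..real K} \<times> {0..real K}))) \<in> borel_measurable M"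
    by (subst measurable_cong[symmetric]) auto
qed

text \<open>Letting the boxes grow to the quadrant removes the truncation. The counts may become
  infinite in the limit, and there the continuity of \<open>exp_neg\<close> at \<infinity> is
  used.\<close>

lemma laplace_sections:
  assumes I: "finite I" and D: "\<And>i. i \<in> I \<Longrightarrow> D i \<in> sets (G \<Otimes>\<^sub>M borel)" and c: "\<And>i. i \<in> I \<Longrightarrow> 0 \<le> (c i :: real)"
    and H: "H \<in> sets G"
  shows "(\<integral>\<^sup>+\<omega>. indicator H \<omega> * exp_neg (\<Sum>i\<in>I. ennreal (c i) * emeasure (N \<omega>) {x. (\<omega>, x) \<in> D i}) \<partial>M) =
    (\<integral>\<^sup>+\<omega>. indicator H \<omega> * exp_neg (ennreal r * (\<integral>\<^sup>+x. ennreal (1 - exp (- (\<Sum>i\<in>I. c i * indicator (D i) (\<omega>, x)))) * indicator quadrant x \<partial>clock_measure \<omega>)) \<partial>M)"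
proof -
  define f where "f = (\<lambda>z. \<Sum>i\<in>I. c i * indicat_real (D i) z)"
  define Q where "Q \<omega> = (\<integral>\<^sup>+x. ennreal (1 - exp (- f (\<omega>, x))) * indicator quadrant x \<partial>clock_measure \<omega>)" for \<omega>
  have L: "laplace_formula K f" for K
    unfolding f_def by (intro laplace_formula_bounded_closure simple_in_bounded_closure I D c)
  have fm: "(\<lambda>x. f (\<omega>, x)) \<in> borel_measurable borel" if "\<omega> \<in> space M" for \<omega>
    using L[of 0] that unfolding laplace_formula_def by (elim conjE) (rule bspec)
  have m: "count_int K f \<in> borel_measurable M" "clock_int K f \<in> borel_measurable M" for K
    using L[of K] unfolding laplace_formula_def by simp_all
  have cnt: "(\<lambda>K. count_int K f \<omega>) \<longlonglongrightarrow> (\<Sum>i\<in>I. ennreal (c i) * emeasure (N \<omega>) {x. (\<omega>, x) \<in> D i})"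
    if \<omega>: "\<omega> \<in> space M" for \<omega>
  proof -
    have "count_int K f \<omega> = (\<Sum>i\<in>I. ennreal (c i) * emeasure (N \<omega>) ({x. (\<omega>, x) \<in> D i} \<inter> ({0..real K} \<times> {0..real K})))" for K
      unfolding f_def by (rule count_int_simple) (use I D c \<omega> in auto)
    then show ?thesis
      using section_sets[OF D] by (simp only:) (intro tendsto_sum ennreal_tendsto_cmult N_box_lim[OF \<omega>], auto)
  qed
  have clk: "(\<lambda>K. clock_int K f \<omega>) \<longlonglongrightarrow> Q \<omega>" if \<omega>: "\<omega> \<in> space M" for \<omega>
    unfolding clock_int_def Q_def
  proof (rule nn_integral_LIMSEQ)
    have box: "{0..real K} \<times> {0..real K} \<subseteq> {0..real L} \<times> {0..real L}" if "K \<le> L" for K L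
      using that by auto
    show "incseq (\<lambda>K x. ennreal (1 - exp (- f (\<omega>, x))) * indicator ({0..real K} \<times> {0..real K}) x)"
      using box by (intro incseq_SucI le_funI mult_left_mono) (auto simp: indicator_def)
    show "(\<lambda>x. ennreal (1 - exp (- f (\<omega>, x))) * indicator ({0..real K} \<times> {0..real K}) x) \<in> borel_measurable (clock_measure \<omega>)" for K
    proof -
      note [measurable] = fm[OF \<omega>]
      have "(\<lambda>x. ennreal (1 - exp (- f (\<omega>, x))) * indicator ({0..real K} \<times> {0..real K}) x) \<in> borel_measurable borel"
        by measurable
      then show ?thesis using measurable_cong_sets[OF sets_clock_measure refl] by blast
    qed
    show "(\<lambda>K. ennreal (1 - exp (- f (\<omega>, x))) * indicator ({0..real K} \<times> {0..real K}) x) \<longlonglongrightarrow>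
        ennreal (1 - exp (- f (\<omega>, x))) * indicator quadrant x" for x
    proof -
      have "(\<lambda>K. indicator ({0..real K} \<times> {0..real K}) x :: ennreal) \<longlonglongrightarrow> indicator (\<Union>K. {0..real K} \<times> {0..real K}) x"
        using incseq_box by (rule LIMSEQ_indicator_incseq)
      then show ?thesis unfolding UN_box by (intro ennreal_tendsto_cmult) auto
    qed
  qed
  have mc: "(\<lambda>\<omega>. \<Sum>i\<in>I. ennreal (c i) * emeasure (N \<omega>) {x. (\<omega>, x) \<in> D i}) \<in> borel_measurable M"
    by (rule borel_measurable_LIMSEQ_order[OF cnt m(1)], assumption)
  have mQ: "Q \<in> borel_measurable M"
    by (rule borel_measurable_LIMSEQ_order[OF clk m(2)], assumption)
  have "(\<lambda>K. \<integral>\<^sup>+\<omega>. indicator H \<omega> * exp_neg (count_int K f \<omega>) \<partial>M) \<longlonglongrightarrow>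
      (\<integral>\<^sup>+\<omega>. indicator H \<omega> * exp_neg (\<Sum>i\<in>I. ennreal (c i) * emeasure (N \<omega>) {x. (\<omega>, x) \<in> D i}) \<partial>M)"
    by (rule exp_neg_integral_lim[OF H m(1) mc cnt])
  moreover have "(\<lambda>K. \<integral>\<^sup>+\<omega>. indicator H \<omega> * exp_neg (ennreal r * clock_int K f \<omega>) \<partial>M) \<longlonglongrightarrow>
      (\<integral>\<^sup>+\<omega>. indicator H \<omega> * exp_neg (ennreal r * Q \<omega>) \<partial>M)"
    using m(2) mQ clk by (intro exp_neg_integral_lim[OF H] borel_measurable_times_ennreal ennreal_tendsto_cmult) auto
  moreover have "(\<integral>\<^sup>+\<omega>. indicator H \<omega> * exp_neg (count_int K f \<omega>) \<partial>M) =
      (\<integral>\<^sup>+\<omega>. indicator H \<omega> * exp_neg (ennreal r * clock_int K f \<omega>) \<partial>M)" for K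
    using L[of K] H unfolding laplace_formula_def by (elim conjE) (rule bspec)
  ultimately show ?thesis unfolding Q_def f_def by (simp add: LIMSEQ_unique)
qed

text \<open>For an indicator of a null set the exponent vanishes, so exp (- N D) has expectation 1;
  being at most 1, it equals 1 almost surely.\<close>

lemma null_section:
  assumes D: "D \<in> sets (G \<Otimes>\<^sub>M borel)"
    and null: "\<And>\<omega>. \<omega> \<in> space M \<Longrightarrow> emeasure (clock_measure \<omega>) {x. (\<omega>, x) \<in> D} = 0"
  shows "AE \<omega> in M. emeasure (N \<omega>) {x. (\<omega>, x) \<in> D} = 0"
proof -
  note [measurable] = count_section_measurable[OF D]
  let ?Z = "\<lambda>\<omega>. emeasure (N \<omega>) {x. (\<omega>, x) \<in> D}"
  have zero: "(\<integral>\<^sup>+x. ennreal (1 - exp (- indicat_real D (\<omega>, x))) * indicator quadrant x \<partial>clock_measure \<omega>) = 0" if \<omega>: "\<omega> \<in> space M" for \<omega>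
  proof -
    have "AE x in clock_measure \<omega>. (\<omega>, x) \<notin> D"
      using null[OF \<omega>] section_sets[OF D, of \<omega>] by (intro AE_I[of _ _ "{x. (\<omega>, x) \<in> D}"]) auto
    then have "(\<integral>\<^sup>+x. ennreal (1 - exp (- indicat_real D (\<omega>, x))) * indicator quadrant x \<partial>clock_measure \<omega>) =
      (\<integral>\<^sup>+x. 0 \<partial>clock_measure \<omega>)"
      by (intro nn_integral_cong_AE) auto
    then show ?thesis by simp
  qed
  have "(\<integral>\<^sup>+\<omega>. indicator (space G) \<omega> * exp_neg (?Z \<omega>) \<partial>M) =
     (\<integral>\<^sup>+\<omega>. indicator (space G) \<omega> * exp_neg (ennreal r * (\<integral>\<^sup>+x. ennreal (1 - exp (- indicat_real D (\<omega>, x))) * indicator quadrant x \<partial>clock_measure \<omega>)) \<partial>M)"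
    using laplace_sections[of "{()}" "\<lambda>_. D" "\<lambda>_. 1" "space G"] D by simp
  also have "\<dots> = (\<integral>\<^sup>+\<omega>. 1 \<partial>M)"
    by (intro nn_integral_cong) (simp add: zero space_G)
  finally have 1: "(\<integral>\<^sup>+\<omega>. exp_neg (?Z \<omega>) \<partial>M) = (\<integral>\<^sup>+\<omega>. 1 \<partial>M)"
    by (subst nn_integral_cong[where v="\<lambda>\<omega>. indicator (space G) \<omega> * exp_neg (?Z \<omega>)"]) (auto simp: space_G)
  have "(\<integral>\<^sup>+\<omega>. 1 - exp_neg (?Z \<omega>) \<partial>M) = (\<integral>\<^sup>+\<omega>. 1 \<partial>M) - (\<integral>\<^sup>+\<omega>. exp_neg (?Z \<omega>) \<partial>M)"
    using exp_neg_le_1 by (intro nn_integral_diff) (auto simp: 1 emeasure_space_1)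
  also have "\<dots> = 0" unfolding 1 by (simp add: emeasure_space_1)
  finally have "AE \<omega> in M. 1 - exp_neg (?Z \<omega>) = 0"
    by (subst (asm) nn_integral_0_iff_AE) auto
  then show ?thesis
  proof eventually_elim
    case (elim \<omega>)
    then have "1 \<le> exp_neg (?Z \<omega>)" by (simp add: diff_eq_0_iff_ennreal)
    then have "exp_neg (?Z \<omega>) = 1" using exp_neg_le_1 antisym by blast
    then show ?case by (simp add: exp_neg_eq_1_iff)
  qed
qed

end

lemma prod_indicator_eq:
  "finite I \<Longrightarrow> (\<Prod>i\<in>I. indicator (C i) (x i) :: ennreal) = (if \<forall>i\<in>I. x i \<in> C i then 1 else 0)"
  by (induction I rule: finite_induct) (auto simp: indicator_def)

lemma nn_integral_prod_indicator:
  assumes I: "finite I" and H: "H \<in> sets M"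
    and X: "\<And>i. i \<in> I \<Longrightarrow> X i \<in> borel_measurable M" and C: "\<And>i. i \<in> I \<Longrightarrow> C i \<in> sets borel"
  shows "(\<integral>\<^sup>+\<omega>. indicator H \<omega> * (\<Prod>i\<in>I. indicator (C i) (X i \<omega>)) \<partial>M) = emeasure M (H \<inter> {\<omega>\<in>space M. \<forall>i\<in>I. X i \<omega> \<in> C i})"
    and "{\<omega>\<in>space M. \<forall>i\<in>I. X i \<omega> \<in> C i} \<in> sets M"
proof -
  show m: "{\<omega>\<in>space M. \<forall>i\<in>I. X i \<omega> \<in> C i} \<in> sets M"
  proof (rule sets.sets_Collect_finite_All[OF _ I])
    fix i assume i: "i \<in> I"
    have "X i -` C i \<inter> space M \<in> sets M" by (rule measurable_sets[OF X[OF i] C[OF i]])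
    also have "X i -` C i \<inter> space M = {\<omega>\<in>space M. X i \<omega> \<in> C i}" by auto
    finally show "{\<omega>\<in>space M. X i \<omega> \<in> C i} \<in> sets M" .
  qed
  have "(\<integral>\<^sup>+\<omega>. indicator H \<omega> * (\<Prod>i\<in>I. indicator (C i) (X i \<omega>)) \<partial>M) =
    (\<integral>\<^sup>+\<omega>. indicator (H \<inter> {\<omega>\<in>space M. \<forall>i\<in>I. X i \<omega> \<in> C i}) \<omega> \<partial>M)"
    using sets.sets_into_space[OF H] by (intro nn_integral_cong) (auto simp: prod_indicator_eq[OF I] split: split_indicator)
  also have "\<dots> = emeasure M (H \<inter> {\<omega>\<in>space M. \<forall>i\<in>I. X i \<omega> \<in> C i})"
    using H m by (intro nn_integral_indicator sets.Int)
  finally show "(\<integral>\<^sup>+\<omega>. indicator H \<omega> * (\<Prod>i\<in>I. indicator (C i) (X i \<omega>)) \<partial>M) = emeasure M (H \<inter> {\<omega>\<in>space M. \<forall>i\<in>I. X i \<omega> \<in> C i})" .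
qed

text \<open>The clock carries the clock measure to Lebesgue measure on the quadrant, so random
  functions that factor through the clock have deterministic integrals.\<close>

lemma (in time_change) nn_integral_clock_measure:
  assumes \<omega>: "\<omega> \<in> space M" and \<phi>: "\<phi> \<in> borel_measurable borel"
  shows "(\<integral>\<^sup>+x. \<phi> (clock \<omega> x) * indicator quadrant x \<partial>clock_measure \<omega>) = (\<integral>\<^sup>+u. \<phi> u * indicator quadrant u \<partial>lborel)"
proof -
  note cl = clock_section[OF \<omega>]
  have cm: "clock \<omega> \<in> clock_measure \<omega> \<rightarrow>\<^sub>M borel"
    using cl measurable_cong_sets[OF sets_clock_measure refl] by blast
  have "emeasure (clock_measure \<omega>) (- quadrant) = 0"
  proof -
    have "- quadrant \<in> sets borel" using quadrant_sets by (rule borel_comp)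
    moreover have "{u \<in> quadrant. inv_clock \<omega> u \<in> - quadrant} = {}"
      using inv_clock_quadrant[OF \<omega>] by auto
    ultimately show ?thesis using emeasure_clock_measure[OF \<omega>, of "- quadrant"] by (simp only: emeasure_empty)
  qed
  then have ae: "AE x in clock_measure \<omega>. x \<in> quadrant"
    using borel_comp[OF quadrant_sets] by (intro AE_I[of _ _ "- quadrant"]) auto
  have "(\<integral>\<^sup>+x. \<phi> (clock \<omega> x) * indicator quadrant x \<partial>clock_measure \<omega>) = (\<integral>\<^sup>+x. \<phi> (clock \<omega> x) \<partial>clock_measure \<omega>)"
    using ae by (intro nn_integral_cong_AE) (auto elim!: eventually_mono)
  also have "\<dots> = (\<integral>\<^sup>+u. \<phi> u \<partial>distr (clock_measure \<omega>) borel (clock \<omega>))"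
    by (rule nn_integral_distr[symmetric, OF cm]) (simp add: \<phi>)
  also have "distr (clock_measure \<omega>) borel (clock \<omega>) = density lborel (indicator quadrant)"
  proof (rule measure_eqI)
    fix B assume "B \<in> sets (distr (clock_measure \<omega>) borel (clock \<omega>))"
    then have B: "B \<in> sets borel" by simp
    have "emeasure (distr (clock_measure \<omega>) borel (clock \<omega>)) B = emeasure lborel (quadrant \<inter> B)"
      using distr_clock_measure[OF \<omega> B] by (simp add: emeasure_distr[OF cm B] vimage_def)
    also have "\<dots> = emeasure (density lborel (indicator quadrant)) B"
      using B quadrant_sets by (simp add: emeasure_density indicator_inter_arith[symmetric])
    finally show "emeasure (distr (clock_measure \<omega>) borel (clock \<omega>)) B = emeasure (density lborel (indicator quadrant)) B" .
  qed simp
  also have "(\<integral>\<^sup>+u. \<phi> u \<partial>density lborel (indicator quadrant)) = (\<integral>\<^sup>+u. indicator quadrant u * \<phi> u \<partial>lborel)"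
    using \<phi> quadrant_sets by (intro nn_integral_density) auto
  finally show ?thesis by (simp add: mult.commute)
qed

lemma (in time_change) clock_preimage_sets:
  assumes "B \<in> sets borel"
  shows "{z \<in> space (G \<Otimes>\<^sub>M borel). clock (fst z) (snd z) \<in> B} \<in> sets (G \<Otimes>\<^sub>M borel)"
  by (rule measurable_sets_Collect) (use clock_measurable assms in \<open>auto\<close>)

section \<open>The image of the counting measure under the clock\<close>

context grid_poisson
begin

text \<open>This is the Poisson field that will witness the definition of the fractional
  field.\<close>

definition unclocked :: "'w \<Rightarrow> (real \<times> real) measure" where
  "unclocked \<omega> = distr (N \<omega>) borel (clock \<omega>)"

lemma emeasure_unclocked:
  assumes \<omega>: "\<omega> \<in> space M" and B: "B \<in> sets borel"
  shows "emeasure (unclocked \<omega>) B = emeasure (N \<omega>) {x. clock \<omega> x \<in> B}"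
proof -
  have "clock \<omega> \<in> N \<omega> \<rightarrow>\<^sub>M borel"
    using clock_section[OF \<omega>] measurable_cong_sets[OF sets_N[OF \<omega>] refl] by blast
  from emeasure_distr[OF this B] show ?thesis by (simp add: unclocked_def vimage_def space_N[OF \<omega>])
qed

lemma unclocked_section:
  assumes \<omega>: "\<omega> \<in> space M" and B: "B \<in> sets borel"
  shows "emeasure (unclocked \<omega>) B = emeasure (N \<omega>) {x. (\<omega>, x) \<in> {z \<in> space (G \<Otimes>\<^sub>M borel). clock (fst z) (snd z) \<in> B}}"
  using \<omega> by (simp add: emeasure_unclocked[OF assms] space_pair_measure space_G)

lemma unclocked_measurable:
  assumes B: "B \<in> sets borel"
  shows "(\<lambda>\<omega>. emeasure (unclocked \<omega>) B) \<in> borel_measurable M"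
  by (subst measurable_cong[OF unclocked_section[OF _ B]]) (assumption, rule count_section_measurable[OF clock_preimage_sets[OF B]])

lemma unclocked_range:
  assumes \<omega>: "\<omega> \<in> space M" and B: "B \<in> sets borel"
  shows "emeasure (unclocked \<omega>) B \<in> range of_nat \<union> {\<infinity>}"
  unfolding unclocked_section[OF assms] by (rule N_range[OF \<omega> section_sets[OF clock_preimage_sets[OF B]]])

lemma random_counting_unclocked: "random_counting_measure M unclocked"
  unfolding random_counting_measure_def counting_measure_def locally_finite_measure_def
proof (intro conjI ballI impI)
  fix \<omega> assume \<omega>: "\<omega> \<in> space M"
  show "sets (unclocked \<omega>) = sets borel" by (simp add: unclocked_def)
  have "{x. clock \<omega> x \<in> - quadrant} = {}" using clock_quadrant[OF \<omega>] by auto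
  then show "emeasure (unclocked \<omega>) (- quadrant) = 0"
    by (simp only: emeasure_unclocked[OF \<omega> borel_comp[OF quadrant_sets]] emeasure_empty)
  fix B :: "(real \<times> real) set" assume B: "B \<in> sets borel"
  show "emeasure (unclocked \<omega>) B \<in> range of_nat \<union> {\<infinity>}" by (rule unclocked_range[OF \<omega> B])
  assume "bounded B"
  then obtain K where K: "\<And>x. x \<in> B \<Longrightarrow> norm x \<le> K" using bounded_iff by blast
  \<comment> \<open>The paths are unbounded, so past these times the clock has left the ball of
    radius K; the extra 1 makes the inequality strict.\<close>
  obtain s t where st: "K + 1 \<le> y1 s \<omega>" "K + 1 \<le> y2 t \<omega>" 
    using y_good[OF \<omega>] unfolding good_path_def by meson
  have sub: "{x. clock \<omega> x \<in> B} \<inter> quadrant \<subseteq> {0..s} \<times> {0..t}"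
  proof
    fix x assume x: "x \<in> {x. clock \<omega> x \<in> B} \<inter> quadrant"
    then have "norm (clock \<omega> x) \<le> K" using K by auto
    then have "\<bar>y1 (fst x) \<omega>\<bar> \<le> K" "\<bar>y2 (snd x) \<omega>\<bar> \<le> K"
      using norm_fst_le[of "y1 (fst x) \<omega>" "y2 (snd x) \<omega>"] norm_snd_le[of "y2 (snd x) \<omega>" "y1 (fst x) \<omega>"]
      by (auto simp: clock_def)
    then have "\<not> s \<le> fst x" "\<not> t \<le> snd x"
      using st y_mono[OF \<omega>, of s "fst x"] y_mono[OF \<omega>, of t "snd x"] by auto
    then show "x \<in> {0..s} \<times> {0..t}" using x by (cases x) (auto simp: quadrant_def)
  qed
  have m: "{x. clock \<omega> x \<in> B} \<in> sets borel"
    using measurable_sets[OF clock_section[OF \<omega>] B] by (simp add: vimage_def)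
  have "emeasure (N \<omega>) ({x. clock \<omega> x \<in> B} \<inter> quadrant) < \<infinity>"
    by (rule N_finite[OF \<omega> sets.Int[OF m quadrant_sets]
      bounded_subset[OF bounded_Times[OF bounded_closed_interval bounded_closed_interval] sub]])
  then show "emeasure (unclocked \<omega>) B < \<infinity>"
    by (simp only: emeasure_unclocked[OF \<omega> B] N_Int_quadrant[OF \<omega> m])
next
  show "(\<lambda>\<omega>. emeasure (unclocked \<omega>) B) \<in> borel_measurable M" if "B \<in> sets borel" for B
    by (rule unclocked_measurable[OF that])
qed

text \<open>The random sets are preimages under the clock, so the exponent is an integral against
  Lebesgue measure and no longer depends on \<omega>. The resulting factorisation over
  \<open>H\<close> holds the Poisson law and the independence from \<open>G\<close> at the same
  time.\<close>

lemma laplace_unclocked: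
  assumes I: "finite I" and B: "\<And>i. i \<in> I \<Longrightarrow> B i \<in> sets borel" and c: "\<And>i. i \<in> I \<Longrightarrow> 0 \<le> (c i :: real)"
    and H: "H \<in> sets G"
  shows "(\<integral>\<^sup>+\<omega>. indicator H \<omega> * exp_neg (\<Sum>i\<in>I. ennreal (c i) * emeasure (unclocked \<omega>) (B i)) \<partial>M) =
    emeasure M H * exp_neg (ennreal r * (\<integral>\<^sup>+u. ennreal (1 - exp (- (\<Sum>i\<in>I. c i * indicator (B i) u))) * indicator quadrant u \<partial>lborel))"
    (is "_ = _ * ?e")
proof -
  define D where "D i = {z \<in> space (G \<Otimes>\<^sub>M borel). clock (fst z) (snd z) \<in> B i}" for i
  have D: "D i \<in> sets (G \<Otimes>\<^sub>M borel)" if "i \<in> I" for i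
    unfolding D_def by (rule clock_preimage_sets[OF B[OF that]])
  have "(\<integral>\<^sup>+\<omega>. indicator H \<omega> * exp_neg (\<Sum>i\<in>I. ennreal (c i) * emeasure (unclocked \<omega>) (B i)) \<partial>M) =
    (\<integral>\<^sup>+\<omega>. indicator H \<omega> * exp_neg (\<Sum>i\<in>I. ennreal (c i) * emeasure (N \<omega>) {x. (\<omega>, x) \<in> D i}) \<partial>M)"
  proof (rule nn_integral_cong)
    fix \<omega> assume \<omega>: "\<omega> \<in> space M"
    have "(\<Sum>i\<in>I. ennreal (c i) * emeasure (unclocked \<omega>) (B i)) = (\<Sum>i\<in>I. ennreal (c i) * emeasure (N \<omega>) {x. (\<omega>, x) \<in> D i})"
      unfolding D_def by (rule sum.cong[OF refl], subst unclocked_section[OF \<omega> B]) simp_all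
    then show "indicator H \<omega> * exp_neg (\<Sum>i\<in>I. ennreal (c i) * emeasure (unclocked \<omega>) (B i)) =
        indicator H \<omega> * exp_neg (\<Sum>i\<in>I. ennreal (c i) * emeasure (N \<omega>) {x. (\<omega>, x) \<in> D i})" by (simp only:)
  qed
  also have "\<dots> = (\<integral>\<^sup>+\<omega>. indicator H \<omega> * exp_neg (ennreal r * (\<integral>\<^sup>+x. ennreal (1 - exp (- (\<Sum>i\<in>I. c i * indicator (D i) (\<omega>, x)))) * indicator quadrant x \<partial>clock_measure \<omega>)) \<partial>M)"
    by (rule laplace_sections[OF I D c H])
  also have "\<dots> = (\<integral>\<^sup>+\<omega>. ?e * indicator H \<omega> \<partial>M)"
  proof (rule nn_integral_cong)
    fix \<omega> assume \<omega>: "\<omega> \<in> space M"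
    have "indicator (D i) (\<omega>, x) = (indicator (B i) (clock \<omega> x) :: real)" for i x
      using \<omega> by (auto simp: D_def indicator_def space_pair_measure space_G)
    then have "(\<integral>\<^sup>+x. ennreal (1 - exp (- (\<Sum>i\<in>I. c i * indicator (D i) (\<omega>, x)))) * indicator quadrant x \<partial>clock_measure \<omega>) =
      (\<integral>\<^sup>+x. ennreal (1 - exp (- (\<Sum>i\<in>I. c i * indicator (B i) (clock \<omega> x)))) * indicator quadrant x \<partial>clock_measure \<omega>)"
      by (simp only:)
    also have "\<dots> = (\<integral>\<^sup>+u. ennreal (1 - exp (- (\<Sum>i\<in>I. c i * indicator (B i) u))) * indicator quadrant u \<partial>lborel)"
    proof (rule nn_integral_clock_measure[OF \<omega>])
      note [measurable] = B
      show "(\<lambda>u. ennreal (1 - exp (- (\<Sum>i\<in>I. c i * indicator (B i) u)))) \<in> borel_measurable borel" by measurable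
    qed
    finally show "indicator H \<omega> * exp_neg (ennreal r * (\<integral>\<^sup>+x. ennreal (1 - exp (- (\<Sum>i\<in>I. c i * indicator (D i) (\<omega>, x)))) * indicator quadrant x \<partial>clock_measure \<omega>)) =
      ?e * indicator H \<omega>"
      by (simp only: mult.commute)
  qed
  also have "\<dots> = ?e * emeasure M H"
    by (rule nn_integral_cmult_indicator[OF sets_G[OF H]])
  finally show ?thesis by (simp only: mult.commute)
qed

lemma unclocked_indep:
  assumes I: "finite I" and B: "\<And>i. i \<in> I \<Longrightarrow> B i \<in> sets borel" and C: "\<And>i. i \<in> I \<Longrightarrow> C i \<in> sets borel"
    and H: "H \<in> sets G"
  shows "emeasure M (H \<inter> {\<omega>\<in>space M. \<forall>i\<in>I. emeasure (unclocked \<omega>) (B i) \<in> C i}) =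
    emeasure M H * emeasure M {\<omega>\<in>space M. \<forall>i\<in>I. emeasure (unclocked \<omega>) (B i) \<in> C i}"
proof -
  let ?X = "\<lambda>i \<omega>. emeasure (unclocked \<omega>) (B i)"
  have X: "?X i \<in> borel_measurable M" if "i \<in> I" for i by (rule unclocked_measurable[OF B[OF that]])
  have HM: "H \<in> sets M" by (rule sets_G[OF H])
  have fin: "emeasure M H < \<infinity>" by (simp add: less_top[symmetric])
  have "(\<integral>\<^sup>+\<omega>. indicator H \<omega> * (\<Prod>i\<in>I. indicator (C i) (?X i \<omega>)) \<partial>M) =
    (\<integral>\<^sup>+\<omega>. (emeasure M H * indicator (space M) \<omega>) * (\<Prod>i\<in>I. indicator (C i) (?X i \<omega>)) \<partial>M)"
  \<comment> \<open>The weights compared are the indicator of \<open>H\<close> and the constant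
    probability of \<open>H\<close>. By the factorisation they have the same transforms.\<close>
  proof (rule laplace_inversion[OF I])
    fix c :: "'a \<Rightarrow> real" assume c: "\<And>i. 0 \<le> c i"
    then have c': "\<And>i. i \<in> I \<Longrightarrow> 0 \<le> c i" by blast
    have "(\<integral>\<^sup>+\<omega>. (emeasure M H * indicator (space M) \<omega>) * exp_neg (\<Sum>i\<in>I. ennreal (c i) * ?X i \<omega>) \<partial>M) =
      emeasure M H * (\<integral>\<^sup>+\<omega>. indicator (space M) \<omega> * exp_neg (\<Sum>i\<in>I. ennreal (c i) * ?X i \<omega>) \<partial>M)"
      unfolding mult.assoc using X
      by (intro nn_integral_cmult borel_measurable_times_ennreal measurable_compose[OF _ borel_measurable_exp_neg]
          borel_measurable_sum borel_measurable_const borel_measurable_indicator) auto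
    also have "\<dots> = (\<integral>\<^sup>+\<omega>. indicator H \<omega> * exp_neg (\<Sum>i\<in>I. ennreal (c i) * ?X i \<omega>) \<partial>M)"
      by (subst (1 2) laplace_unclocked) (use I B c' H in \<open>simp_all add: space_G[symmetric] emeasure_space_1[folded space_G]\<close>)
    finally show "(\<integral>\<^sup>+\<omega>. indicator H \<omega> * exp_neg (\<Sum>i\<in>I. ennreal (c i) * ?X i \<omega>) \<partial>M) =
      (\<integral>\<^sup>+\<omega>. (emeasure M H * indicator (space M) \<omega>) * exp_neg (\<Sum>i\<in>I. ennreal (c i) * ?X i \<omega>) \<partial>M)" by (rule sym)
  next
    show "(\<integral>\<^sup>+\<omega>. indicator H \<omega> \<partial>M) < \<infinity>" using HM fin by simp
    show "(\<integral>\<^sup>+\<omega>. emeasure M H * indicator (space M) \<omega> \<partial>M) < \<infinity>"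
      using fin by (simp add: nn_integral_cmult_indicator emeasure_space_1)
  qed (use X C HM B unclocked_range in auto)
  also have "\<dots> = emeasure M H * (\<integral>\<^sup>+\<omega>. indicator (space M) \<omega> * (\<Prod>i\<in>I. indicator (C i) (?X i \<omega>)) \<partial>M)"
    unfolding mult.assoc using X C
    by (intro nn_integral_cmult borel_measurable_times_ennreal borel_measurable_prod_ennreal
        borel_measurable_const borel_measurable_indicator measurable_compose[OF _ borel_measurable_indicator]) auto
  finally have "(\<integral>\<^sup>+\<omega>. indicator H \<omega> * (\<Prod>i\<in>I. indicator (C i) (?X i \<omega>)) \<partial>M) =
    emeasure M H * (\<integral>\<^sup>+\<omega>. indicator (space M) \<omega> * (\<Prod>i\<in>I. indicator (C i) (?X i \<omega>)) \<partial>M)" .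
  moreover have "(\<integral>\<^sup>+\<omega>. indicator H' \<omega> * (\<Prod>i\<in>I. indicator (C i) (?X i \<omega>)) \<partial>M) =
      emeasure M (H' \<inter> {\<omega>\<in>space M. \<forall>i\<in>I. ?X i \<omega> \<in> C i})" if "H' \<in> sets M" for H'
    by (rule nn_integral_prod_indicator(1)) (use I X C that in auto)
  moreover have "space M \<inter> {\<omega>\<in>space M. \<forall>i\<in>I. ?X i \<omega> \<in> C i} = {\<omega>\<in>space M. \<forall>i\<in>I. ?X i \<omega> \<in> C i}" by blast
  ultimately show ?thesis by (simp only: HM sets.top)
qed

lemma unclocked_law:
  assumes I: "finite I" and B: "\<And>i. i \<in> I \<Longrightarrow> B i \<in> sets borel" "\<And>i. i \<in> I \<Longrightarrow> B i \<subseteq> quadrant"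
    and dis: "disjoint_family_on B I" and C: "\<And>i. i \<in> I \<Longrightarrow> C i \<in> sets borel"
  shows "emeasure M {\<omega>\<in>space M. \<forall>i\<in>I. emeasure (unclocked \<omega>) (B i) \<in> C i} =
    (\<Prod>i\<in>I. emeasure (measure_pmf (poisson_law (ennreal r * emeasure lborel (B i)))) (C i))"
proof -
  let ?X = "\<lambda>i \<omega>. emeasure (unclocked \<omega>) (B i)"
  have X: "?X i \<in> borel_measurable M" if "i \<in> I" for i by (rule unclocked_measurable[OF B(1)[OF that]])
  have "(\<integral>\<^sup>+\<omega>. indicator (space M) \<omega> * (\<Prod>i\<in>I. indicator (C i) (?X i \<omega>)) \<partial>M) =
    1 * (\<Prod>i\<in>I. emeasure (measure_pmf (poisson_law (ennreal r * emeasure lborel (B i)))) (C i))"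
  proof (rule laplace_imp_poisson[OF I])
    fix c :: "'a \<Rightarrow> real" assume c: "\<And>i. 0 \<le> c i"
    then have c': "\<And>i. i \<in> I \<Longrightarrow> 0 \<le> c i" by blast
    \<comment> \<open>By disjointness at most one indicator is nonzero at u, so 1 - exp (- sum)
      splits into a sum; this is what makes the counts independent.\<close>
    have pt: "ennreal (1 - exp (- (\<Sum>i\<in>I. c i * indicator (B i) u))) * indicator quadrant u =
      (\<Sum>i\<in>I. ennreal (1 - exp (- c i)) * indicator (B i) u)" for u
    proof (cases "\<exists>i\<in>I. u \<in> B i")
      case True
      then obtain i where i: "i \<in> I" "u \<in> B i" by blast
      then have other: "u \<notin> B j" if "j \<in> I" "j \<noteq> i" for j
        using dis that by (auto simp: disjoint_family_on_def)
      have "(\<Sum>i\<in>I. c i * indicator (B i) u) = (\<Sum>i\<in>{i}. c i * indicator (B i) u)"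
        "(\<Sum>i\<in>I. ennreal (1 - exp (- c i)) * indicator (B i) u) = (\<Sum>i\<in>{i}. ennreal (1 - exp (- c i)) * indicator (B i) u)"
        using I i other by (intro sum.mono_neutral_right; auto)+
      moreover have "u \<in> quadrant" using B(2) i by blast
      ultimately show ?thesis using i by simp
    next
      case False
      then show ?thesis by (simp add: sum.neutral)
    qed
    have "(\<integral>\<^sup>+u. ennreal (1 - exp (- (\<Sum>i\<in>I. c i * indicator (B i) u))) * indicator quadrant u \<partial>lborel) =
      (\<Sum>i\<in>I. (\<integral>\<^sup>+u. ennreal (1 - exp (- c i)) * indicator (B i) u \<partial>lborel))"
      unfolding pt using B(1)
      by (intro nn_integral_sum borel_measurable_times_ennreal borel_measurable_const borel_measurable_indicator) simp
    also have "\<dots> = (\<Sum>i\<in>I. ennreal (1 - exp (- c i)) * emeasure lborel (B i))"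
      using B(1) by (intro sum.cong refl nn_integral_cmult_indicator) simp
    finally have "ennreal r * (\<integral>\<^sup>+u. ennreal (1 - exp (- (\<Sum>i\<in>I. c i * indicator (B i) u))) * indicator quadrant u \<partial>lborel) =
      (\<Sum>i\<in>I. ennreal r * emeasure lborel (B i) * ennreal (1 - exp (- c i)))"
      by (simp only: sum_distrib_left mult_ac)
    then show "(\<integral>\<^sup>+\<omega>. indicator (space M) \<omega> * exp_neg (\<Sum>i\<in>I. ennreal (c i) * ?X i \<omega>) \<partial>M) =
      1 * (\<Prod>i\<in>I. exp_neg (ennreal r * emeasure lborel (B i) * ennreal (1 - exp (- c i))))"
      by (subst laplace_unclocked) (use I B(1) c' in \<open>simp_all add: space_G[symmetric] emeasure_space_1[folded space_G] exp_neg_sum[symmetric]\<close>)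
  next
    show "(\<integral>\<^sup>+\<omega>. indicator (space M) \<omega> \<partial>M) < \<infinity>" by (simp add: emeasure_space_1)
  qed (use X C B unclocked_range in auto)
  moreover have "(\<integral>\<^sup>+\<omega>. indicator (space M) \<omega> * (\<Prod>i\<in>I. indicator (C i) (?X i \<omega>)) \<partial>M) =
      emeasure M (space M \<inter> {\<omega>\<in>space M. \<forall>i\<in>I. ?X i \<omega> \<in> C i})"
    by (rule nn_integral_prod_indicator(1)) (use I X C in auto)
  moreover have "space M \<inter> {\<omega>\<in>space M. \<forall>i\<in>I. ?X i \<omega> \<in> C i} = {\<omega>\<in>space M. \<forall>i\<in>I. ?X i \<omega> \<in> C i}" by blast
  ultimately show ?thesis by (simp only: mult_1)
qed

lemma unclocked_prf: "poisson_random_field M r unclocked"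
  unfolding poisson_random_field_def
proof (intro conjI ballI allI impI)
  show "random_counting_measure M unclocked" by (rule random_counting_unclocked)
next
  fix B :: "(real \<times> real) set" and C :: "ennreal set"
  assume B: "B \<in> sets borel" "B \<subseteq> quadrant" and C: "C \<in> sets borel"
  have "emeasure M {\<omega>\<in>space M. emeasure (unclocked \<omega>) B \<in> C} = emeasure (measure_pmf (poisson_law (ennreal r * emeasure lborel B))) C"
    using unclocked_law[of "{()}" "\<lambda>_. B" "\<lambda>_. C"] B C by (simp add: disjoint_family_on_def)
  then show "measure M {\<omega>\<in>space M. emeasure (unclocked \<omega>) B \<in> C} = measure_pmf.prob (poisson_law (ennreal r * emeasure lborel B)) C"
    by (simp add: measure_def)
next
  fix n :: nat and B :: "nat \<Rightarrow> (real \<times> real) set"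
  assume B: "(\<forall>i<n. B i \<in> sets borel \<and> B i \<subseteq> quadrant) \<and> disjoint_family_on B {..<n}"
  let ?X = "\<lambda>i \<omega>. emeasure (unclocked \<omega>) (B i)"
  have Bi: "B i \<in> sets borel" "B i \<subseteq> quadrant" if "i \<in> {..<n}" for i using B that by auto
  have X: "?X i \<in> borel_measurable M" if "i \<in> {..<n}" for i by (rule unclocked_measurable[OF Bi(1)[OF that]])
  show "indep_vars (\<lambda>_. borel) ?X {..<n}"
    unfolding indep_vars_def2
  proof (intro conjI ballI indep_setsI)
    fix i assume i: "i \<in> {..<n}"
    show "random_variable borel (?X i)" by (rule X[OF i])
    then show "{?X i -` A \<inter> space M |A. A \<in> sets borel} \<subseteq> events"
      using measurable_sets[OF X[OF i]] by blast
  next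
    fix A J assume J: "J \<noteq> {}" "J \<subseteq> {..<n}" "finite J" and A: "\<forall>j\<in>J. A j \<in> {?X j -` A \<inter> space M |A. A \<in> sets borel}"
    from A have "\<forall>j\<in>J. \<exists>C. C \<in> sets borel \<and> A j = ?X j -` C \<inter> space M" by blast
    then obtain C where C: "\<And>j. j \<in> J \<Longrightarrow> C j \<in> sets borel" "\<And>j. j \<in> J \<Longrightarrow> A j = ?X j -` C j \<inter> space M"
      by metis
    have dis: "disjoint_family_on B J" using B J(2) disjoint_family_on_mono by blast
    have one: "emeasure M (A j) = emeasure (measure_pmf (poisson_law (ennreal r * emeasure lborel (B j)))) (C j)" if "j \<in> J" for j
    proof -
      have "A j = {\<omega>\<in>space M. \<forall>i\<in>{j}. ?X i \<omega> \<in> C i}" using C(2)[OF that] by auto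
      then show ?thesis using unclocked_law[of "{j}" B C] Bi that J C by (auto simp: disjoint_family_on_def)
    qed
    have "(\<Inter>j\<in>J. A j) = {\<omega>\<in>space M. \<forall>i\<in>J. ?X i \<omega> \<in> C i}" using C(2) J(1) by auto
    moreover have "B i \<in> sets borel" "B i \<subseteq> quadrant" if "i \<in> J" for i using Bi J(2) that by auto
    note unclocked_law[OF J(3) this dis C(1)]
    ultimately have "emeasure M (\<Inter>j\<in>J. A j) = (\<Prod>j\<in>J. emeasure M (A j))"
      by (simp add: one)
    then show "prob (\<Inter>j\<in>J. A j) = (\<Prod>j\<in>J. prob (A j))"
      by (simp add: emeasure_eq_measure prod_ennreal prod_nonneg)
  qed
qed

text \<open>Events fixed by finitely many counts generate the algebra of the field. Indexing them by
  finite sets of pairs turns intersections into unions of index sets, which gives stability under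
  intersection.\<close>

lemma unclocked_indep_set: "indep_set (sets (field_algebra M unclocked)) (sets G)"
proof -
  let ?E = "\<lambda>F. {\<omega>\<in>space M. \<forall>bc\<in>F. emeasure (unclocked \<omega>) (fst bc) \<in> snd bc}"
  let ?\<F> = "{F :: ((real \<times> real) set \<times> ennreal set) set. finite F \<and> F \<subseteq> sets borel \<times> sets borel}"
  have ind: "indep_set (?E ` ?\<F>) (sets G)"
  proof (rule indep_setI)
    show "?E ` ?\<F> \<subseteq> events"
    proof (rule image_subsetI)
      fix F assume "F \<in> ?\<F>"
      then show "?E F \<in> events"
        by (intro nn_integral_prod_indicator(2)[where I=F and X="\<lambda>bc \<omega>. emeasure (unclocked \<omega>) (fst bc)" and C=snd] unclocked_measurable) auto
    qed
    show "sets G \<subseteq> events" using sets_G by blast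
    fix a H assume "a \<in> ?E ` ?\<F>" and H: "H \<in> sets G"
    then obtain F where F: "finite F" "F \<subseteq> sets borel \<times> sets borel" "a = ?E F" by blast
    have "emeasure M (H \<inter> a) = emeasure M H * emeasure M a"
      unfolding F(3) by (rule unclocked_indep[OF F(1) _ _ H]) (use F(2) in auto)
    then have "ennreal (prob (H \<inter> a)) = ennreal (prob H * prob a)"
      by (simp add: emeasure_eq_measure ennreal_mult)
    then show "prob (a \<inter> H) = prob a * prob H"
      by (simp add: Int_commute mult.commute)
  qed
  have sig: "indep_set (sigma_sets (space M) (?E ` ?\<F>)) (sigma_sets (space M) (sets G))"
  proof (rule indep_set_sigma_sets[OF ind])
    show "Int_stable (?E ` ?\<F>)"
    proof (rule Int_stableI)
      fix a b assume "a \<in> ?E ` ?\<F>" "b \<in> ?E ` ?\<F>"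
      then obtain F F' where "F \<in> ?\<F>" "F' \<in> ?\<F>" "a = ?E F" "b = ?E F'" by blast
      then have "a \<inter> b = ?E (F \<union> F')" "F \<union> F' \<in> ?\<F>" by auto
      then show "a \<inter> b \<in> ?E ` ?\<F>" by blast
    qed
    show "Int_stable (sets G)" by (auto simp: Int_stable_def)
  qed
  have G: "sigma_sets (space M) (sets G) = sets G"
    using sets.sigma_sets_eq[of G] by (simp add: space_G)
  have sub: "sets (field_algebra M unclocked) \<subseteq> sigma_sets (space M) (?E ` ?\<F>)"
  proof -
    let ?S = "{(\<lambda>\<omega>. emeasure (unclocked \<omega>) B) -` C \<inter> space M |B C. B \<in> sets borel \<and> C \<in> sets borel}"
    have "?S \<subseteq> ?E ` ?\<F>"
    proof
      fix S assume "S \<in> ?S"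
      then obtain B C where BC: "S = (\<lambda>\<omega>. emeasure (unclocked \<omega>) B) -` C \<inter> space M" "B \<in> sets borel" "C \<in> sets borel" by blast
      then have "S = ?E {(B, C)}" by auto
      then show "S \<in> ?E ` ?\<F>" using BC by blast
    qed
    moreover have "sets (field_algebra M unclocked) = sigma_sets (space M) ?S"
      unfolding field_algebra_def by (intro sets_measure_of) blast
    ultimately show ?thesis by (simp only: sigma_sets_mono')
  qed
  show ?thesis unfolding indep_set_def
  proof (rule indep_sets_mono_sets[OF sig[unfolded G indep_set_def]])
    show "(case i of True \<Rightarrow> sets (field_algebra M unclocked) | False \<Rightarrow> sets G) \<subseteq>
        (case i of True \<Rightarrow> sigma_sets (space M) (?E ` ?\<F>) | False \<Rightarrow> sets G)" for i
      using sub by (cases i) simp_all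
  qed
qed

text \<open>The preimage of the rectangle below the clock at (t1, t2) can exceed [0, t1] x [0, t2]
  only by points reached through a stretch on which one of the paths is constant. Such points carry
  no clock mass, hence almost surely no points of \<open>N\<close>.\<close>

lemma unclocked_rectangles:
  "AE \<omega> in M. \<forall>t1\<ge>0. \<forall>t2\<ge>0. emeasure (N \<omega>) ({0..t1} \<times> {0..t2}) =
     emeasure (unclocked \<omega>) ({0..y1 t1 \<omega>} \<times> {0..y2 t2 \<omega>})"
proof -
  \<comment> \<open>Points beyond q, in one coordinate, at which the path still has its value at q.
    Letting q be rational covers all constant stretches by countably many random sets.\<close>
  define D where "D q = {z \<in> space (G \<Otimes>\<^sub>M (borel :: (real \<times> real) measure)).
     (q < fst (snd z) \<and> fst (clock (fst z) (snd z)) = y1 q (fst z)) \<or>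
     (q < snd (snd z) \<and> snd (clock (fst z) (snd z)) = y2 q (fst z))}" for q
  have Dm: "D q \<in> sets (G \<Otimes>\<^sub>M borel)" for q
  proof -
    note [measurable] = clock_measurable y_measurable
    have [measurable]: "(fst :: real \<times> real \<Rightarrow> real) \<in> borel_measurable borel" "(snd :: real \<times> real \<Rightarrow> real) \<in> borel_measurable borel"
      by (auto intro!: borel_measurable_continuous_onI continuous_intros)
    have [measurable]: "(\<lambda>z. fst (clock (fst z) (snd z))) \<in> borel_measurable (G \<Otimes>\<^sub>M borel)"
      "(\<lambda>z. snd (clock (fst z) (snd z))) \<in> borel_measurable (G \<Otimes>\<^sub>M borel)"
      "(\<lambda>z :: 'w \<times> real \<times> real. fst (snd z)) \<in> borel_measurable (G \<Otimes>\<^sub>M borel)"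
      "(\<lambda>z :: 'w \<times> real \<times> real. snd (snd z)) \<in> borel_measurable (G \<Otimes>\<^sub>M borel)"
      by measurable
    show ?thesis unfolding D_def by measurable
  qed
  have null: "emeasure (clock_measure \<omega>) {x. (\<omega>, x) \<in> D q} = 0" if \<omega>: "\<omega> \<in> space M" for \<omega> q
  proof -
    \<comment> \<open>The clock sends the points of \<open>D q\<close> into these two lines, which
      are Lebesgue null.\<close>
    let ?L = "{y1 q \<omega>} \<times> UNIV \<union> UNIV \<times> {y2 q \<omega>}"
    have L: "?L \<in> sets borel" by (intro sets.Un borel_closed closed_Times) auto
    have clL: "{x. clock \<omega> x \<in> ?L} \<in> sets borel"
      using measurable_sets[OF clock_section[OF \<omega>] L] by (simp add: vimage_def)
    have "emeasure (clock_measure \<omega>) {x. (\<omega>, x) \<in> D q} \<le> emeasure (clock_measure \<omega>) {x. clock \<omega> x \<in> ?L}"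
      using clL by (intro emeasure_mono) (auto simp: D_def clock_def)
    also have "\<dots> = emeasure lborel (quadrant \<inter> ?L)" by (rule distr_clock_measure[OF \<omega> L])
    also have "\<dots> \<le> emeasure lborel ?L" using L by (intro emeasure_mono) auto
    also have "\<dots> \<le> emeasure lborel ({y1 q \<omega>} \<times> (UNIV :: real set)) + emeasure lborel ((UNIV :: real set) \<times> {y2 q \<omega>})"
      by (intro emeasure_subadditive) (auto intro!: borel_closed closed_Times)
    also have "\<dots> = 0" by (simp add: emeasure_lborel_line)
    finally show ?thesis by simp
  qed
  \<comment> \<open>One exceptional event for all rational q, and thereby for all (t1, t2)
    simultaneously.\<close>
  have "AE \<omega> in M. \<forall>q\<in>\<rat>. emeasure (N \<omega>) {x. (\<omega>, x) \<in> D q} = 0"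
    using null_section[OF Dm null] by (simp add: AE_ball_countable[OF countable_rat])
  then show ?thesis
  proof (rule AE_mp, intro AE_I2 impI allI)
    fix \<omega> and t1 t2 :: real assume \<omega>: "\<omega> \<in> space M" and q: "\<forall>q\<in>\<rat>. emeasure (N \<omega>) {x. (\<omega>, x) \<in> D q} = 0"
      and t: "0 \<le> t1" "0 \<le> t2"
    let ?R = "{0..t1} \<times> {0..t2}" and ?B = "{0..y1 t1 \<omega>} \<times> {0..y2 t2 \<omega>}"
    have B: "?B \<in> sets borel" and R: "?R \<in> sets borel" by (auto intro!: borel_closed closed_Times)
    have mB: "{x. clock \<omega> x \<in> ?B} \<in> sets borel"
      using measurable_sets[OF clock_section[OF \<omega>] B] by (simp add: vimage_def)
    have U: "(\<Union>q\<in>\<rat>. {x. (\<omega>, x) \<in> D q}) \<in> null_sets (N \<omega>)"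
      using q section_sets[OF Dm] sets_N[OF \<omega>] by (intro null_sets_UN' countable_rat) auto
    \<comment> \<open>If the clock has not advanced between t1 and the first coordinate of x, it has
      not advanced since any rational q in between either; likewise for t2.\<close>
    have sub: "x \<in> (\<Union>q\<in>\<rat>. {x. (\<omega>, x) \<in> D q})" if "x \<in> quadrant" "clock \<omega> x \<in> ?B" "x \<notin> ?R" for x
    proof -
      have "t1 < fst x \<or> t2 < snd x" using that(1,3) by (cases x) (auto simp: quadrant_def)
      then show ?thesis
      proof
        assume "t1 < fst x"
        then obtain q where q: "q \<in> \<rat>" "t1 < q" "q < fst x" using Rats_dense_in_real by blast
        have "y1 t1 \<omega> \<le> y1 q \<omega>" "y1 q \<omega> \<le> y1 (fst x) \<omega>" using y_mono(1)[OF \<omega>] q by auto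
        moreover have "y1 (fst x) \<omega> \<le> y1 t1 \<omega>" using that(2) by (auto simp: clock_def)
        ultimately have "(\<omega>, x) \<in> D q" using q \<omega> by (auto simp: D_def clock_def space_pair_measure space_G)
        then show ?thesis using q(1) by blast
      next
        assume "t2 < snd x"
        then obtain q where q: "q \<in> \<rat>" "t2 < q" "q < snd x" using Rats_dense_in_real by blast
        have "y2 t2 \<omega> \<le> y2 q \<omega>" "y2 q \<omega> \<le> y2 (snd x) \<omega>" using y_mono(2)[OF \<omega>] q by auto
        moreover have "y2 (snd x) \<omega> \<le> y2 t2 \<omega>" using that(2) by (auto simp: clock_def)
        ultimately have "(\<omega>, x) \<in> D q" using q \<omega> by (auto simp: D_def clock_def space_pair_measure space_G)
        then show ?thesis using q(1) by blast
      qed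
    qed
    have sup: "clock \<omega> x \<in> ?B" if "x \<in> ?R" for x
      using that y_mono[OF \<omega>] clock_quadrant[OF \<omega>, of x] by (cases x) (auto simp: clock_def quadrant_def)
    have "AE x in N \<omega>. x \<in> quadrant"
      using N_off_quadrant[OF \<omega>] sets_N[OF \<omega>] by (intro AE_I[of _ _ "- quadrant"]) auto
    moreover have "AE x in N \<omega>. x \<notin> (\<Union>q\<in>\<rat>. {x. (\<omega>, x) \<in> D q})" using U by (rule AE_not_in)
    ultimately have "AE x in N \<omega>. x \<in> ?R \<longleftrightarrow> x \<in> {x. clock \<omega> x \<in> ?B}"
    proof eventually_elim
      case (elim x)
      then show ?case
        using sub[OF elim(1)] sup[of x] unfolding mem_Collect_eq[of x "\<lambda>x. clock \<omega> x \<in> ?B"] by metis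
    qed
    then have "emeasure (N \<omega>) ?R = emeasure (N \<omega>) {x. clock \<omega> x \<in> ?B}"
      using R mB sets_N[OF \<omega>] by (intro emeasure_eq_AE) auto
    then show "emeasure (N \<omega>) ?R = emeasure (unclocked \<omega>) ?B"
      by (simp only: emeasure_unclocked[OF \<omega> B])
  qed
qed

end

section \<open>Poisson random fields independent of the clock\<close>

text \<open>A Dynkin argument inside each set \<open>W n\<close> of finite mass, where complements
  may be subtracted, followed by n to \<infinity>. As \<open>W n\<close> need not lie in
  \<open>E\<close>, the intersections are part of the assumption \<open>gen\<close>.\<close>

lemma kernel_measurable_generator:
  fixes \<kappa> :: "'a \<Rightarrow> 'b measure"
  assumes E: "Int_stable E" "E \<subseteq> Pow \<Omega>"
    and sets: "\<And>a. a \<in> space A \<Longrightarrow> sets (\<kappa> a) = sigma_sets \<Omega> E"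
    and W: "\<And>n::nat. W n \<in> sigma_sets \<Omega> E" "incseq W" "(\<Union>n. W n) = \<Omega>"
      "\<And>a n. a \<in> space A \<Longrightarrow> emeasure (\<kappa> a) (W n) < \<infinity>" "\<And>n. (\<lambda>a. emeasure (\<kappa> a) (W n)) \<in> borel_measurable A"
    and gen: "\<And>X n. X \<in> E \<Longrightarrow> (\<lambda>a. emeasure (\<kappa> a) (X \<inter> W n)) \<in> borel_measurable A"
    and X: "X \<in> sigma_sets \<Omega> E"
  shows "(\<lambda>a. emeasure (\<kappa> a) X) \<in> borel_measurable A"
proof (rule borel_measurable_LIMSEQ_order)
  interpret sigma_algebra \<Omega> "sigma_sets \<Omega> E" by (rule sigma_algebra_sigma_sets[OF E(2)])
  have X\<Omega>: "X \<subseteq> \<Omega>" using X sets_into_space by blast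
  fix a assume a: "a \<in> space A"
  have "(\<lambda>n. emeasure (\<kappa> a) (X \<inter> W n)) \<longlonglongrightarrow> emeasure (\<kappa> a) (\<Union>n. X \<inter> W n)"
  proof (rule Lim_emeasure_incseq)
    show "range (\<lambda>n. X \<inter> W n) \<subseteq> sets (\<kappa> a)"
      unfolding sets[OF a] by (intro image_subsetI Int X W)
    show "incseq (\<lambda>n. X \<inter> W n)"
      using incseq_SucD[OF W(2)] by (intro incseq_SucI Int_mono order_refl)
  qed
  also have "(\<Union>n. X \<inter> W n) = X" using X\<Omega> by (simp only: Int_UN_distrib[symmetric] W(3) Int_absorb2)
  finally show "(\<lambda>n. emeasure (\<kappa> a) (X \<inter> W n)) \<longlonglongrightarrow> emeasure (\<kappa> a) X" .
next
  interpret sigma_algebra \<Omega> "sigma_sets \<Omega> E" by (rule sigma_algebra_sigma_sets[OF E(2)])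
  fix n
  show "(\<lambda>a. emeasure (\<kappa> a) (X \<inter> W n)) \<in> borel_measurable A"
  proof (rule sigma_sets_induct_disjoint[OF E X, where P="\<lambda>X. (\<lambda>a. emeasure (\<kappa> a) (X \<inter> W n)) \<in> borel_measurable A"])
    fix X assume "X \<in> E"
    then show "(\<lambda>a. emeasure (\<kappa> a) (X \<inter> W n)) \<in> borel_measurable A" by (rule gen)
  next
    show "(\<lambda>a. emeasure (\<kappa> a) ({} \<inter> W n)) \<in> borel_measurable A" by simp
  next
    fix X assume X: "X \<in> sigma_sets \<Omega> E" and m: "(\<lambda>a. emeasure (\<kappa> a) (X \<inter> W n)) \<in> borel_measurable A"
    have eq: "emeasure (\<kappa> a) ((\<Omega> - X) \<inter> W n) = emeasure (\<kappa> a) (W n) - emeasure (\<kappa> a) (X \<inter> W n)" if a: "a \<in> space A" for a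
    proof -
      have "(\<Omega> - X) \<inter> W n = W n - X \<inter> W n" using sets_into_space[OF W(1)[of n]] by blast
      moreover have "emeasure (\<kappa> a) (X \<inter> W n) \<le> emeasure (\<kappa> a) (W n)"
        by (rule emeasure_mono) (simp_all add: sets[OF a] W)
      then have "emeasure (\<kappa> a) (X \<inter> W n) \<noteq> \<infinity>" using W(4)[OF a, of n] by (metis leD infinity_ennreal_def top.not_eq_extremum)
      ultimately show ?thesis
        using X W(1)[of n] by (simp only:) (rule emeasure_Diff, simp_all add: sets[OF a] Int)
    qed
    show "(\<lambda>a. emeasure (\<kappa> a) ((\<Omega> - X) \<inter> W n)) \<in> borel_measurable A"
      by (subst measurable_cong[OF eq], assumption, intro borel_measurable_minus_ennreal W(5) m)
  next
    fix S :: "nat \<Rightarrow> 'b set" assume S: "disjoint_family S" "range S \<subseteq> sigma_sets \<Omega> E"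
      and m: "\<And>i. (\<lambda>a. emeasure (\<kappa> a) (S i \<inter> W n)) \<in> borel_measurable A"
    have eq: "emeasure (\<kappa> a) (\<Union>(range S) \<inter> W n) = (\<Sum>i. emeasure (\<kappa> a) (S i \<inter> W n))" if a: "a \<in> space A" for a
    proof -
      have "\<Union>(range S) \<inter> W n = (\<Union>i. S i \<inter> W n)" by blast
      moreover have "(\<Sum>i. emeasure (\<kappa> a) (S i \<inter> W n)) = emeasure (\<kappa> a) (\<Union>i. S i \<inter> W n)"
        using S W(1)[of n] by (intro suminf_emeasure) (auto simp: sets[OF a] disjoint_family_on_def)
      ultimately show ?thesis by simp
    qed
    show "(\<lambda>a. emeasure (\<kappa> a) (\<Union>(range S) \<inter> W n)) \<in> borel_measurable A"
      by (subst measurable_cong[OF eq], assumption, intro borel_measurable_suminf_order m)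
  qed
qed

text \<open>Testing the conditional probability on \<open>S\<close> and on its complement shows that
  \<open>A\<close> differs from \<open>S\<close> by a null set. It serves to identify the event of
  an infinite count with an event of \<open>G\<close>.\<close>

lemma (in prob_space) conditional_prob_indicator:
  assumes G: "subalgebra M G" and A: "A \<in> sets M" and S: "S \<in> sets G"
    and eq: "AE \<omega> in M. conditional_prob M G A \<omega> = indicator S \<omega>"
  shows "AE \<omega> in M. \<omega> \<in> A \<longleftrightarrow> \<omega> \<in> S"
proof -
  have SM: "S \<in> sets M" and sp: "space G = space M" using G S by (auto simp: subalgebra_def)
  have *: "emeasure M (H \<inter> A) = emeasure M (H \<inter> S)" if H: "H \<in> sets G" for H
  proof -
    have HM: "H \<in> sets M" using G H by (auto simp: subalgebra_def)
    have "emeasure M (H \<inter> A) = (\<integral>\<^sup>+\<omega>. indicator (H \<inter> A) \<omega> \<partial>M)" using HM A by simp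
    also have "\<dots> = (\<integral>\<^sup>+\<omega>. indicator H \<omega> * indicator A \<omega> \<partial>M)"
      by (intro nn_integral_cong) (auto split: split_indicator)
    also have "\<dots> = (\<integral>\<^sup>+\<omega>. indicator H \<omega> * ennreal (conditional_prob M G A \<omega>) \<partial>M)"
      by (rule nn_integral_conditional_prob[symmetric, OF G A borel_measurable_indicator[OF H]])
    also have "\<dots> = (\<integral>\<^sup>+\<omega>. indicator (H \<inter> S) \<omega> \<partial>M)"
      using eq by (intro nn_integral_cong_AE) (auto split: split_indicator)
    also have "\<dots> = emeasure M (H \<inter> S)" using HM SM by simp
    finally show ?thesis .
  qed
  have "emeasure M ((space M - S) \<inter> A) = emeasure M ((space M - S) \<inter> S)"
    using S sp by (intro *) (metis sets.compl_sets)
  also have "(space M - S) \<inter> S = {}" by blast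
  finally have 1: "(space M - S) \<inter> A \<in> null_sets M" using A SM by (auto simp: null_sets_def)
  have "emeasure M (S \<inter> A) = emeasure M S" using *[OF S] by simp
  then have "emeasure M (S - A) = 0"
    using emeasure_Diff[of M "S \<inter> A" S] A SM by (simp add: Diff_Int)
  then have 2: "S - A \<in> null_sets M" using A SM by (auto simp: null_sets_def)
  show ?thesis
    using AE_not_in[OF 1] AE_not_in[OF 2] AE_space by eventually_elim auto
qed

lemma (in prob_space) conditional_prob_cong:
  assumes G: "subalgebra M G" and A: "A \<in> sets M" "A' \<in> sets M" and eq: "AE \<omega> in M. \<omega> \<in> A \<longleftrightarrow> \<omega> \<in> A'"
  shows "AE \<omega> in M. conditional_prob M G A \<omega> = conditional_prob M G A' \<omega>"
proof -
  interpret sigma_finite_subalgebra M G by (rule sigma_finite_subalgebraI[OF G])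
  have "AE \<omega> in M. indicat_real A \<omega> = indicat_real A' \<omega>"
    using eq by eventually_elim (auto simp: indicator_def)
  then show ?thesis unfolding conditional_prob_def using A by (intro real_cond_exp_cong) auto
qed

locale prf_time_change = time_change M G y1 y2 for M :: "'w measure" and G y1 y2 +
  fixes N :: "'w \<Rightarrow> (real \<times> real) measure" and r :: real
  assumes is_prf: "poisson_random_field M r N"
    and indep: "indep_set (sets (field_algebra M N)) (sets G)"
begin

lemma rcm: "random_counting_measure M N"
  using is_prf by (simp add: poisson_random_field_def)

lemma sets_N: "\<omega> \<in> space M \<Longrightarrow> sets (N \<omega>) = sets borel"
  using rcm by (auto simp: random_counting_measure_def counting_measure_def)

lemma space_N: "\<omega> \<in> space M \<Longrightarrow> space (N \<omega>) = UNIV"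
  using sets_eq_imp_space_eq[OF sets_N] by simp

lemma N_measurable: "B \<in> sets borel \<Longrightarrow> (\<lambda>\<omega>. emeasure (N \<omega>) B) \<in> borel_measurable M"
  using rcm by (auto simp: random_counting_measure_def)

lemma sets_field: "sets (field_algebra M N) =
    sigma_sets (space M) {(\<lambda>\<omega>. emeasure (N \<omega>) B) -` C \<inter> space M | B C. B \<in> sets borel \<and> C \<in> sets borel}"
  unfolding field_algebra_def by (intro sets_measure_of) blast

lemma space_field: "space (field_algebra M N) = space M"
  unfolding field_algebra_def by (intro space_measure_of) blast

lemma subalgebra_field: "subalgebra M (field_algebra M N)"
  unfolding subalgebra_def space_field sets_field
  using N_measurable by (auto intro!: sets.sigma_sets_subset measurable_sets)

lemma N_measurable_field:
  assumes B: "B \<in> sets borel"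
  shows "(\<lambda>\<omega>. emeasure (N \<omega>) B) \<in> borel_measurable (field_algebra M N)"
proof (rule measurableI)
  fix C :: "ennreal set" assume "C \<in> sets borel"
  then show "(\<lambda>\<omega>. emeasure (N \<omega>) B) -` C \<inter> space (field_algebra M N) \<in> sets (field_algebra M N)"
    unfolding sets_field space_field using B by (intro sigma_sets.Basic) blast
qed simp

text \<open>Freezing treats the clock and the field as two independent copies of \<omega>, so the
  count on a random set must be measurable in both arguments jointly.\<close>

lemma section_measurable_field:
  assumes D: "D \<in> sets (G \<Otimes>\<^sub>M borel)"
  shows "(\<lambda>z. emeasure (N (snd z)) {u. (fst z, u) \<in> D}) \<in> borel_measurable (G \<Otimes>\<^sub>M field_algebra M N)"
proof -
  let ?A = "G \<Otimes>\<^sub>M field_algebra M N" and ?\<Omega> = "space G \<times> (UNIV :: (real \<times> real) set)"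
  let ?E = "{a \<times> b |a b. a \<in> sets G \<and> b \<in> sets (borel :: (real \<times> real) measure)}"
  define \<kappa> where "\<kappa> z = distr (N (snd z)) (G \<Otimes>\<^sub>M borel) (Pair (fst z))" for z :: "'w \<times> 'w"
  have gen: "sets (G \<Otimes>\<^sub>M (borel :: (real \<times> real) measure)) = sigma_sets ?\<Omega> ?E" by (simp add: sets_pair_measure)
  have sp: "fst z \<in> space M" "snd z \<in> space M" if "z \<in> space ?A" for z
    using that by (auto simp: space_pair_measure space_G space_field)
  have em: "emeasure (\<kappa> z) X = emeasure (N (snd z)) {u. (fst z, u) \<in> X}" if z: "z \<in> space ?A" and X: "X \<in> sets (G \<Otimes>\<^sub>M borel)" for z X
  proof -
    have "Pair (fst z) \<in> N (snd z) \<rightarrow>\<^sub>M G \<Otimes>\<^sub>M borel"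
      using measurable_Pair1'[of "fst z" G "borel :: (real \<times> real) measure"] measurable_cong_sets[OF sets_N[OF sp(2)[OF z]] refl] sp(1)[OF z] space_G by blast
    from emeasure_distr[OF this X] show ?thesis by (simp add: \<kappa>_def vimage_def space_N[OF sp(2)[OF z]])
  qed
  have EG: "X \<in> sets (G \<Otimes>\<^sub>M borel)" if "X \<in> ?E" for X unfolding gen using that by (rule sigma_sets.Basic)
  have em_rect: "emeasure (\<kappa> z) (a \<times> b) = indicator a (fst z) * emeasure (N (snd z)) b"
    if "z \<in> space ?A" "a \<in> sets G" "b \<in> sets borel" for z a b
    using that by (subst em) (auto split: split_indicator)
  have m_rect: "(\<lambda>z. emeasure (\<kappa> z) (a \<times> b)) \<in> borel_measurable ?A" if ab: "a \<in> sets G" "b \<in> sets borel" for a b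
  proof (subst measurable_cong[OF em_rect[OF _ ab]])
    show "(\<lambda>z. indicator a (fst z) * emeasure (N (snd z)) b) \<in> borel_measurable ?A"
      by (intro borel_measurable_times_ennreal measurable_compose[OF measurable_fst borel_measurable_indicator]
          measurable_compose[OF measurable_snd N_measurable_field] ab)
  qed
  have "(\<lambda>z. emeasure (\<kappa> z) D) \<in> borel_measurable ?A"
  proof (rule kernel_measurable_generator[where E="?E" and \<Omega>="?\<Omega>" and W="\<lambda>n. space G \<times> cball 0 (real n)"])
    show "Int_stable ?E" by (rule Int_stable_pair_measure_generator)
    show "?E \<subseteq> Pow ?\<Omega>" using sets.sets_into_space[of _ G] by blast
    show "sets (\<kappa> z) = sigma_sets ?\<Omega> ?E" for z by (simp only: \<kappa>_def sets_distr gen)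
    show "space G \<times> cball 0 (real n) \<in> sigma_sets ?\<Omega> ?E" for n
      by (rule sigma_sets.Basic) (auto intro!: exI[of _ "space G"] exI[of _ "cball 0 (real n)"])
    show "incseq (\<lambda>n. space G \<times> cball (0 :: real \<times> real) (real n))"
      by (intro incseq_SucI) auto
    show "(\<Union>n. space G \<times> cball (0 :: real \<times> real) (real n)) = ?\<Omega>"
    proof -
      have "\<exists>n. norm x \<le> real n" for x :: "real \<times> real" by (rule real_arch_simple)
      then show ?thesis by auto
    qed
    show "emeasure (\<kappa> z) (space G \<times> cball 0 (real n)) < \<infinity>" if z: "z \<in> space ?A" for z n
    proof -
      have "emeasure (N (snd z)) (cball 0 (real n)) < \<infinity>"
        using rcm sp(2)[OF z] by (auto simp: random_counting_measure_def locally_finite_measure_def)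
      then show ?thesis using em_rect[OF z sets.top, of "cball 0 (real n)"] by (auto split: split_indicator)
    qed
    show "(\<lambda>z. emeasure (\<kappa> z) (space G \<times> cball 0 (real n))) \<in> borel_measurable ?A" for n
      by (intro m_rect) auto
    show "(\<lambda>z. emeasure (\<kappa> z) (X \<inter> space G \<times> cball 0 (real n))) \<in> borel_measurable ?A" if "X \<in> ?E" for X n
    proof -
      obtain a b where ab: "X = a \<times> b" "a \<in> sets G" "b \<in> sets borel" using \<open>X \<in> ?E\<close> by blast
      have "X \<inter> space G \<times> cball 0 (real n) = (a \<inter> space G) \<times> (b \<inter> cball 0 (real n))" unfolding ab(1) by (rule Times_Int_Times)
      then show ?thesis using ab by (simp only:) (intro m_rect, auto)
    qed
    show "D \<in> sigma_sets ?\<Omega> ?E" using D by (simp only: gen)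
  qed
  then show ?thesis by (subst measurable_cong[OF em[OF _ D, symmetric]])
qed

lemma field_law:
  fixes n :: nat
  assumes B: "\<And>i. i < n \<Longrightarrow> B i \<in> sets borel" "\<And>i. i < n \<Longrightarrow> B i \<subseteq> quadrant" and dis: "disjoint_family_on B {..<n}"
    and J: "J \<subseteq> {..<n}" and C: "\<And>i. i \<in> J \<Longrightarrow> C i \<in> sets borel"
  shows "measure M {\<omega>\<in>space M. \<forall>i\<in>J. emeasure (N \<omega>) (B i) \<in> C i} =
    (\<Prod>i\<in>J. measure_pmf.prob (poisson_law (ennreal r * emeasure lborel (B i))) (C i))"
proof (cases "J = {}")
  case True
  then show ?thesis by (simp add: prob_space)
next
  case False
  have fin: "finite J" by (rule finite_subset[OF J finite_lessThan])
  have iv: "indep_vars (\<lambda>_. borel) (\<lambda>i \<omega>. emeasure (N \<omega>) (B i)) {..<n}"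
  proof (rule is_prf[unfolded poisson_random_field_def, THEN conjunct2, THEN conjunct2, THEN spec, THEN spec, THEN mp])
    show "(\<forall>i<n. B i \<in> sets borel \<and> B i \<subseteq> quadrant) \<and> disjoint_family_on B {..<n}" using B dis by simp
  qed
  have "{\<omega>\<in>space M. \<forall>i\<in>J. emeasure (N \<omega>) (B i) \<in> C i} = (\<Inter>i\<in>J. (\<lambda>\<omega>. emeasure (N \<omega>) (B i)) -` C i \<inter> space M)"
    using False by auto
  also have "prob \<dots> = (\<Prod>i\<in>J. prob ((\<lambda>\<omega>. emeasure (N \<omega>) (B i)) -` C i \<inter> space M))"
    using False fin J C by (intro indep_varsD[OF iv]) auto
  also have "\<dots> = (\<Prod>i\<in>J. measure_pmf.prob (poisson_law (ennreal r * emeasure lborel (B i))) (C i))"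
  proof (rule prod.cong[OF refl])
    fix i assume i: "i \<in> J"
    have "(\<lambda>\<omega>. emeasure (N \<omega>) (B i)) -` C i \<inter> space M = {\<omega>\<in>space M. emeasure (N \<omega>) (B i) \<in> C i}" by auto
    then show "prob ((\<lambda>\<omega>. emeasure (N \<omega>) (B i)) -` C i \<inter> space M) = measure_pmf.prob (poisson_law (ennreal r * emeasure lborel (B i))) (C i)"
      using is_prf[unfolded poisson_random_field_def, THEN conjunct2, THEN conjunct1, THEN bspec, THEN mp, THEN bspec, of "B i" "C i"]
        B[of i] C[OF i] i J by (simp add: subset_iff)
  qed
  finally show ?thesis .
qed

text \<open>By independence the diagonal map has the product of the two restricted laws as its
  distribution, and Tonelli integrates over the field with the clock held fixed.\<close>

lemma freezing:
  assumes f: "f \<in> borel_measurable (G \<Otimes>\<^sub>M field_algebra M N)"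
  shows "(\<integral>\<^sup>+\<omega>. f (\<omega>, \<omega>) \<partial>M) = (\<integral>\<^sup>+\<omega>. (\<integral>\<^sup>+\<omega>'. f (\<omega>, \<omega>') \<partial>M) \<partial>M)"
proof -
  let ?F = "field_algebra M N"
  have idG: "(\<lambda>\<omega>. \<omega>) \<in> M \<rightarrow>\<^sub>M G" and idF: "(\<lambda>\<omega>. \<omega>) \<in> M \<rightarrow>\<^sub>M ?F"
    by (rule measurable_from_subalg[OF subalg], measurable) (rule measurable_from_subalg[OF subalgebra_field], measurable)
  \<comment> \<open>Independence of random variables refers to the sigma-algebras they generate; the
    identity map into \<open>G\<close> generates \<open>G\<close> itself.\<close>
  have G': "sigma_sets (space M) {(\<lambda>\<omega>. \<omega>) -` A \<inter> space M |A. A \<in> sets G} = sets G"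
  proof -
    have "{(\<lambda>\<omega>. \<omega>) -` A \<inter> space M |A. A \<in> sets G} = sets G"
      using sets.sets_into_space[of _ G] by (auto simp: space_G) (metis Int_absorb2)
    then show ?thesis using sets.sigma_sets_eq[of G] by (simp add: space_G)
  qed
  have F': "sigma_sets (space M) {(\<lambda>\<omega>. \<omega>) -` A \<inter> space M |A. A \<in> sets ?F} = sets ?F"
  proof -
    have "{(\<lambda>\<omega>. \<omega>) -` A \<inter> space M |A. A \<in> sets ?F} = sets ?F"
      using sets.sets_into_space[of _ ?F] by (auto simp: space_field) (metis Int_absorb2)
    then show ?thesis using sets.sigma_sets_eq[of ?F] by (simp add: space_field)
  qed
  have "indep_set (sets G) (sets ?F)"
    using indep unfolding indep_sets2_eq by (metis Int_commute mult.commute)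
  then have "indep_var G (\<lambda>\<omega>. \<omega>) ?F (\<lambda>\<omega>. \<omega>)"
    unfolding indep_var_eq G' F' using idG idF by simp
  then have d: "distr M G (\<lambda>\<omega>. \<omega>) \<Otimes>\<^sub>M distr M ?F (\<lambda>\<omega>. \<omega>) = distr M (G \<Otimes>\<^sub>M ?F) (\<lambda>\<omega>. (\<omega>, \<omega>))"
    by (simp add: indep_var_distribution_eq)
  interpret F: prob_space "distr M ?F (\<lambda>\<omega>. \<omega>)" by (rule prob_space_distr[OF idF])
  have f': "f \<in> borel_measurable (distr M G (\<lambda>\<omega>. \<omega>) \<Otimes>\<^sub>M distr M ?F (\<lambda>\<omega>. \<omega>))"
    unfolding d using f by simp
  have f'': "f \<in> borel_measurable (distr M G (\<lambda>\<omega>. \<omega>) \<Otimes>\<^sub>M ?F)"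
    using f by (simp cong: measurable_cong_sets sets_pair_measure_cong)
  have "(\<integral>\<^sup>+\<omega>. f (\<omega>, \<omega>) \<partial>M) = (\<integral>\<^sup>+z. f z \<partial>distr M (G \<Otimes>\<^sub>M ?F) (\<lambda>\<omega>. (\<omega>, \<omega>)))"
    by (rule nn_integral_distr[symmetric, OF measurable_Pair[OF idG idF]]) (simp add: f)
  also have "\<dots> = (\<integral>\<^sup>+\<omega>. (\<integral>\<^sup>+\<omega>'. f (\<omega>, \<omega>') \<partial>distr M ?F (\<lambda>\<omega>. \<omega>)) \<partial>distr M G (\<lambda>\<omega>. \<omega>))"
    unfolding d[symmetric] by (rule F.nn_integral_fst[symmetric, OF f'])
  also have "\<dots> = (\<integral>\<^sup>+\<omega>. (\<integral>\<^sup>+\<omega>'. f (\<omega>, \<omega>') \<partial>distr M ?F (\<lambda>\<omega>. \<omega>)) \<partial>M)"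
    using F.borel_measurable_nn_integral_fst[OF f'] by (intro nn_integral_distr[OF idG]) simp
  also have "\<dots> = (\<integral>\<^sup>+\<omega>. (\<integral>\<^sup>+\<omega>'. f (\<omega>, \<omega>') \<partial>M) \<partial>M)"
  proof (rule nn_integral_cong)
    fix \<omega> assume "\<omega> \<in> space M"
    then have "(\<lambda>\<omega>'. f (\<omega>, \<omega>')) \<in> borel_measurable ?F"
      using measurable_compose[OF measurable_Pair1'[of \<omega> G ?F] f] by (simp add: space_G)
    then show "(\<integral>\<^sup>+\<omega>'. f (\<omega>, \<omega>') \<partial>distr M ?F (\<lambda>\<omega>. \<omega>)) = (\<integral>\<^sup>+\<omega>'. f (\<omega>, \<omega>') \<partial>M)"
      by (intro nn_integral_distr[OF idF]) simp
  qed
  finally show ?thesis .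
qed

text \<open>The value \<open>\<infinity>\<close> on \<open>S i\<close> accounts for increments after the mass has become infinite, where the
  subtraction in \<^typ>\<open>ennreal\<close> yields \<open>\<infinity>\<close>.\<close>

lemma conditional_law:
  fixes n :: nat and D :: "nat \<Rightarrow> ('w \<times> real \<times> real) set" and S :: "nat \<Rightarrow> 'w set"
  defines "Z \<equiv> \<lambda>i \<omega> \<omega>'. if \<omega> \<in> S i then \<infinity> else emeasure (N \<omega>') {u. (\<omega>, u) \<in> D i}"
    and "\<rho> \<equiv> \<lambda>i \<omega>. if \<omega> \<in> S i then \<infinity> else ennreal r * emeasure lborel {u. (\<omega>, u) \<in> D i}"
  assumes D: "\<And>i. i < n \<Longrightarrow> D i \<in> sets (G \<Otimes>\<^sub>M borel)" "\<And>i \<omega>. i < n \<Longrightarrow> \<omega> \<in> space M \<Longrightarrow> {u. (\<omega>, u) \<in> D i} \<subseteq> quadrant"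
    and dis: "\<And>\<omega>. \<omega> \<in> space M \<Longrightarrow> disjoint_family_on (\<lambda>i. {u. (\<omega>, u) \<in> D i}) {..<n}"
    and S: "\<And>i. i < n \<Longrightarrow> S i \<in> sets G"
    and J: "J \<subseteq> {..<n}" and C: "\<And>i. i \<in> J \<Longrightarrow> C i \<in> sets borel"
  shows "AE \<omega> in M. conditional_prob M G {\<omega>\<in>space M. \<forall>i\<in>J. Z i \<omega> \<omega> \<in> C i} \<omega> =
      (\<Prod>i\<in>J. measure_pmf.prob (poisson_law (\<rho> i \<omega>)) (C i))"
    and "i < n \<Longrightarrow> (\<lambda>\<omega>. Z i \<omega> \<omega>) \<in> borel_measurable M"
proof -
  let ?F = "field_algebra M N"
  have fin: "finite J" by (rule finite_subset[OF J finite_lessThan])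
  have Zm: "(\<lambda>z. Z i (fst z) (snd z)) \<in> borel_measurable (G \<Otimes>\<^sub>M ?F)" if i: "i < n" for i
  proof -
    have "{z \<in> space (G \<Otimes>\<^sub>M ?F). fst z \<in> S i} \<in> sets (G \<Otimes>\<^sub>M ?F)"
    proof (rule measurable_sets_Collect[OF measurable_fst])
      have "{x \<in> space G. x \<in> S i} = S i" using sets.sets_into_space[OF S[OF i]] by auto
      then show "{x \<in> space G. x \<in> S i} \<in> sets G" using S[OF i] by simp
    qed
    then show ?thesis unfolding Z_def
      using section_measurable_field[OF D(1)[OF i]] by (intro measurable_If) auto
  qed
  have dm: "(\<lambda>\<omega>. (\<omega>, \<omega>)) \<in> M \<rightarrow>\<^sub>M G \<Otimes>\<^sub>M ?F"
  proof (rule measurable_Pair)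
    show "(\<lambda>\<omega>. \<omega>) \<in> M \<rightarrow>\<^sub>M G" by (rule measurable_from_subalg[OF subalg]) measurable
    show "(\<lambda>\<omega>. \<omega>) \<in> M \<rightarrow>\<^sub>M ?F" by (rule measurable_from_subalg[OF subalgebra_field]) measurable
  qed
  have Zd: "(\<lambda>\<omega>. Z i \<omega> \<omega>) \<in> borel_measurable M" if i: "i < n" for i
    using measurable_compose[OF dm Zm[OF i]] by simp
  then show "i < n \<Longrightarrow> (\<lambda>\<omega>. Z i \<omega> \<omega>) \<in> borel_measurable M" .
  have \<rho>m: "\<rho> i \<in> borel_measurable G" if i: "i < n" for i
  proof -
    have "D i \<in> sets (G \<Otimes>\<^sub>M lborel)"
      using D(1)[OF i] sets_pair_measure_cong[OF refl sets_lborel] by blast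
    from lborel.measurable_emeasure_Pair[OF this]
    have [measurable]: "(\<lambda>\<omega>. emeasure lborel {u. (\<omega>, u) \<in> D i}) \<in> borel_measurable G" by (simp add: vimage_def)
    have [measurable]: "S i \<in> sets G" by (rule S[OF i])
    show ?thesis unfolding \<rho>_def by measurable
  qed
  let ?A = "{\<omega>\<in>space M. \<forall>i\<in>J. Z i \<omega> \<omega> \<in> C i}"
  have A: "?A \<in> sets M"
    by (rule nn_integral_prod_indicator(2)[OF fin, of "space M"]) (use Zd J C in auto)
  show "AE \<omega> in M. conditional_prob M G ?A \<omega> = (\<Prod>i\<in>J. measure_pmf.prob (poisson_law (\<rho> i \<omega>)) (C i))"
  proof (rule conditional_prob_eqI[OF subalg A])
    show "(\<lambda>\<omega>. \<Prod>i\<in>J. measure_pmf.prob (poisson_law (\<rho> i \<omega>)) (C i)) \<in> borel_measurable G"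
      using J by (intro borel_measurable_prod measurable_compose[OF \<rho>m borel_measurable_poisson_law]) auto
    show "0 \<le> (\<Prod>i\<in>J. measure_pmf.prob (poisson_law (\<rho> i \<omega>)) (C i))" for \<omega> by (intro prod_nonneg) simp
    show "(\<Prod>i\<in>J. measure_pmf.prob (poisson_law (\<rho> i \<omega>)) (C i)) \<le> 1" for \<omega>
      by (intro prod_le_1) simp
    fix H assume H: "H \<in> sets G"
    define f where "f z = indicator H (fst z) * (\<Prod>i\<in>J. indicator (C i) (Z i (fst z) (snd z)) :: ennreal)" for z
    have f: "f \<in> borel_measurable (G \<Otimes>\<^sub>M ?F)"
      unfolding f_def using J
      by (intro borel_measurable_times_ennreal borel_measurable_prod_ennreal
          measurable_compose[OF Zm borel_measurable_indicator[OF C]] measurable_compose[OF measurable_fst borel_measurable_indicator[OF H]]) auto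
    have "(\<integral>\<^sup>+\<omega>. indicator H \<omega> * indicator ?A \<omega> \<partial>M) = (\<integral>\<^sup>+\<omega>. f (\<omega>, \<omega>) \<partial>M)"
      by (intro nn_integral_cong) (auto simp: f_def prod_indicator_eq[OF fin] split: split_indicator)
    also have "\<dots> = (\<integral>\<^sup>+\<omega>. (\<integral>\<^sup>+\<omega>'. f (\<omega>, \<omega>') \<partial>M) \<partial>M)" by (rule freezing[OF f])
    also have "\<dots> = (\<integral>\<^sup>+\<omega>. indicator H \<omega> * ennreal (\<Prod>i\<in>J. measure_pmf.prob (poisson_law (\<rho> i \<omega>)) (C i)) \<partial>M)"
    proof (rule nn_integral_cong)
      fix \<omega> assume \<omega>: "\<omega> \<in> space M"
      \<comment> \<open>With \<omega> frozen, a forced value \<infinity> makes the condition on that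
        count either void or impossible; it is encoded in the target set so that
        \<open>field_law\<close> applies, and agrees with the point mass at \<infinity> of the
        Poisson law.\<close>
      define C' where "C' i = (if \<omega> \<in> S i then (if \<infinity> \<in> C i then UNIV else {}) else C i)" for i
      let ?B = "\<lambda>i. {u. (\<omega>, u) \<in> D i}"
      have B: "?B i \<in> sets borel" if "i < n" for i by (rule section_sets[OF D(1)[OF that]])
      have C': "C' i \<in> sets borel" if "i \<in> J" for i using C[OF that] by (auto simp: C'_def)
      have eq: "emeasure (N \<omega>') (?B i) \<in> C' i \<longleftrightarrow> Z i \<omega> \<omega>' \<in> C i" for i \<omega>'
        by (auto simp: C'_def Z_def)
      have set: "{\<omega>'\<in>space M. \<forall>i\<in>J. emeasure (N \<omega>') (?B i) \<in> C' i} \<in> sets M"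
        by (rule nn_integral_prod_indicator(2)[OF fin, of "space M"]) (use N_measurable B J C' in auto)
      have "(\<integral>\<^sup>+\<omega>'. f (\<omega>, \<omega>') \<partial>M) = (\<integral>\<^sup>+\<omega>'. indicator H \<omega> * indicator {\<omega>'\<in>space M. \<forall>i\<in>J. emeasure (N \<omega>') (?B i) \<in> C' i} \<omega>' \<partial>M)"
        unfolding eq by (intro nn_integral_cong) (auto simp: f_def prod_indicator_eq[OF fin] split: split_indicator)
      also have "\<dots> = indicator H \<omega> * emeasure M {\<omega>'\<in>space M. \<forall>i\<in>J. emeasure (N \<omega>') (?B i) \<in> C' i}"
        by (rule nn_integral_cmult_indicator[OF set])
      also have "emeasure M {\<omega>'\<in>space M. \<forall>i\<in>J. emeasure (N \<omega>') (?B i) \<in> C' i} =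
          ennreal (\<Prod>i\<in>J. measure_pmf.prob (poisson_law (ennreal r * emeasure lborel (?B i))) (C' i))"
        unfolding emeasure_eq_measure
        by (rule arg_cong[where f=ennreal], rule field_law[where n=n]) (use B D(2) \<omega> dis J C' in auto)
      also have "(\<Prod>i\<in>J. measure_pmf.prob (poisson_law (ennreal r * emeasure lborel (?B i))) (C' i)) =
          (\<Prod>i\<in>J. measure_pmf.prob (poisson_law (\<rho> i \<omega>)) (C i))"
        by (intro prod.cong refl) (auto simp: C'_def \<rho>_def poisson_law_def)
      finally show "(\<integral>\<^sup>+\<omega>'. f (\<omega>, \<omega>') \<partial>M) = indicator H \<omega> * ennreal (\<Prod>i\<in>J. measure_pmf.prob (poisson_law (\<rho> i \<omega>)) (C i))" .
    qed
    finally show "(\<integral>\<^sup>+\<omega>. indicator H \<omega> * indicator ?A \<omega> \<partial>M) =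
      (\<integral>\<^sup>+\<omega>. indicator H \<omega> * ennreal (\<Prod>i\<in>J. measure_pmf.prob (poisson_law (\<rho> i \<omega>)) (C i)) \<partial>M)" .
  qed
qed

end

lemma prob_poisson_law_of_nat:
  assumes "0 \<le> m"
  shows "measure_pmf.prob (poisson_law (ennreal m)) {of_nat k} = m ^ k / fact k * exp (- m)"
proof -
  have "emeasure (measure_pmf (poisson_law (ennreal m))) {of_nat k} =
    (\<Sum>j. ennreal (m ^ j / fact j * exp (- m)) * indicator {of_nat k :: ennreal} (of_nat j))"
    using nn_integral_poisson_law_ennreal[OF assms, of "indicator {of_nat k}"] by simp
  also have "(\<lambda>j. ennreal (m ^ j / fact j * exp (- m)) * indicator {of_nat k :: ennreal} (of_nat j)) sums
      (\<Sum>j\<in>{k}. ennreal (m ^ j / fact j * exp (- m)) * indicator {of_nat k :: ennreal} (of_nat j))"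
    by (rule sums_finite) (auto simp: indicator_def)
  then have "(\<Sum>j. ennreal (m ^ j / fact j * exp (- m)) * indicator {of_nat k :: ennreal} (of_nat j)) = ennreal (m ^ k / fact k * exp (- m))"
    by (simp add: sums_iff)
  finally show ?thesis using assms by (simp add: measure_def)
qed

section \<open>Increments along increasing sets and cell counts\<close>

lemma increasing_set_mono: "increasing_set \<Gamma> \<Longrightarrow> 0 \<le> s \<Longrightarrow> s \<le> t \<Longrightarrow> \<Gamma> s \<subseteq> \<Gamma> t"
  unfolding increasing_set_def by blast

lemma increasing_set_lower: "increasing_set \<Gamma> \<Longrightarrow> 0 \<le> t \<Longrightarrow> \<Gamma> t \<in> lower_set_family"
  unfolding increasing_set_def by (drule conjunct1) simp

lemma increasing_set_0: "increasing_set \<Gamma> \<Longrightarrow> \<Gamma> 0 = {(0, 0)}"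
  unfolding increasing_set_def by (elim conjE)

lemma increasing_set_closed: "increasing_set \<Gamma> \<Longrightarrow> 0 \<le> t \<Longrightarrow> \<Gamma> t \<in> sets borel"
  using increasing_set_lower[of \<Gamma> t] by (simp add: lower_set_family_def borel_closed)

lemma (in time_change) clock_measure_origin:
  assumes \<omega>: "\<omega> \<in> space M"
  shows "emeasure (clock_measure \<omega>) {(0, 0)} = 0"
proof -
  have "{u \<in> quadrant. inv_clock \<omega> u \<in> {(0, 0)}} \<subseteq> {(0, 0)}"
  proof
    fix u assume u: "u \<in> {u \<in> quadrant. inv_clock \<omega> u \<in> {(0, 0)}}"
    then have "clock \<omega> (0, 0) = u" using clock_inv_clock[OF \<omega>, of u] by auto
    moreover have "clock \<omega> (0, 0) = (0, 0)" using y_good[OF \<omega>] by (auto simp: clock_def good_path_def)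
    ultimately show "u \<in> {(0, 0)}" by simp
  qed
  then have "emeasure lborel {u \<in> quadrant. inv_clock \<omega> u \<in> {(0, 0)}} \<le> emeasure lborel {(0 :: real, 0 :: real)}"
    by (intro emeasure_mono) auto
  also have "\<dots> = 0" by (rule emeasure_lborel_singleton)
  finally show ?thesis by (subst emeasure_clock_measure[OF \<omega>]) auto
qed

text \<open>Along the increasing set of a grid the increment over (i, i + 1] counts exactly cell i,
  so the law of the increments is the law of the cells.\<close>

lemma (in time_change) grid_poissonI:
  assumes N: "random_counting_measure M N" and r: "0 < r"
    and origin: "AE \<omega> in M. emeasure (N \<omega>) {(0, 0)} = 0"
    and law: "\<And>\<Gamma> n C. increasing_set \<Gamma> \<Longrightarrow> (\<And>i. i < n \<Longrightarrow> C i \<in> sets borel) \<Longrightarrow>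
      AE \<omega> in M. conditional_prob M G {x\<in>space M. \<forall>i<n::nat. emeasure (N x) (\<Gamma> (real i + 1)) - emeasure (N x) (\<Gamma> (real i)) \<in> C i} \<omega> =
        (\<Prod>i<n. measure_pmf.prob (poisson_law (ennreal r * emeasure (clock_measure \<omega>) (\<Gamma> (real i + 1)) -
           ennreal r * emeasure (clock_measure \<omega>) (\<Gamma> (real i)))) (C i))"
  shows "grid_poisson M G y1 y2 N r"
proof (intro grid_poisson.intro time_change_axioms grid_poisson_axioms.intro N r)
  fix d p :: nat and u :: "'w \<Rightarrow> ennreal" and k :: "nat \<Rightarrow> nat"
  assume u: "u \<in> borel_measurable G"
  define n where "n = (p + 1) * (p + 1)"
  have Nsets: "sets (N \<omega>) = sets borel" if "\<omega> \<in> space M" for \<omega>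
    using N that by (auto simp: random_counting_measure_def counting_measure_def)
  obtain \<Gamma> where \<Gamma>: "increasing_set \<Gamma>" and \<Gamma>_eq: "\<And>k. k \<le> n \<Longrightarrow>
       \<Gamma> (real k) = {x \<in> quadrant. x = (0, 0) \<or> (nat \<lceil>2 ^ d * fst x\<rceil> \<le> p \<and> (p + 1) * nat \<lceil>2 ^ d * snd x\<rceil> + nat \<lceil>2 ^ d * fst x\<rceil> < k)}"
    unfolding n_def by (rule grid_increasing_set) blast
  \<comment> \<open>The origin belongs to every set of the family from time 0 on, so it is missing
    from the increment that should give its cell; it is null for both measures.\<close>
  have diff: "\<Gamma> (real i + 1) - \<Gamma> (real i) = grid_cell d p i - {(0, 0)}" if i: "i < n" for i
  proof -
    have "\<Gamma> (real i + 1) = \<Gamma> (real (Suc i))" by (simp add: add.commute)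
    then show ?thesis
      using \<Gamma>_eq[of i] \<Gamma>_eq[of "Suc i"] i by (auto simp: grid_cell_def dyadic_index_def less_Suc_eq)
  qed
  have bnd: "bounded (\<Gamma> (real i))" if i: "i \<le> n" for i
  proof -
    have "\<Gamma> (real i) \<subseteq> (\<Union>c\<in>{..<n}. grid_cell d p c) \<union> {(0, 0)}"
      unfolding \<Gamma>_eq[OF i] using i by (auto simp: grid_cell_def dyadic_index_def)
    moreover have "bounded ((\<Union>c\<in>{..<n}. grid_cell d p c) \<union> {(0, 0)})"
      unfolding bounded_Un using bounded_grid_cell by (auto simp: n_def intro!: bounded_UN)
    ultimately show ?thesis by (rule bounded_subset[rotated])
  qed
  \<comment> \<open>Stated for any measure, as it is needed for the counts and for the clock
    measure.\<close>
  have incr: "emeasure \<nu> (\<Gamma> (real i + 1)) - emeasure \<nu> (\<Gamma> (real i)) = emeasure \<nu> (grid_cell d p i)"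
    if i: "i < n" and \<nu>: "sets \<nu> = sets borel" "emeasure \<nu> {(0, 0)} = 0" "emeasure \<nu> (\<Gamma> (real i)) < \<infinity>" for i and \<nu> :: "(real \<times> real) measure"
  proof -
    have "emeasure \<nu> (\<Gamma> (real i + 1)) - emeasure \<nu> (\<Gamma> (real i)) = emeasure \<nu> (\<Gamma> (real i + 1) - \<Gamma> (real i))"
    proof (rule emeasure_Diff[symmetric])
      show "\<Gamma> (real i) \<subseteq> \<Gamma> (real i + 1)" by (rule increasing_set_mono[OF \<Gamma>]) auto
    qed (use \<nu> in \<open>auto simp: increasing_set_closed[OF \<Gamma>]\<close>)
    also have "\<dots> = emeasure \<nu> (grid_cell d p i - {(0, 0)})" by (simp only: diff[OF i])
    also have "\<dots> = emeasure \<nu> (grid_cell d p i)"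
      using \<nu> by (intro emeasure_Diff_null_set) (auto simp: null_sets_def)
    finally show ?thesis .
  qed
  have fin: "emeasure (N \<omega>) B < \<infinity>" if "\<omega> \<in> space M" "B \<in> sets borel" "bounded B" for \<omega> B
    using N that by (auto simp: random_counting_measure_def locally_finite_measure_def)
  have range: "emeasure (N \<omega>) B \<in> range of_nat \<union> {\<infinity>}" if "\<omega> \<in> space M" "B \<in> sets borel" for \<omega> B
    using N that by (auto simp: random_counting_measure_def counting_measure_def)
  have Nm: "(\<lambda>\<omega>. emeasure (N \<omega>) B) \<in> borel_measurable M" if "B \<in> sets borel" for B
    using N that by (auto simp: random_counting_measure_def)
  have bc: "bounded (grid_cell d p i)" if "i < n" for i using bounded_grid_cell that by (simp add: n_def)
  have cnt: "nat \<lfloor>measure (N \<omega>) (grid_cell d p i)\<rfloor> = k i \<longleftrightarrow> emeasure (N \<omega>) (grid_cell d p i) = of_nat (k i)"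
    if \<omega>: "\<omega> \<in> space M" and i: "i < n" for \<omega> i
  proof -
    obtain j where j: "emeasure (N \<omega>) (grid_cell d p i) = of_nat j"
      using range[OF \<omega> grid_cell_sets, of d p i] fin[OF \<omega> grid_cell_sets bc[OF i]] by auto
    then have "measure (N \<omega>) (grid_cell d p i) = real j" by (simp add: measure_def ennreal_of_nat_eq_real_of_nat)
    then show ?thesis using j by simp
  qed
  let ?X = "\<lambda>i x. emeasure (N x) (\<Gamma> (real i + 1)) - emeasure (N x) (\<Gamma> (real i))"
  let ?A = "{x\<in>space M. \<forall>i<n. ?X i x \<in> {of_nat (k i)}}"
  have X: "?X i \<in> borel_measurable M" for i
    by (intro borel_measurable_minus_ennreal Nm increasing_set_closed[OF \<Gamma>]) auto
  have A: "?A \<in> sets M"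
    using nn_integral_prod_indicator(2)[of "{..<n}" "space M" M ?X "\<lambda>i. {of_nat (k i)}"] X
    by (simp only: lessThan_iff Ball_def) simp
  have "(\<integral>\<^sup>+\<omega>. u \<omega> * (\<Prod>c<n. indicator {k c} (nat \<lfloor>measure (N \<omega>) (grid_cell d p c)\<rfloor>)) \<partial>M) = (\<integral>\<^sup>+\<omega>. u \<omega> * indicator ?A \<omega> \<partial>M)"
  proof (rule nn_integral_cong_AE)
    show "AE \<omega> in M. u \<omega> * (\<Prod>c<n. indicator {k c} (nat \<lfloor>measure (N \<omega>) (grid_cell d p c)\<rfloor>)) = u \<omega> * indicator ?A \<omega>"
      using origin AE_space
    proof eventually_elim
      case (elim \<omega>)
      have "?X i \<omega> = emeasure (N \<omega>) (grid_cell d p i)" if "i < n" for i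
        using that elim fin[OF elim(2) increasing_set_closed[OF \<Gamma>] bnd[of i]] by (intro incr Nsets) auto
      then have "\<omega> \<in> ?A \<longleftrightarrow> (\<forall>i\<in>{..<n}. nat \<lfloor>measure (N \<omega>) (grid_cell d p i)\<rfloor> \<in> {k i})"
        using elim(2) cnt[OF elim(2)] by auto
      then have "(\<Prod>c<n. indicator {k c} (nat \<lfloor>measure (N \<omega>) (grid_cell d p c)\<rfloor>) :: ennreal) = indicator ?A \<omega>"
        unfolding prod_indicator_eq[OF finite_lessThan] by (simp only: indicator_def of_bool_def)
      then show ?case by (simp only:)
    qed
  qed
  also have "\<dots> = (\<integral>\<^sup>+\<omega>. u \<omega> * ennreal (conditional_prob M G ?A \<omega>) \<partial>M)"
    by (rule nn_integral_conditional_prob[symmetric, OF subalg A u])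
  also have "\<dots> = (\<integral>\<^sup>+\<omega>. u \<omega> * (\<Prod>c<n. ennreal ((r * measure (clock_measure \<omega>) (grid_cell d p c)) ^ k c / fact (k c) *
            exp (- (r * measure (clock_measure \<omega>) (grid_cell d p c))))) \<partial>M)"
  proof (rule nn_integral_cong_AE)
    have "AE \<omega> in M. conditional_prob M G ?A \<omega> =
        (\<Prod>i<n. measure_pmf.prob (poisson_law (ennreal r * emeasure (clock_measure \<omega>) (\<Gamma> (real i + 1)) -
           ennreal r * emeasure (clock_measure \<omega>) (\<Gamma> (real i)))) {of_nat (k i)})"
      by (rule law[OF \<Gamma>]) simp
    then show "AE \<omega> in M. u \<omega> * ennreal (conditional_prob M G ?A \<omega>) =
        u \<omega> * (\<Prod>c<n. ennreal ((r * measure (clock_measure \<omega>) (grid_cell d p c)) ^ k c / fact (k c) *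
            exp (- (r * measure (clock_measure \<omega>) (grid_cell d p c)))))"
      using AE_space
    proof eventually_elim
      case (elim \<omega>)
      have "measure_pmf.prob (poisson_law (ennreal r * emeasure (clock_measure \<omega>) (\<Gamma> (real i + 1)) -
           ennreal r * emeasure (clock_measure \<omega>) (\<Gamma> (real i)))) {of_nat (k i)} =
        (r * measure (clock_measure \<omega>) (grid_cell d p i)) ^ k i / fact (k i) * exp (- (r * measure (clock_measure \<omega>) (grid_cell d p i)))"
        if i: "i < n" for i
      proof -
        have f: "emeasure (clock_measure \<omega>) (\<Gamma> (real i)) < \<infinity>"
          using bnd[of i] i by (intro clock_measure_bounded[OF elim(2)] increasing_set_closed[OF \<Gamma>]) auto
        have "ennreal r * emeasure (clock_measure \<omega>) (\<Gamma> (real i + 1)) - ennreal r * emeasure (clock_measure \<omega>) (\<Gamma> (real i)) =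
          ennreal r * (emeasure (clock_measure \<omega>) (\<Gamma> (real i + 1)) - emeasure (clock_measure \<omega>) (\<Gamma> (real i)))"
          by (rule ennreal_right_diff_distrib[symmetric]) simp
        also have "\<dots> = ennreal r * emeasure (clock_measure \<omega>) (grid_cell d p i)"
          using incr[OF i sets_clock_measure clock_measure_origin[OF elim(2)] f] by (simp only:)
        also have "\<dots> = ennreal (r * measure (clock_measure \<omega>) (grid_cell d p i))"
          using clock_measure_bounded[OF elim(2) grid_cell_sets bc[OF i]] r
          by (simp add: emeasure_eq_ennreal_measure ennreal_mult)
        finally show ?thesis using r by (simp only:) (rule prob_poisson_law_of_nat, simp)
      qed
      then have "conditional_prob M G ?A \<omega> = (\<Prod>c<n. (r * measure (clock_measure \<omega>) (grid_cell d p c)) ^ k c / fact (k c) *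
            exp (- (r * measure (clock_measure \<omega>) (grid_cell d p c))))"
        unfolding elim(1) by (intro prod.cong) auto
      then show ?case using r by (simp only:) (subst prod_ennreal, auto)
    qed
  qed
  finally show "(\<integral>\<^sup>+\<omega>. u \<omega> * (\<Prod>c<(p + 1) * (p + 1). indicator {k c} (nat \<lfloor>measure (N \<omega>) (grid_cell d p c)\<rfloor>)) \<partial>M) =
    (\<integral>\<^sup>+\<omega>. u \<omega> * (\<Prod>c<(p + 1) * (p + 1). ennreal ((r * measure (clock_measure \<omega>) (grid_cell d p c)) ^ k c / fact (k c) *
            exp (- (r * measure (clock_measure \<omega>) (grid_cell d p c))))) \<partial>M)"
    unfolding n_def .
qed

lemma disjoint_increments:
  assumes \<Gamma>: "increasing_set \<Gamma>" and st: "\<And>i. i \<in> I \<Longrightarrow> 0 \<le> s i \<and> s i < t i"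
    and dis: "disjoint_family_on (\<lambda>i. {s i<..t i}) I"
  shows "disjoint_family_on (\<lambda>i. \<Gamma> (t i) - \<Gamma> (s i)) I"
  unfolding disjoint_family_on_def
proof (intro ballI impI)
  fix i j assume ij: "i \<in> I" "j \<in> I" "i \<noteq> j"
  then have "{s i<..t i} \<inter> {s j<..t j} = {}" using dis by (auto simp: disjoint_family_on_def)
  \<comment> \<open>The smaller right end point would lie in both intervals unless one of them ends
    before the other begins.\<close>
  then have "min (t i) (t j) \<notin> {s i<..t i} \<inter> {s j<..t j}" by blast
  then have "t i \<le> s j \<or> t j \<le> s i" using st[OF ij(1)] st[OF ij(2)] by (auto simp: min_def split: if_splits)
  then show "(\<Gamma> (t i) - \<Gamma> (s i)) \<inter> (\<Gamma> (t j) - \<Gamma> (s j)) = {}"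
  proof
    assume "t i \<le> s j"
    then have "\<Gamma> (t i) \<subseteq> \<Gamma> (s j)" using st[OF ij(1)] by (intro increasing_set_mono[OF \<Gamma>]) auto
    then show ?thesis by blast
  next
    assume "t j \<le> s i"
    then have "\<Gamma> (t j) \<subseteq> \<Gamma> (s i)" using st[OF ij(2)] by (intro increasing_set_mono[OF \<Gamma>]) auto
    then show ?thesis by blast
  qed
qed

section \<open>Increments of a time-changed Poisson field\<close>

context prf_time_change
begin

text \<open>By \<open>path_inv_le_iff\<close> the rectangle below the clock at (t1, t2) is the
  preimage of [0, t1] x [0, t2] under \<open>inv_clock\<close>. Hence the time-changed field and the
  image measure agree on all lower quadrants, and these determine a locally finite measure; the
  exceptional event does not depend on \<open>B\<close>.\<close>

lemma image_measure:
  assumes N': "random_counting_measure M N'"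
    and rect: "AE \<omega> in M. \<forall>t1\<ge>0. \<forall>t2\<ge>0. emeasure (N' \<omega>) ({0..t1} \<times> {0..t2}) = emeasure (N \<omega>) ({0..y1 t1 \<omega>} \<times> {0..y2 t2 \<omega>})"
  shows "AE \<omega> in M. \<forall>B\<in>sets borel. emeasure (N' \<omega>) B = emeasure (N \<omega>) {u\<in>quadrant. inv_clock \<omega> u \<in> B}"
  using rect
proof (rule AE_mp, intro AE_I2 impI)
  fix \<omega> assume \<omega>: "\<omega> \<in> space M"
    and eq: "\<forall>t1\<ge>0. \<forall>t2\<ge>0. emeasure (N' \<omega>) ({0..t1} \<times> {0..t2}) = emeasure (N \<omega>) ({0..y1 t1 \<omega>} \<times> {0..y2 t2 \<omega>})"
  have N's: "sets (N' \<omega>) = sets borel" "emeasure (N' \<omega>) (- quadrant) = 0"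
    "\<And>B. B \<in> sets borel \<Longrightarrow> bounded B \<Longrightarrow> emeasure (N' \<omega>) B < \<infinity>"
    using N' \<omega> by (auto simp: random_counting_measure_def counting_measure_def locally_finite_measure_def)
  have Nq: "emeasure (N \<omega>) (- quadrant) = 0"
    using rcm \<omega> by (auto simp: random_counting_measure_def counting_measure_def)
  have cm: "inv_clock \<omega> \<in> N \<omega> \<rightarrow>\<^sub>M borel"
    using inv_clock_section[OF \<omega>] measurable_cong_sets[OF sets_N[OF \<omega>] refl] by blast
  have D: "emeasure (distr (N \<omega>) borel (inv_clock \<omega>)) B = emeasure (N \<omega>) {u\<in>quadrant. inv_clock \<omega> u \<in> B}"
    if B: "B \<in> sets borel" for B
  proof -
    have m: "inv_clock \<omega> -` B \<in> sets borel" using measurable_sets[OF inv_clock_section[OF \<omega>] B] by simp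
    have "AE u in N \<omega>. u \<in> quadrant"
      using Nq sets_N[OF \<omega>] by (intro AE_I[of _ _ "- quadrant"]) auto
    then have "emeasure (N \<omega>) (inv_clock \<omega> -` B) = emeasure (N \<omega>) (quadrant \<inter> inv_clock \<omega> -` B)"
      using m sets_N[OF \<omega>] by (intro emeasure_eq_AE) auto
    moreover have "quadrant \<inter> inv_clock \<omega> -` B = {u\<in>quadrant. inv_clock \<omega> u \<in> B}" by blast
    ultimately show ?thesis by (simp add: emeasure_distr[OF cm B] space_N[OF \<omega>])
  qed
  have sub0: "emeasure (N' \<omega>) X = 0" if "X \<subseteq> - quadrant" for X
    using emeasure_mono[OF that, of "N' \<omega>"] N's(1,2) borel_comp[OF quadrant_sets] by simp
  have gen: "emeasure (N' \<omega>) {..a} = emeasure (distr (N \<omega>) borel (inv_clock \<omega>)) {..a}" for a :: "real \<times> real"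
  proof (cases "0 \<le> fst a \<and> 0 \<le> snd a")
    case True
    have "AE u in N' \<omega>. u \<in> quadrant"
      using N's by (intro AE_I[of _ _ "- quadrant"]) auto
    then have "emeasure (N' \<omega>) {..a} = emeasure (N' \<omega>) ({0..fst a} \<times> {0..snd a})"
      using N's(1) True by (intro emeasure_eq_AE)
        (auto elim!: eventually_mono simp: quadrant_def less_eq_prod_def intro!: borel_closed closed_Times)
    also have "\<dots> = emeasure (N \<omega>) ({0..y1 (fst a) \<omega>} \<times> {0..y2 (snd a) \<omega>})" using eq True by blast
    also have "{0..y1 (fst a) \<omega>} \<times> {0..y2 (snd a) \<omega>} = {u\<in>quadrant. inv_clock \<omega> u \<in> {..a}}"
      using path_inv_le_iff[OF y_good(1)[OF \<omega>], of "fst a"] path_inv_le_iff[OF y_good(2)[OF \<omega>], of "snd a"] True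
      by (auto simp: quadrant_def inv_clock_def less_eq_prod_def)
    finally show ?thesis by (subst D) auto
  next
    case False
    then have "{..a} \<subseteq> - quadrant" by (auto simp: quadrant_def less_eq_prod_def)
    moreover have "{u\<in>quadrant. inv_clock \<omega> u \<in> {..a}} = {}"
    proof -
      have "\<not> inv_clock \<omega> u \<le> a" for u
        using False inv_clock_quadrant[OF \<omega>, of u] by (auto simp: quadrant_def less_eq_prod_def mem_Times_iff)
      then show ?thesis by auto
    qed
    moreover have "{..a} \<in> sets borel" by auto
    ultimately show ?thesis using sub0[of "{..a}"] by (simp only: D emeasure_empty)
  qed
  have "N' \<omega> = distr (N \<omega>) borel (inv_clock \<omega>)"
  proof (rule measure_eqI_generator_eq[where E="range atMost" and \<Omega>=UNIV and A="\<lambda>n. {..(real n, real n)}"])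
    show "Int_stable (range (atMost :: real \<times> real \<Rightarrow> _))"
    proof (rule Int_stableI)
      fix A B :: "(real \<times> real) set" assume "A \<in> range atMost" "B \<in> range atMost"
      then obtain a b where "A = {..a}" "B = {..b}" by blast
      then have "A \<inter> B = {..inf a b}" by auto
      then show "A \<inter> B \<in> range atMost" by blast
    qed
    show "sets (N' \<omega>) = sigma_sets UNIV (range atMost)"
      "sets (distr (N \<omega>) borel (inv_clock \<omega>)) = sigma_sets UNIV (range atMost)"
      by (simp_all add: N's(1) borel_eq_atMost)
    show "(\<Union>n. {..(real n, real n)}) = UNIV"
    proof -
      have "\<exists>n::nat. x \<le> (real n, real n)" for x :: "real \<times> real"
        using real_arch_simple[of "max (fst x) (snd x)"] by (auto simp: less_eq_prod_def)
      then show ?thesis by auto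
    qed
    show "emeasure (N' \<omega>) {..(real n, real n)} \<noteq> \<infinity>" for n
    proof -
      have "AE u in N' \<omega>. u \<in> quadrant"
        using N's by (intro AE_I[of _ _ "- quadrant"]) auto
      then have "emeasure (N' \<omega>) {..(real n, real n)} = emeasure (N' \<omega>) ({0..real n} \<times> {0..real n})"
        using N's(1) by (intro emeasure_eq_AE)
          (auto elim!: eventually_mono simp: quadrant_def less_eq_prod_def intro!: borel_closed closed_Times)
      moreover have "emeasure (N' \<omega>) ({0..real n} \<times> {0..real n}) < \<infinity>"
        by (intro N's(3) borel_closed closed_Times bounded_Times) auto
      ultimately show ?thesis by (metis less_irrefl infinity_ennreal_def)
    qed
  qed (use gen in auto)
  then show "\<forall>B\<in>sets borel. emeasure (N' \<omega>) B = emeasure (N \<omega>) {u\<in>quadrant. inv_clock \<omega> u \<in> B}"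
    using D by simp
qed

text \<open>As a difference in \<open>ennreal\<close>, an increment is \<infinity> as soon as the
  count at its left end is. Almost surely this happens exactly on an event of \<open>G\<close>, off
  which the increment is the count of the difference set and \<open>conditional_law\<close>
  applies.\<close>

lemma increments_law:
  assumes N': "random_counting_measure M N'" and r: "0 < r"
    and rect: "AE \<omega> in M. \<forall>t1\<ge>0. \<forall>t2\<ge>0. emeasure (N' \<omega>) ({0..t1} \<times> {0..t2}) = emeasure (N \<omega>) ({0..y1 t1 \<omega>} \<times> {0..y2 t2 \<omega>})"
    and \<Gamma>: "increasing_set \<Gamma>" and st: "\<And>i. i < n \<Longrightarrow> 0 \<le> s i \<and> s i < t i"
    and dis: "disjoint_family_on (\<lambda>i. {s i<..t i}) {..<n::nat}"
    and J: "J \<subseteq> {..<n}" and C: "\<And>i. i \<in> J \<Longrightarrow> C i \<in> sets borel"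
  shows "AE \<omega> in M. conditional_prob M G {x\<in>space M. \<forall>i\<in>J. emeasure (N' x) (\<Gamma> (t i)) - emeasure (N' x) (\<Gamma> (s i)) \<in> C i} \<omega> =
      (\<Prod>i\<in>J. measure_pmf.prob (poisson_law (ennreal r * emeasure (clock_measure \<omega>) (\<Gamma> (t i)) - ennreal r * emeasure (clock_measure \<omega>) (\<Gamma> (s i)))) (C i))"
proof -
  have fin: "finite J" by (rule finite_subset[OF J finite_lessThan])
  have N'm: "(\<lambda>\<omega>. emeasure (N' \<omega>) B) \<in> borel_measurable M" if "B \<in> sets borel" for B
    using N' that by (auto simp: random_counting_measure_def)
  have N's: "sets (N' \<omega>) = sets borel" if "\<omega> \<in> space M" for \<omega>
    using N' that by (auto simp: random_counting_measure_def counting_measure_def)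
  have \<Gamma>b: "\<Gamma> (s i) \<in> sets borel" "\<Gamma> (t i) \<in> sets borel" "\<Gamma> (s i) \<subseteq> \<Gamma> (t i)" if "i < n" for i
    using st[OF that] increasing_set_closed[OF \<Gamma>] increasing_set_mono[OF \<Gamma>, of "s i" "t i"] by simp_all
  define pre where "pre B = {z \<in> space (G \<Otimes>\<^sub>M borel). snd z \<in> quadrant \<and> inv_clock (fst z) (snd z) \<in> B}" for B
  have pre: "pre B \<in> sets (G \<Otimes>\<^sub>M borel)" if "B \<in> sets borel" for B
    unfolding pre_def by (rule inv_clock_preimage_sets[OF that])
  have pre_sec: "{u. (\<omega>, u) \<in> pre B} = {u\<in>quadrant. inv_clock \<omega> u \<in> B}" if "\<omega> \<in> space M" for \<omega> B
    using that by (auto simp: pre_def space_pair_measure space_G)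
  define S where "S i = {\<omega>\<in>space G. emeasure (clock_measure \<omega>) (\<Gamma> (s i)) = \<infinity>}" for i
  have S: "S i \<in> sets G" if "i < n" for i
  proof -
    note [measurable] = clock_measure_measurable[OF \<Gamma>b(1)[OF that]]
    show ?thesis unfolding S_def by measurable
  qed
  have image: "AE \<omega> in M. \<forall>B\<in>sets borel. emeasure (N' \<omega>) B = emeasure (N \<omega>) {u\<in>quadrant. inv_clock \<omega> u \<in> B}"
    by (rule image_measure[OF N' rect])
  \<comment> \<open>The count up to time s i is conditionally Poisson, so its conditional
    probability of being infinite is 0 or 1 according to its mean.\<close>
  have infin: "AE \<omega> in M. emeasure (N' \<omega>) (\<Gamma> (s i)) = \<infinity> \<longleftrightarrow> \<omega> \<in> S i" if i: "i < n" for i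
  proof -
    \<comment> \<open>A single set presented as a one-element family on which no value \<infinity>
      is forced.\<close>
    let ?D = "\<lambda>_::nat. pre (\<Gamma> (s i))"
    let ?A = "{\<omega>\<in>space M. \<forall>j\<in>{0::nat}. (if \<omega> \<in> {} then \<infinity> else emeasure (N \<omega>) {u. (\<omega>, u) \<in> ?D j}) \<in> {\<infinity>}}"
    have "AE \<omega> in M. conditional_prob M G ?A \<omega> =
        (\<Prod>j\<in>{0::nat}. measure_pmf.prob (poisson_law (if \<omega> \<in> {} then \<infinity> else ennreal r * emeasure lborel {u. (\<omega>, u) \<in> ?D j})) {\<infinity>})"
    proof (rule conditional_law(1)[where n=1 and S="\<lambda>_. {}"])
      show "?D j \<in> sets (G \<Otimes>\<^sub>M borel)" for j by (rule pre[OF \<Gamma>b(1)[OF i]])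
      show "{u. (\<omega>, u) \<in> ?D j} \<subseteq> quadrant" if "\<omega> \<in> space M" for j \<omega> using pre_sec[OF that] by auto
    qed (auto simp: disjoint_family_on_def)
    then have "AE \<omega> in M. conditional_prob M G ?A \<omega> = indicator (S i) \<omega>"
      using AE_space
    proof eventually_elim
      case (elim \<omega>)
      have "ennreal r * emeasure (clock_measure \<omega>) (\<Gamma> (s i)) = \<infinity> \<longleftrightarrow> emeasure (clock_measure \<omega>) (\<Gamma> (s i)) = \<infinity>"
        using r by (auto simp: ennreal_mult_eq_top_iff)
      \<comment> \<open>A Poisson law charges \<infinity> only if its mean is infinite.\<close>
      moreover have "measure_pmf.prob (poisson_law \<rho>) {\<infinity>} = (if \<rho> = \<infinity> then 1 else 0)" for \<rho>
        by (cases "\<rho> = 0 \<or> \<rho> = \<infinity>") (auto simp: poisson_law_def indicator_def measure_map_pmf vimage_def)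
      moreover have "emeasure lborel {u. (\<omega>, u) \<in> pre (\<Gamma> (s i))} = emeasure (clock_measure \<omega>) (\<Gamma> (s i))"
        using elim(2) by (simp add: pre_sec emeasure_clock_measure \<Gamma>b[OF i])
      ultimately show ?case using elim by (simp add: S_def space_G indicator_def)
    qed
    moreover have "?A \<in> sets M"
    proof -
      have "?A = {\<omega>\<in>space M. emeasure (N \<omega>) {u. (\<omega>, u) \<in> pre (\<Gamma> (s i))} = \<infinity>}" by auto
      moreover have "(\<lambda>\<omega>. emeasure (N \<omega>) {u. (\<omega>, u) \<in> pre (\<Gamma> (s i))}) \<in> borel_measurable M"
        using conditional_law(2)[where n=1 and S="\<lambda>_. {}" and D="?D" and J="{}" and i=0] pre[OF \<Gamma>b(1)[OF i]] pre_sec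
        by (auto simp: disjoint_family_on_def)
      ultimately show ?thesis by simp
    qed
    ultimately have "AE \<omega> in M. \<omega> \<in> ?A \<longleftrightarrow> \<omega> \<in> S i" using S[OF i] by (intro conditional_prob_indicator[OF subalg])
    then show ?thesis using image AE_space
    proof eventually_elim
      case (elim \<omega>)
      have "emeasure (N' \<omega>) (\<Gamma> (s i)) = emeasure (N \<omega>) {u. (\<omega>, u) \<in> pre (\<Gamma> (s i))}"
        using elim(2,3) \<Gamma>b(1)[OF i] by (simp add: pre_sec)
      then show ?case using elim(1,3) by simp
    qed
  qed
  define D where "D i = pre (\<Gamma> (t i) - \<Gamma> (s i))" for i
  let ?Z = "\<lambda>i \<omega>. if \<omega> \<in> S i then \<infinity> else emeasure (N \<omega>) {u. (\<omega>, u) \<in> D i}"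
  let ?\<rho> = "\<lambda>i \<omega>. if \<omega> \<in> S i then \<infinity> else ennreal r * emeasure lborel {u. (\<omega>, u) \<in> D i}"
  have D: "\<And>i. i < n \<Longrightarrow> D i \<in> sets (G \<Otimes>\<^sub>M borel)" "\<And>i \<omega>. i < n \<Longrightarrow> \<omega> \<in> space M \<Longrightarrow> {u. (\<omega>, u) \<in> D i} \<subseteq> quadrant"
    using \<Gamma>b pre_sec by (auto simp: D_def intro!: pre)
  have Ddis: "disjoint_family_on (\<lambda>i. {u. (\<omega>, u) \<in> D i}) {..<n}" if "\<omega> \<in> space M" for \<omega>
    using disjoint_increments[OF \<Gamma> _ dis] st unfolding D_def pre_sec[OF that] disjoint_family_on_def by blast
  have law: "AE \<omega> in M. conditional_prob M G {\<omega>\<in>space M. \<forall>i\<in>J. ?Z i \<omega> \<in> C i} \<omega> =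
      (\<Prod>i\<in>J. measure_pmf.prob (poisson_law (?\<rho> i \<omega>)) (C i))"
    by (rule conditional_law(1)[OF D Ddis S J C])
  have Zm: "?Z i \<in> borel_measurable M" if "i < n" for i
    by (rule conditional_law(2)[OF D Ddis S J C that])
  \<comment> \<open>Counts follow this case distinction, and the scaled clock measure follows the
    corresponding one below; both cases are almost surely governed by the same event
    \<open>S i\<close>.\<close>
  have diff: "emeasure \<nu> (\<Gamma> (t i)) - emeasure \<nu> (\<Gamma> (s i)) = (if emeasure \<nu> (\<Gamma> (s i)) = \<infinity> then \<infinity> else emeasure \<nu> (\<Gamma> (t i) - \<Gamma> (s i)))"
    if i: "i < n" and \<nu>: "sets \<nu> = sets borel" for i \<nu>
  proof (cases "emeasure \<nu> (\<Gamma> (s i)) = \<infinity>")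
    case True
    have "emeasure \<nu> (\<Gamma> (s i)) \<le> emeasure \<nu> (\<Gamma> (t i))" using \<Gamma>b[OF i] \<nu> by (intro emeasure_mono) auto
    then show ?thesis using True by (simp add: top_unique)
  next
    case False
    then show ?thesis using \<Gamma>b[OF i] \<nu> by (subst emeasure_Diff) auto
  qed
  have X: "AE \<omega> in M. \<forall>i\<in>{..<n}. emeasure (N' \<omega>) (\<Gamma> (t i)) - emeasure (N' \<omega>) (\<Gamma> (s i)) = ?Z i \<omega>"
  proof (rule AE_ball_countable')
    fix i assume "i \<in> {..<n}"
    then have i: "i < n" by simp
    show "AE \<omega> in M. emeasure (N' \<omega>) (\<Gamma> (t i)) - emeasure (N' \<omega>) (\<Gamma> (s i)) = ?Z i \<omega>"
      using infin[OF i] image AE_space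
    proof eventually_elim
      case (elim \<omega>)
      have "emeasure (N' \<omega>) (\<Gamma> (t i) - \<Gamma> (s i)) = emeasure (N \<omega>) {u. (\<omega>, u) \<in> D i}"
        using elim(2) \<Gamma>b[OF i] unfolding D_def pre_sec[OF elim(3)] by blast
      then show ?case using elim(1) by (simp add: diff[OF i N's[OF elim(3)]])
    qed
  qed simp
  have Xm: "{x\<in>space M. \<forall>i\<in>J. emeasure (N' x) (\<Gamma> (t i)) - emeasure (N' x) (\<Gamma> (s i)) \<in> C i} \<in> sets M"
    by (rule nn_integral_prod_indicator(2)[OF fin, of "space M"]) (use N'm \<Gamma>b J C in auto)
  have Zms: "{\<omega>\<in>space M. \<forall>i\<in>J. ?Z i \<omega> \<in> C i} \<in> sets M"
    by (rule nn_integral_prod_indicator(2)[OF fin, of "space M"]) (use Zm J C in auto)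
  have "AE \<omega> in M. \<omega> \<in> {x\<in>space M. \<forall>i\<in>J. emeasure (N' x) (\<Gamma> (t i)) - emeasure (N' x) (\<Gamma> (s i)) \<in> C i} \<longleftrightarrow> \<omega> \<in> {\<omega>\<in>space M. \<forall>i\<in>J. ?Z i \<omega> \<in> C i}"
    using X
  proof eventually_elim
    case (elim \<omega>)
    then have "emeasure (N' \<omega>) (\<Gamma> (t i)) - emeasure (N' \<omega>) (\<Gamma> (s i)) = ?Z i \<omega>" if "i \<in> J" for i using J that by blast
    then show ?case by (simp cong: ball_cong)
  qed
  from conditional_prob_cong[OF subalg Xm Zms this] law AE_space show ?thesis
  proof eventually_elim
    case (elim \<omega>)
    have "ennreal r * emeasure (clock_measure \<omega>) (\<Gamma> (t i)) - ennreal r * emeasure (clock_measure \<omega>) (\<Gamma> (s i)) = ?\<rho> i \<omega>" if "i \<in> J" for i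
    proof -
      have i: "i < n" using that J by auto
      have lb: "emeasure lborel {u. (\<omega>, u) \<in> D i} = emeasure (clock_measure \<omega>) (\<Gamma> (t i) - \<Gamma> (s i))"
        using \<Gamma>b[OF i] unfolding D_def pre_sec[OF elim(3)] by (subst emeasure_clock_measure[OF elim(3)]) auto
      show ?thesis
      proof (cases "emeasure (clock_measure \<omega>) (\<Gamma> (s i)) = \<infinity>")
        case True
        have "emeasure (clock_measure \<omega>) (\<Gamma> (s i)) \<le> emeasure (clock_measure \<omega>) (\<Gamma> (t i))"
          using \<Gamma>b[OF i] by (intro emeasure_mono) auto
        then show ?thesis using True r elim(3) by (simp add: S_def space_G top_unique ennreal_mult_top)
      next
        case False
        then have "ennreal r * emeasure (clock_measure \<omega>) (\<Gamma> (t i)) - ennreal r * emeasure (clock_measure \<omega>) (\<Gamma> (s i)) =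
          ennreal r * (emeasure (clock_measure \<omega>) (\<Gamma> (t i)) - emeasure (clock_measure \<omega>) (\<Gamma> (s i)))"
          by (intro ennreal_right_diff_distrib[symmetric]) simp
        then show ?thesis using False by (simp add: diff[OF i sets_clock_measure] lb S_def)
      qed
    qed
    then show ?case unfolding elim(1,2) by (intro prod.cong) auto
  qed
qed

end

section \<open>Inverse stable subordinators\<close>

text \<open>Markov's inequality for exp (- L n) bounds the probability of staying below k by exp (k
  - n), which tends to 0.\<close>

lemma stable_subordinator_unbounded:
  assumes "prob_space M" and L: "stable_subordinator M \<alpha> L"
  shows "AE \<omega> in M. \<forall>k::nat. \<exists>n::nat. real k < L (real n) \<omega>"
  unfolding AE_all_countable
proof
  interpret prob_space M by fact
  fix k :: nat
  let ?A = "{\<omega>\<in>space M. \<forall>n::nat. L (real n) \<omega> \<le> real k}"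
  have Lm [measurable]: "L (real n) \<in> borel_measurable M" for n :: nat
    using L by (simp add: stable_subordinator_def)
  have A: "?A \<in> sets M" by measurable
  have bound: "emeasure M ?A \<le> ennreal (exp (real k - real n))" for n :: nat
  proof -
    \<comment> \<open>At s = 1 the exponent is just n, whatever \<alpha> is.\<close>
    have E: "expectation (\<lambda>\<omega>. exp (- 1 * L (real n) \<omega>)) = exp (- real n * 1 powr \<alpha>)"
      using L unfolding stable_subordinator_def by (metis of_nat_0_le_iff zero_le_one)
    \<comment> \<open>The integral of a function that is not integrable has the default value 0,
      which an exponential never takes.\<close>
    then have "integrable M (\<lambda>\<omega>. exp (- 1 * L (real n) \<omega>))"
      using not_integrable_integral_eq by (metis exp_not_eq_zero)
    then have nn: "(\<integral>\<^sup>+\<omega>. ennreal (exp (- 1 * L (real n) \<omega>)) \<partial>M) = ennreal (exp (- real n))"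
      using E by (subst nn_integral_eq_integral) auto
    have "ennreal (exp (- real k)) * emeasure M ?A = (\<integral>\<^sup>+\<omega>. ennreal (exp (- real k)) * indicator ?A \<omega> \<partial>M)"
      by (rule nn_integral_cmult_indicator[symmetric, OF A])
    also have "\<dots> \<le> (\<integral>\<^sup>+\<omega>. ennreal (exp (- 1 * L (real n) \<omega>)) \<partial>M)"
      by (intro nn_integral_mono) (auto split: split_indicator)
    finally have le: "ennreal (exp (- real k)) * emeasure M ?A \<le> ennreal (exp (- real n))" unfolding nn .
    have "emeasure M ?A = ennreal (exp (real k)) * (ennreal (exp (- real k)) * emeasure M ?A)"
      by (simp add: mult.assoc[symmetric] ennreal_mult[symmetric] exp_minus_inverse)
    also have "\<dots> \<le> ennreal (exp (real k)) * ennreal (exp (- real n))" by (intro mult_left_mono le) simp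
    also have "\<dots> = ennreal (exp (real k - real n))"
      by (simp add: ennreal_mult[symmetric] exp_add[symmetric])
    finally show ?thesis .
  qed
  have "(\<lambda>n. ennreal (exp (real k - real n))) \<longlonglongrightarrow> ennreal 0"
  proof (rule tendsto_ennrealI)
    have "(\<lambda>n. exp (real k) * exp (- 1 :: real) ^ n) \<longlonglongrightarrow> exp (real k) * 0"
      by (intro tendsto_mult_left LIMSEQ_power_zero) simp
    then show "(\<lambda>n. exp (real k - real n)) \<longlonglongrightarrow> 0"
      by (simp add: exp_of_nat_mult[symmetric] exp_add[symmetric])
  qed
  then have "emeasure M ?A \<le> ennreal 0"
    by (rule LIMSEQ_le_const) (use bound in blast)
  then have "emeasure M ?A = 0" by simp
  then show "AE \<omega> in M. \<exists>n::nat. real k < L (real n) \<omega>"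
    using A by (intro AE_I[of _ _ ?A]) (auto simp: not_less)
qed

text \<open>At a time beyond \<open>L k\<close>, every u at which \<open>L\<close> has passed that
  time is at least k, because \<open>L\<close> is monotone.\<close>

lemma inverse_stable_subordinator_unbounded:
  assumes M: "prob_space M" and Y: "inverse_stable_subordinator M \<alpha> Y"
  shows "AE \<omega> in M. \<forall>k::nat. \<exists>n::nat. real k \<le> Y (real n) \<omega>"
proof -
  obtain L where L: "stable_subordinator M \<alpha> L"
    and YL: "AE \<omega> in M. \<forall>t\<ge>0. Y t \<omega> = Inf {u. 0 \<le> u \<and> t < L u \<omega>}"
    using Y by (auto simp: inverse_stable_subordinator_def)
  have mono: "AE \<omega> in M. mono_on {0..} (\<lambda>t. L t \<omega>)"
    using L by (auto simp: stable_subordinator_def elim!: eventually_mono)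
  show ?thesis using stable_subordinator_unbounded[OF M L] mono YL
  proof eventually_elim
    case (elim \<omega>)
    show ?case
    proof
      fix k :: nat
      obtain n :: nat where n: "L (real k) \<omega> \<le> real n" using real_arch_simple by blast
      obtain m :: nat where m: "real n < L (real m) \<omega>" using elim(1) by blast
      have "real k \<le> Inf {u. 0 \<le> u \<and> real n < L u \<omega>}"
      proof (rule cInf_greatest)
        \<comment> \<open>This is where the unboundedness of \<open>L\<close> enters: the infimum of
          the empty set would carry no information.\<close>
        show "{u. 0 \<le> u \<and> real n < L u \<omega>} \<noteq> {}" using m by (auto intro!: exI[of _ "real m"])
        fix u assume u: "u \<in> {u. 0 \<le> u \<and> real n < L u \<omega>}"
        show "real k \<le> u"
        proof (rule ccontr)
          assume "\<not> real k \<le> u"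
          then have "L u \<omega> \<le> L (real k) \<omega>" using elim(2) u by (auto simp: mono_on_def)
          then show False using u n by auto
        qed
      qed
      then have "real k \<le> Y (real n) \<omega>" using elim(3) by simp
      then show "\<exists>n::nat. real k \<le> Y (real n) \<omega>" by blast
    qed
  qed
qed

section \<open>The algebra of the clock and the choice of good paths\<close>

lemma sets_process_algebra:
  "sets (process_algebra M Y) = sigma_sets (space M) {Y t -` B \<inter> space M | t B. 0 \<le> t \<and> B \<in> sets borel}"
  unfolding process_algebra_def by (intro sets_measure_of) blast

lemma sets_joint_algebra:
  "sets (joint_algebra M Y1 Y2) = sigma_sets (space M) (sets (process_algebra M Y1) \<union> sets (process_algebra M Y2))"
proof -
  have "space (process_algebra M Y) = space M" for Y :: "real \<Rightarrow> 'a \<Rightarrow> real"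
    unfolding process_algebra_def by (intro space_measure_of) blast
  then have "sets (process_algebra M Y1) \<union> sets (process_algebra M Y2) \<subseteq> Pow (space M)"
    using sets.sets_into_space by (metis (mono_tags, lifting) PowI Un_iff subsetI)
  then show ?thesis unfolding joint_algebra_def by (rule sets_measure_of)
qed

lemma space_joint_algebra: "space (joint_algebra M Y1 Y2) = space M"
  unfolding joint_algebra_def by (simp add: space_measure_of_conv)

lemma subalgebra_joint_algebra:
  assumes "\<And>t. 0 \<le> t \<Longrightarrow> Y1 t \<in> borel_measurable M" "\<And>t. 0 \<le> t \<Longrightarrow> Y2 t \<in> borel_measurable M"
  shows "subalgebra M (joint_algebra M Y1 Y2)"
proof -
  have "sets (process_algebra M Y) \<subseteq> sets M" if "\<And>t. 0 \<le> t \<Longrightarrow> Y t \<in> borel_measurable M" for Y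
    unfolding sets_process_algebra using that by (auto intro!: sets.sigma_sets_subset measurable_sets)
  then have "sets (process_algebra M Y1) \<union> sets (process_algebra M Y2) \<subseteq> sets M" using assms by simp
  then show ?thesis
    unfolding subalgebra_def space_joint_algebra sets_joint_algebra by (simp add: sets.sigma_sets_subset)
qed

lemma joint_algebra_measurable:
  assumes "0 \<le> t"
  shows "Y1 t \<in> borel_measurable (joint_algebra M Y1 Y2)" "Y2 t \<in> borel_measurable (joint_algebra M Y1 Y2)"
proof -
  have *: "Y t -` B \<inter> space M \<in> sets (process_algebra M Y)" if "B \<in> sets borel" for B and Y :: "real \<Rightarrow> 'a \<Rightarrow> real"
    unfolding sets_process_algebra using assms that by (intro sigma_sets.Basic) blast
  show "Y1 t \<in> borel_measurable (joint_algebra M Y1 Y2)" "Y2 t \<in> borel_measurable (joint_algebra M Y1 Y2)"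
    by (rule measurableI; simp add: space_joint_algebra sets_joint_algebra *)+
qed

text \<open>The intensity has to be measurable for the given paths at every \<omega>, including
  those with a bounded path, to which the inverse clock does not apply. So it is computed directly
  on half-open rectangles, where the mass is a product of path increments.\<close>

lemma product_path_measure_measurable:
  assumes Y: "\<And>t. 0 \<le> t \<Longrightarrow> Y1 t \<in> borel_measurable G" "\<And>t. 0 \<le> t \<Longrightarrow> Y2 t \<in> borel_measurable G"
    and path: "\<And>\<omega>. \<omega> \<in> space G \<Longrightarrow> continuous_on {0..} (\<lambda>t. Y1 t \<omega>) \<and> mono_on {0..} (\<lambda>t. Y1 t \<omega>)"
      "\<And>\<omega>. \<omega> \<in> space G \<Longrightarrow> continuous_on {0..} (\<lambda>t. Y2 t \<omega>) \<and> mono_on {0..} (\<lambda>t. Y2 t \<omega>)"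
    and B: "B \<in> sets borel"
  shows "(\<lambda>\<omega>. emeasure (product_path_measure Y1 Y2 \<omega>) B) \<in> borel_measurable G"
proof -
  have F: "mono (\<lambda>t. Y (max 0 t) \<omega>)" "continuous_on UNIV (\<lambda>t. Y (max 0 t) \<omega>)"
    if "continuous_on {0..} (\<lambda>t. Y t \<omega>) \<and> mono_on {0..} (\<lambda>t. Y t \<omega>)" for Y :: "real \<Rightarrow> 'a \<Rightarrow> real" and \<omega>
  proof -
    show "mono (\<lambda>t. Y (max 0 t) \<omega>)" using that by (auto simp: mono_on_def mono_def)
    show "continuous_on UNIV (\<lambda>t. Y (max 0 t) \<omega>)"
      by (rule continuous_on_compose2[OF conjunct1[OF that]]) (auto intro!: continuous_intros)
  qed
  have Ioc: "emeasure (path_measure Y \<omega>) {a<..b} = ennreal (Y (max 0 b) \<omega> - Y (max 0 a) \<omega>)"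
    and sf: "sigma_finite_measure (path_measure Y \<omega>)"
    if "continuous_on {0..} (\<lambda>t. Y t \<omega>) \<and> mono_on {0..} (\<lambda>t. Y t \<omega>)" and "a \<le> b" for Y :: "real \<Rightarrow> 'a \<Rightarrow> real" and \<omega> a b
  proof -
    have m: "\<And>x y. x \<le> y \<Longrightarrow> Y (max 0 x) \<omega> \<le> Y (max 0 y) \<omega>" using F(1)[where Y=Y and \<omega>=\<omega>, OF that(1)] by (simp add: mono_def)
    have c: "\<And>a. continuous (at_right a) (\<lambda>t. Y (max 0 t) \<omega>)"
      using F(2)[where Y=Y and \<omega>=\<omega>, OF that(1)] continuous_at_imp_continuous_at_within by (metis UNIV_I continuous_on_eq_continuous_at open_UNIV)
    show "emeasure (path_measure Y \<omega>) {a<..b} = ennreal (Y (max 0 b) \<omega> - Y (max 0 a) \<omega>)"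
      unfolding path_measure_def by (rule emeasure_interval_measure_Ioc[OF that(2) m c])
    show "sigma_finite_measure (path_measure Y \<omega>)"
      unfolding path_measure_def by (rule sigma_finite_interval_measure[OF m c])
  qed
  define Q where "Q n = {- real n<..real n} \<times> {- real n<..real n}" for n
  have rect: "emeasure (product_path_measure Y1 Y2 \<omega>) ({a<..b} \<times> {c<..d}) =
      ennreal (Y1 (max 0 b) \<omega> - Y1 (max 0 a) \<omega>) * ennreal (Y2 (max 0 d) \<omega> - Y2 (max 0 c) \<omega>)"
    if \<omega>: "\<omega> \<in> space G" and ab: "a \<le> b" "c \<le> d" for \<omega> a b c d
  proof -
    interpret Y2: sigma_finite_measure "path_measure Y2 \<omega>" by (rule sf[where Y=Y2 and \<omega>=\<omega>, OF path(2)[OF \<omega>] ab(2)])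
    have "emeasure (product_path_measure Y1 Y2 \<omega>) ({a<..b} \<times> {c<..d}) = emeasure (path_measure Y1 \<omega>) {a<..b} * emeasure (path_measure Y2 \<omega>) {c<..d}"
      unfolding product_path_measure_def
      by (rule Y2.emeasure_pair_measure_Times) (simp_all add: path_measure_def)
    then show ?thesis by (simp only: Ioc[where Y=Y1 and \<omega>=\<omega>, OF path(1)[OF \<omega>] ab(1)] Ioc[where Y=Y2 and \<omega>=\<omega>, OF path(2)[OF \<omega>] ab(2)])
  qed
  have rectm: "(\<lambda>\<omega>. emeasure (product_path_measure Y1 Y2 \<omega>) ({a<..b} \<times> {c<..d})) \<in> borel_measurable G"
    if "a \<le> b" "c \<le> d" for a b c d
  proof (subst measurable_cong[OF rect[OF _ that]], assumption)
    have [measurable]: "Y1 (max 0 t) \<in> borel_measurable G" "Y2 (max 0 t) \<in> borel_measurable G" for t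
      by (rule Y(1), simp, rule Y(2), simp)
    show "(\<lambda>\<omega>. ennreal (Y1 (max 0 b) \<omega> - Y1 (max 0 a) \<omega>) * ennreal (Y2 (max 0 d) \<omega> - Y2 (max 0 c) \<omega>)) \<in> borel_measurable G"
      by measurable
  qed
  have sets: "sets (product_path_measure Y1 Y2 \<omega>) = sets borel" for \<omega>
    unfolding product_path_measure_def path_measure_def borel_prod[symmetric] by (intro sets_pair_measure_cong sets_interval_measure)
  have gen: "sets borel = sigma_sets UNIV (range (atMost :: real \<times> real \<Rightarrow> _))" by (simp add: borel_eq_atMost)
  show ?thesis
  proof (rule kernel_measurable_generator[where E="range atMost" and \<Omega>=UNIV and W=Q])
    show "Int_stable (range (atMost :: real \<times> real \<Rightarrow> _))"
    proof (rule Int_stableI)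
      fix A B :: "(real \<times> real) set" assume "A \<in> range atMost" "B \<in> range atMost"
      then obtain a b where "A = {..a}" "B = {..b}" by blast
      then have "A \<inter> B = {..inf a b}" by auto
      then show "A \<inter> B \<in> range atMost" by blast
    qed
    show "sets (product_path_measure Y1 Y2 \<omega>) = sigma_sets UNIV (range atMost)" for \<omega>
      unfolding sets by (rule gen)
    show "Q n \<in> sigma_sets UNIV (range atMost)" for n
      unfolding gen[symmetric] Q_def by (intro borel_Times) auto
    show "incseq Q" unfolding Q_def by (intro incseq_SucI) auto
    show "(\<Union>n. Q n) = UNIV"
    proof -
      have "\<exists>n. x \<in> Q n" for x
      proof -
        obtain n where "max \<bar>fst x\<bar> \<bar>snd x\<bar> < real n" using reals_Archimedean2 by blast
        then show ?thesis by (intro exI[of _ n]) (cases x, auto simp: Q_def)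
      qed
      then show ?thesis by blast
    qed
    show "emeasure (product_path_measure Y1 Y2 \<omega>) (Q n) < \<infinity>" if "\<omega> \<in> space G" for \<omega> n
      unfolding Q_def by (subst rect[OF that]) (auto simp: ennreal_mult_less_top)
    show "(\<lambda>\<omega>. emeasure (product_path_measure Y1 Y2 \<omega>) (Q n)) \<in> borel_measurable G" for n
      unfolding Q_def by (intro rectm) auto
    show "(\<lambda>\<omega>. emeasure (product_path_measure Y1 Y2 \<omega>) (X \<inter> Q n)) \<in> borel_measurable G" if X: "X \<in> range atMost" for X n
    proof -
      obtain a where a: "X = {..a}" using X by blast
      \<comment> \<open>The outer maximum turns the rectangle into an empty one, in the form
        required by \<open>rectm\<close>, when a lies to the left of or below the square.\<close>
      have "X \<inter> Q n = {- real n<..max (- real n) (min (fst a) (real n))} \<times> {- real n<..max (- real n) (min (snd a) (real n))}"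
        unfolding a Q_def by (auto simp: less_eq_prod_def)
      then show ?thesis by (simp only:) (intro rectm, auto)
    qed
    show "B \<in> sigma_sets UNIV (range atMost)" using B unfolding gen .
  qed simp
qed

text \<open>Off the almost sure event \<open>U\<close> of unbounded paths, the paths are replaced by \<open>t \<mapsto> max 0 t\<close>.\<close>

lemma path_setup:
  assumes M: "prob_space M"
    and Y: "inverse_stable_subordinator M \<alpha>1 Y1" "inverse_stable_subordinator M \<alpha>2 Y2"
  obtains y1 y2 U where "time_change M (joint_algebra M Y1 Y2) y1 y2" and "AE \<omega> in M. \<omega> \<in> U"
    and "\<And>\<omega> t. \<omega> \<in> U \<Longrightarrow> y1 t \<omega> = Y1 (max 0 t) \<omega>" "\<And>\<omega> t. \<omega> \<in> U \<Longrightarrow> y2 t \<omega> = Y2 (max 0 t) \<omega>"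
proof -
  let ?G = "joint_algebra M Y1 Y2"
  \<comment> \<open>Only integer times and levels occur, so \<open>U\<close> belongs to the joint
    algebra and the replaced paths stay measurable over it.\<close>
  define U where "U = {\<omega>\<in>space ?G. (\<forall>k::nat. \<exists>n::nat. real k \<le> Y1 (real n) \<omega>) \<and> (\<forall>k::nat. \<exists>n::nat. real k \<le> Y2 (real n) \<omega>)}"
  define y where "y Y t \<omega> = (if \<omega> \<in> U then Y (max 0 t) \<omega> else max 0 t)" for Y :: "real \<Rightarrow> 'a \<Rightarrow> real" and t \<omega>
  have Um: "U \<in> sets ?G"
  proof -
    have [measurable]: "Y1 (real n) \<in> borel_measurable ?G" "Y2 (real n) \<in> borel_measurable ?G" for n :: nat
      by (rule joint_algebra_measurable, simp)+
    show ?thesis unfolding U_def by measurable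
  qed
  have ym: "y Y t \<in> borel_measurable ?G" if "\<And>t. 0 \<le> t \<Longrightarrow> Y t \<in> borel_measurable ?G" for Y t
  proof -
    have [measurable]: "Y (max 0 t) \<in> borel_measurable ?G" by (rule that) simp
    note [measurable] = Um
    show ?thesis unfolding y_def by measurable
  qed
  have good: "good_path (\<lambda>t. y Y t \<omega>)"
    if \<omega>: "\<omega> \<in> space M" and Y: "inverse_stable_subordinator M \<alpha> Y" and unb: "\<omega> \<in> U \<Longrightarrow> \<forall>k::nat. \<exists>n::nat. real k \<le> Y (real n) \<omega>" for Y \<alpha> \<omega>
  proof (cases "\<omega> \<in> U")
    case True
    have p: "Y 0 \<omega> = 0" "continuous_on {0..} (\<lambda>t. Y t \<omega>)" "mono_on {0..} (\<lambda>t. Y t \<omega>)"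
      using Y \<omega> by (auto simp: inverse_stable_subordinator_def)
    have "mono (\<lambda>t. Y (max 0 t) \<omega>)" using p(3) by (auto simp: mono_on_def mono_def)
    moreover have "continuous_on UNIV (\<lambda>t. Y (max 0 t) \<omega>)"
      by (rule continuous_on_compose2[OF p(2)]) (auto intro!: continuous_intros)
    moreover have "\<exists>t. c \<le> Y (max 0 t) \<omega>" for c
    proof -
      obtain k :: nat where k: "c \<le> real k" using real_arch_simple by blast
      obtain n :: nat where "real k \<le> Y (real n) \<omega>" using unb[OF True] by blast
      then show ?thesis using k by (intro exI[of _ "real n"]) simp
    qed
    ultimately show ?thesis using True p(1) by (simp add: good_path_def y_def max_def)
  next
    case False
    have "mono (\<lambda>t. max 0 (t::real))" by (auto simp: mono_def)
    moreover have "continuous_on UNIV (\<lambda>t. max 0 (t::real))" by (intro continuous_intros)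
    moreover have "\<exists>t. c \<le> max 0 t" for c :: real by (intro exI[of _ c]) simp
    ultimately show ?thesis using False by (simp add: good_path_def y_def max_def)
  qed
  have YM: "\<And>t. 0 \<le> t \<Longrightarrow> Y1 t \<in> borel_measurable M" "\<And>t. 0 \<le> t \<Longrightarrow> Y2 t \<in> borel_measurable M"
    using Y by (auto simp: inverse_stable_subordinator_def)
  show thesis
  proof (rule that[of "y Y1" "y Y2" U])
    show "time_change M ?G (y Y1) (y Y2)"
    proof (intro time_change.intro time_change_axioms.intro M)
      show "subalgebra M ?G" by (rule subalgebra_joint_algebra[OF YM])
      show "y Y1 t \<in> borel_measurable ?G" "y Y2 t \<in> borel_measurable ?G" for t
        by (rule ym, rule joint_algebra_measurable, assumption)+
      show "good_path (\<lambda>t. y Y1 t \<omega>)" if "\<omega> \<in> space M" for \<omega>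
        by (rule good[OF that Y(1)]) (simp add: U_def)
      show "good_path (\<lambda>t. y Y2 t \<omega>)" if "\<omega> \<in> space M" for \<omega>
        by (rule good[OF that Y(2)]) (simp add: U_def)
    qed
    show "AE \<omega> in M. \<omega> \<in> U"
      using inverse_stable_subordinator_unbounded[OF M Y(1)] inverse_stable_subordinator_unbounded[OF M Y(2)] AE_space
      by eventually_elim (simp add: U_def space_joint_algebra)
  qed (simp_all add: y_def)
qed

section \<open>The characterisation through increasing sets\<close>

theorem theorem4p3:
  fixes M :: "'w measure"
    and Y1 Y2 :: "real \<Rightarrow> 'w \<Rightarrow> real"
    and N :: "'w \<Rightarrow> (real \<times> real) measure"
    and \<alpha>1 \<alpha>2 r :: real
  assumes "prob_space M"
    and "0 < \<alpha>1" "\<alpha>1 < 1" "0 < \<alpha>2" "\<alpha>2 < 1"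
    and "inverse_stable_subordinator M \<alpha>1 Y1"
    and "inverse_stable_subordinator M \<alpha>2 Y2"
    and "prob_space.indep_set M (sets (process_algebra M Y1)) (sets (process_algebra M Y2))"
    and "0 < r"
    and "random_simple_counting_measure M N"
  shows "fractional_poisson_random_field M Y1 Y2 r N \<longleftrightarrow>
    (\<forall>\<Gamma>. increasing_set \<Gamma> \<longrightarrow>
       conditionally_poisson_process M (joint_algebra M Y1 Y2)
         (\<lambda>t \<omega>. emeasure (N \<omega>) (\<Gamma> t))
         (\<lambda>t \<omega>. ennreal r * emeasure (product_path_measure Y1 Y2 \<omega>) (\<Gamma> t)))"
proof -
  note Y = assms(6,7) and r = assms(9)
  have N: "random_counting_measure M N" using assms(10) by (simp add: random_simple_counting_measure_def)
  let ?G = "joint_algebra M Y1 Y2"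
  obtain y1 y2 U where tc: "time_change M ?G y1 y2" and U: "AE \<omega> in M. \<omega> \<in> U"
    and yU: "\<And>\<omega> t. \<omega> \<in> U \<Longrightarrow> y1 t \<omega> = Y1 (max 0 t) \<omega>" "\<And>\<omega> t. \<omega> \<in> U \<Longrightarrow> y2 t \<omega> = Y2 (max 0 t) \<omega>"
    by (rule path_setup[OF assms(1) Y]) blast
  interpret time_change M ?G y1 y2 by (rule tc)
  \<comment> \<open>On \<open>U\<close> the good paths are the given ones, so almost sure statements
    about the two clock measures are interchangeable.\<close>
  have clock: "clock_measure \<omega> = product_path_measure Y1 Y2 \<omega>" if "\<omega> \<in> U" for \<omega>
    by (simp add: clock_measure_def product_path_measure_def path_measure_def yU[OF that])
  have Nm: "(\<lambda>\<omega>. emeasure (N \<omega>) B) \<in> borel_measurable M" if "B \<in> sets borel" for B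
    using N that by (auto simp: random_counting_measure_def)
  show ?thesis
  proof (intro iffI allI impI)
    fix \<Gamma> :: "real \<Rightarrow> (real \<times> real) set"
    assume \<Gamma>: "increasing_set \<Gamma>" and "fractional_poisson_random_field M Y1 Y2 r N"
    then obtain N0 where N0: "poisson_random_field M r N0" "indep_set (sets (field_algebra M N0)) (sets ?G)"
      and N0_rect: "AE \<omega> in M. \<forall>t1\<ge>0. \<forall>t2\<ge>0. emeasure (N \<omega>) ({0..t1} \<times> {0..t2}) = emeasure (N0 \<omega>) ({0..Y1 t1 \<omega>} \<times> {0..Y2 t2 \<omega>})"
      by (auto simp: fractional_poisson_random_field_def)
    interpret prf_time_change M ?G y1 y2 N0 r
      by (intro prf_time_change.intro prf_time_change_axioms.intro tc N0)
    have rect: "AE \<omega> in M. \<forall>t1\<ge>0. \<forall>t2\<ge>0. emeasure (N \<omega>) ({0..t1} \<times> {0..t2}) = emeasure (N0 \<omega>) ({0..y1 t1 \<omega>} \<times> {0..y2 t2 \<omega>})"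
      using N0_rect U by eventually_elim (simp add: yU)
    have law: "AE \<omega> in M. conditional_prob M ?G {x\<in>space M. \<forall>i\<in>J. emeasure (N x) (\<Gamma> (t i)) - emeasure (N x) (\<Gamma> (s i)) \<in> C i} \<omega> =
      (\<Prod>i\<in>J. measure_pmf.prob (poisson_law (ennreal r * emeasure (product_path_measure Y1 Y2 \<omega>) (\<Gamma> (t i)) -
         ennreal r * emeasure (product_path_measure Y1 Y2 \<omega>) (\<Gamma> (s i)))) (C i))"
      if "\<And>i. i < n \<Longrightarrow> 0 \<le> s i \<and> s i < t i" "disjoint_family_on (\<lambda>i. {s i<..t i}) {..<n}" "J \<subseteq> {..<n}" "\<And>i. i \<in> J \<Longrightarrow> C i \<in> sets borel"
      for n :: nat and s t J C
    proof -
      have "AE \<omega> in M. conditional_prob M ?G {x\<in>space M. \<forall>i\<in>J. emeasure (N x) (\<Gamma> (t i)) - emeasure (N x) (\<Gamma> (s i)) \<in> C i} \<omega> =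
        (\<Prod>i\<in>J. measure_pmf.prob (poisson_law (ennreal r * emeasure (clock_measure \<omega>) (\<Gamma> (t i)) -
           ennreal r * emeasure (clock_measure \<omega>) (\<Gamma> (s i)))) (C i))"
        by (rule increments_law[OF N r rect \<Gamma>]) (rule that | assumption)+
      then show ?thesis using U by eventually_elim (simp add: clock)
    qed
    show "conditionally_poisson_process M ?G (\<lambda>t \<omega>. emeasure (N \<omega>) (\<Gamma> t))
         (\<lambda>t \<omega>. ennreal r * emeasure (product_path_measure Y1 Y2 \<omega>) (\<Gamma> t))"
      unfolding conditionally_poisson_process_def
    proof (intro conjI allI impI ballI)
      fix t :: real assume t: "0 \<le> t"
      have path: "continuous_on {0..} (\<lambda>t. Y t \<omega>) \<and> mono_on {0..} (\<lambda>t. Y t \<omega>)"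
        if "inverse_stable_subordinator M \<alpha> Y" "\<omega> \<in> space ?G" for Y \<alpha> \<omega>
        using that by (auto simp: inverse_stable_subordinator_def space_G)
      show "(\<lambda>\<omega>. ennreal r * emeasure (product_path_measure Y1 Y2 \<omega>) (\<Gamma> t)) \<in> borel_measurable ?G"
        by (intro borel_measurable_times_ennreal borel_measurable_const product_path_measure_measurable
            joint_algebra_measurable path[OF Y(1)] path[OF Y(2)] increasing_set_closed[OF \<Gamma> t])
    next
      fix \<omega> assume "\<omega> \<in> space M"
      have sets: "sets (product_path_measure Y1 Y2 \<omega>) = sets borel"
        unfolding product_path_measure_def path_measure_def borel_prod[symmetric] by (intro sets_pair_measure_cong sets_interval_measure)
      show "mono_on {0..} (\<lambda>t. ennreal r * emeasure (product_path_measure Y1 Y2 \<omega>) (\<Gamma> t))"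
        by (intro mono_onI mult_left_mono emeasure_mono increasing_set_mono[OF \<Gamma>])
          (auto simp: sets increasing_set_closed[OF \<Gamma>])
    next
      \<comment> \<open>As a degenerate rectangle the origin falls under the time-change formula
        with t1 = t2 = 0.\<close>
      have G0: "\<Gamma> 0 = {0..0} \<times> {0..0}" by (simp add: increasing_set_0[OF \<Gamma>])
      have "AE \<omega> in M. emeasure (N0 \<omega>) {(0, 0)} = 0"
      proof -
        have "measure M {\<omega>\<in>space M. emeasure (N0 \<omega>) {(0, 0)} \<in> {0}} = measure_pmf.prob (poisson_law (ennreal r * emeasure lborel {(0 :: real, 0 :: real)})) {0}"
          using N0(1)[unfolded poisson_random_field_def, THEN conjunct2, THEN conjunct1, THEN bspec, THEN mp, THEN bspec, of "{(0, 0)}" "{0}"]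
          by (simp add: quadrant_def)
        then have "prob {\<omega>\<in>space M. emeasure (N0 \<omega>) {(0, 0)} = 0} = 1"
          by (simp add: poisson_law_def)
        moreover have "{\<omega>\<in>space M. emeasure (N0 \<omega>) {(0, 0)} = 0} \<in> events"
          using N_measurable[of "{(0, 0)}"] by simp
        ultimately show ?thesis by (simp add: prob_Collect_eq_1)
      qed
      then show "AE \<omega> in M. emeasure (N \<omega>) (\<Gamma> 0) = 0"
        using rect AE_space
      proof eventually_elim
        case (elim \<omega>)
        have "y1 0 \<omega> = 0" "y2 0 \<omega> = 0" using y_good[OF elim(3)] unfolding good_path_def by blast+
        then show "emeasure (N \<omega>) (\<Gamma> 0) = 0" using elim(2)[rule_format, of 0 0] elim(1) by (simp add: G0)
      qed
    next
      fix n :: nat and s t :: "nat \<Rightarrow> real"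
      assume "(\<forall>i<n. 0 \<le> s i \<and> s i < t i) \<and> disjoint_family_on (\<lambda>i. {s i<..t i}) {..<n}"
      then have st: "\<And>i. i < n \<Longrightarrow> 0 \<le> s i \<and> s i < t i" and dis: "disjoint_family_on (\<lambda>i. {s i<..t i}) {..<n}" by auto
      \<comment> \<open>The marginal laws are the joint law for one-element index sets; conditional
        independence follows by comparing the joint law with their product.\<close>
      have single: "AE \<omega> in M. conditional_prob M ?G {x\<in>space M. emeasure (N x) (\<Gamma> (t i)) - emeasure (N x) (\<Gamma> (s i)) \<in> C} \<omega> =
          measure_pmf.prob (poisson_law (ennreal r * emeasure (product_path_measure Y1 Y2 \<omega>) (\<Gamma> (t i)) -
            ennreal r * emeasure (product_path_measure Y1 Y2 \<omega>) (\<Gamma> (s i)))) C"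
        if "i < n" "C \<in> sets borel" for i C
        using law[OF st dis, of "{i}" "\<lambda>_. C"] that by simp
      show "conditionally_indep_vars M ?G (\<lambda>i \<omega>. emeasure (N \<omega>) (\<Gamma> (t i)) - emeasure (N \<omega>) (\<Gamma> (s i))) {..<n}"
        unfolding conditionally_indep_vars_def
      proof (intro conjI ballI allI impI)
        fix i assume "i \<in> {..<n}"
        then show "(\<lambda>\<omega>. emeasure (N \<omega>) (\<Gamma> (t i)) - emeasure (N \<omega>) (\<Gamma> (s i))) \<in> borel_measurable M"
          using st[of i] by (intro borel_measurable_minus_ennreal Nm increasing_set_closed[OF \<Gamma>]) auto
      next
        fix J and C :: "nat \<Rightarrow> ennreal set" assume J: "J \<subseteq> {..<n} \<and> finite J \<and> (\<forall>i\<in>J. C i \<in> sets borel)"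
        have "AE \<omega> in M. \<forall>i\<in>J. conditional_prob M ?G {x\<in>space M. emeasure (N x) (\<Gamma> (t i)) - emeasure (N x) (\<Gamma> (s i)) \<in> C i} \<omega> =
          measure_pmf.prob (poisson_law (ennreal r * emeasure (product_path_measure Y1 Y2 \<omega>) (\<Gamma> (t i)) -
            ennreal r * emeasure (product_path_measure Y1 Y2 \<omega>) (\<Gamma> (s i)))) (C i)"
          using J by (intro AE_ball_countable' single countable_finite) auto
        moreover have "AE \<omega> in M. conditional_prob M ?G {x\<in>space M. \<forall>i\<in>J. emeasure (N x) (\<Gamma> (t i)) - emeasure (N x) (\<Gamma> (s i)) \<in> C i} \<omega> =
          (\<Prod>i\<in>J. measure_pmf.prob (poisson_law (ennreal r * emeasure (product_path_measure Y1 Y2 \<omega>) (\<Gamma> (t i)) -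
         ennreal r * emeasure (product_path_measure Y1 Y2 \<omega>) (\<Gamma> (s i)))) (C i))"
          using J by (intro law[OF st dis]) auto
        ultimately show "AE \<omega> in M. conditional_prob M ?G {x\<in>space M. \<forall>i\<in>J. emeasure (N x) (\<Gamma> (t i)) - emeasure (N x) (\<Gamma> (s i)) \<in> C i} \<omega> =
          (\<Prod>i\<in>J. conditional_prob M ?G {x\<in>space M. emeasure (N x) (\<Gamma> (t i)) - emeasure (N x) (\<Gamma> (s i)) \<in> C i} \<omega>)"
          by eventually_elim (simp cong: prod.cong)
      qed
      show "conditionally_poisson M ?G (\<lambda>\<omega>. emeasure (N \<omega>) (\<Gamma> (t i)) - emeasure (N \<omega>) (\<Gamma> (s i)))
         (\<lambda>\<omega>. ennreal r * emeasure (product_path_measure Y1 Y2 \<omega>) (\<Gamma> (t i)) - ennreal r * emeasure (product_path_measure Y1 Y2 \<omega>) (\<Gamma> (s i)))"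
        if "i < n" for i
        unfolding conditionally_poisson_def by (intro ballI single that)
    qed
  next
    assume R: "\<forall>\<Gamma>. increasing_set \<Gamma> \<longrightarrow>
       conditionally_poisson_process M ?G (\<lambda>t \<omega>. emeasure (N \<omega>) (\<Gamma> t))
         (\<lambda>t \<omega>. ennreal r * emeasure (product_path_measure Y1 Y2 \<omega>) (\<Gamma> t))"
    have "grid_poisson M ?G y1 y2 N r"
    proof (rule grid_poissonI[OF N r])
      \<comment> \<open>Any increasing set would do here: all of them start at the origin, where the
        process is 0 almost surely.\<close>
      obtain \<Gamma> where \<Gamma>: "increasing_set \<Gamma>" by (rule grid_increasing_set)
      then have "AE \<omega> in M. emeasure (N \<omega>) (\<Gamma> 0) = 0"
        using R unfolding conditionally_poisson_process_def by blast
      moreover have "\<Gamma> 0 = {(0, 0)}" by (rule increasing_set_0[OF \<Gamma>])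
      ultimately show "AE \<omega> in M. emeasure (N \<omega>) {(0, 0)} = 0" by simp
    next
      fix \<Gamma> and n :: nat and C :: "nat \<Rightarrow> ennreal set"
      assume \<Gamma>: "increasing_set \<Gamma>" and C: "\<And>i. i < n \<Longrightarrow> C i \<in> sets borel"
      let ?X = "\<lambda>i x. emeasure (N x) (\<Gamma> (real i + 1)) - emeasure (N x) (\<Gamma> (real i))"
      let ?m = "\<lambda>i \<omega>. ennreal r * emeasure (product_path_measure Y1 Y2 \<omega>) (\<Gamma> (real i + 1)) - ennreal r * emeasure (product_path_measure Y1 Y2 \<omega>) (\<Gamma> (real i))"
      have dis: "disjoint_family_on (\<lambda>i. {real i<..real i + 1}) {..<n}"
        unfolding disjoint_family_on_def
      proof (intro ballI impI)
        fix i j :: nat assume "i \<noteq> j"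
        then have "real i + 1 \<le> real j \<or> real j + 1 \<le> real i" by linarith
        then show "{real i<..real i + 1} \<inter> {real j<..real j + 1} = {}" by auto
      qed
      have CP: "conditionally_poisson_process M ?G (\<lambda>t \<omega>. emeasure (N \<omega>) (\<Gamma> t))
         (\<lambda>t \<omega>. ennreal r * emeasure (product_path_measure Y1 Y2 \<omega>) (\<Gamma> t))" using R \<Gamma> by blast
      have "conditionally_indep_vars M ?G ?X {..<n} \<and> (\<forall>i<n. conditionally_poisson M ?G (?X i) (?m i))"
        by (rule CP[unfolded conditionally_poisson_process_def, THEN conjunct2, THEN conjunct2, THEN conjunct2,
              THEN spec, THEN spec, THEN spec, THEN mp, of n real "\<lambda>i. real i + 1"]) (use dis in simp)
      then have ind: "conditionally_indep_vars M ?G ?X {..<n}" and poi: "\<And>i. i < n \<Longrightarrow> conditionally_poisson M ?G (?X i) (?m i)"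
        by auto
      have 1: "AE \<omega> in M. conditional_prob M ?G {x\<in>space M. \<forall>i\<in>{..<n}. ?X i x \<in> C i} \<omega> =
          (\<Prod>i\<in>{..<n}. conditional_prob M ?G {x\<in>space M. ?X i x \<in> C i} \<omega>)"
        by (rule ind[unfolded conditionally_indep_vars_def, THEN conjunct2, THEN spec, THEN spec, THEN mp]) (use C in auto)
      have 2: "AE \<omega> in M. \<forall>i\<in>{..<n}. conditional_prob M ?G {x\<in>space M. ?X i x \<in> C i} \<omega> = measure_pmf.prob (poisson_law (?m i \<omega>)) (C i)"
        using poi C by (intro AE_ball_countable') (auto simp: conditionally_poisson_def)
      show "AE \<omega> in M. conditional_prob M ?G {x\<in>space M. \<forall>i<n. ?X i x \<in> C i} \<omega> =
        (\<Prod>i<n. measure_pmf.prob (poisson_law (ennreal r * emeasure (clock_measure \<omega>) (\<Gamma> (real i + 1)) -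
           ennreal r * emeasure (clock_measure \<omega>) (\<Gamma> (real i)))) (C i))"
        using 1 2 U
      proof eventually_elim
        case (elim \<omega>)
        have "(\<Prod>i<n. conditional_prob M ?G {x\<in>space M. ?X i x \<in> C i} \<omega>) = (\<Prod>i<n. measure_pmf.prob (poisson_law (?m i \<omega>)) (C i))"
          using elim(2) by (intro prod.cong) auto
        then show ?case using elim(1) by (simp add: clock[OF elim(3)] Ball_def)
      qed
    qed
    then interpret grid_poisson M ?G y1 y2 N r .
    \<comment> \<open>The witness is built with the good paths, and \<open>U\<close> turns its
      time-change formula into one for \<open>Y1\<close> and \<open>Y2\<close>.\<close>
    have "AE \<omega> in M. \<forall>t1\<ge>0. \<forall>t2\<ge>0. emeasure (N \<omega>) ({0..t1} \<times> {0..t2}) = emeasure (unclocked \<omega>) ({0..Y1 t1 \<omega>} \<times> {0..Y2 t2 \<omega>})"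
      using unclocked_rectangles U by eventually_elim (simp add: yU)
    then show "fractional_poisson_random_field M Y1 Y2 r N"
      unfolding fractional_poisson_random_field_def using unclocked_prf unclocked_indep_set by blast
  qed
qed

end
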